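(* Let $M$ be a Riemannian manifold with a vector field $\zeta$, a function $\beta\in C(M)$ and a conformal Killing vector field $\tau$, with associated algebra $C(M)\rtimes_\tau\mathbb{R}$ and calculus $\Omega^1(C(M)\rtimes_\tau\mathbb{R})$ as described in the context. Define the induced spacetime wave operator $\square$ on $C(M)\rtimes_\tau\mathbb{R}$ by \[ \mathrm df=\bar{\mathrm d}f+(\partial_0f)\,\mathrm dt+\tfrac{\lambda}{2}(\square f)\,\theta'.\] Then: (1) $\square f(t)=(\bar\Delta f)(t+\lambda\alpha)+2\Delta_0f(t)$ on normal ordered $f(t)=\sum_nf_nt^n$. (2) In the classical limit, $\lim_{\lambda\to0}\square f=\bar\Delta f+\beta\ddot f$. (3) If $\beta$ is invertible and $\zeta^*=-\frac12\beta^{-1}\bar{\mathrm d}\beta$, then the classical limit of $\square$ is the Laplace-Beltrami operator on $M\times\mathbb{R}$ for the static metric $\beta^{-1}\bar{\mathrm d}t\otimes\bar{\mathrm d}t+\bar g$.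
   Context: $C(M)$ is the algebra of smooth functions, $\bar\Omega^1$ the classical 1-forms, $\bar{\mathrm d}$ the classical exterior derivative, $\bar g$ the metric, $(\ ,\ )$ the inverse metric on 1-forms, $\bar\Delta_{LB}$ the Laplace-Beltrami operator, $\bar\Delta f=\bar\Delta_{LB}f+\zeta(f)$, $\zeta^*=\bar g(\zeta)$, $n=\dim M$, $\alpha=\frac2n\mathrm{div}(\tau)-1$ (so $\bar{\mathcal L}_\tau\bar g=(1+\alpha)\bar g$). $\lambda$ is the deformation parameter. $C(M)\rtimes_\tau\mathbb{R}$ is generated by $C(M)$ and $t$ with $[f,t]=\lambda\tau(f)$; elements are uniquely written in normal ordered form $f=\sum_nf_nt^n$ with $f_n\in C(M)$ (finite sums). Via normal ordering it is identified as a vector space with polynomials in $t$ with coefficients in $C(M)$; limits are taken coefficientwise and $\ddot f$ is the usual second derivative in $t$. For $a\in C(M)$, $f(t+\lambda a)$ means $\sum_nf_n(t+\lambda a)^n$ computed in the algebra. $\bar\Delta f=\sum_n(\bar\Delta f_n)t^n$ and $\bar{\mathrm d}f=\sum_n(\bar{\mathrm d}f_n)t^n$. The calculus $\Omega^1(C(M)\rtimes_\tau\mathbb{R})$ is the bimodule generated by $\bar\Omega^1,\theta',\mathrm dt$ (elements uniquely written with coefficients in $C(M)$ on the left and powers of $t$ on the right of these generators), with, for $\omega\in\bar\Omega^1$, $f\in C(M)$, \[[\omega,f]=\lambda(\omega,\bar{\mathrm d}f)\theta',\quad[\theta',f]=0,\quad[\theta',t]=\alpha\lambda\theta',\quad[f,\mathrm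 dt]=\lambda\,\mathrm df,\quad[\mathrm dt,t]=\beta\lambda\theta'-\lambda\,\mathrm dt,\] \[[\omega,t]=\lambda(\bar{\mathcal L}_\tau-\mathrm{id})\omega-\lambda^2\tfrac{n-2}4(\bar{\mathrm d}\alpha,\omega)\theta'-\tfrac{\lambda^2}2(\bar{\mathcal L}_\tau\zeta^*,\omega)\theta',\] and derivation $\mathrm d$ with $\mathrm df=\bar{\mathrm d}f+\frac\lambda2(\bar\Delta f)\theta'$ for $f\in C(M)$. $\partial_0f(t)=\lambda^{-1}(f(t)-f(t-\lambda))$. $\Delta_0$ is the left $C(M)$-linear operator determined by $\mathrm d(t^k)=(\partial_0t^k)\mathrm dt+\lambda(\Delta_0t^k)\theta'$; locally it is given by \[\Delta_0f(t)=\lambda^{-2}\Big(\nu f(t+\lambda\alpha)+\mu f\big(t-\lambda(\tfrac\beta\mu-\alpha)\big)-(\nu+\mu)f\big(t+\lambda(\alpha-\tfrac\beta{\nu+\mu})\big)\Big)\] for any $\mu,\nu\in C(M)$ with $\tau(\mu)=\beta-(1+\alpha)\mu$, $\tau(\nu)=\mu-\alpha\nu$ for which the quotients make sense (functions of $M$ standing in front multiply from the left, and $f(t+\lambda a)=\sum_nf_n(t+\lambda a)^n$); it does not depend on the choice of $\mu,\nu$. *)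

theory Defs
  imports
    "HOL-Analysis.Analysis"
    "HOL-Algebra.Ring"
    "HOL-Library.Function_Algebras"
begin

text \<open>
  Functions, normal ordered elements and differential forms are added and multiplied
  pointwise, with the instances of \<open>Function_Algebras\<close> (and \<open>Product_Plus\<close> for pairs);
  \<open>1 :: 'm \<Rightarrow> real\<close> is the constant function.
\<close>

section \<open>Smooth manifolds\<close>

text \<open>\<open>iter_deriv vs f\<close> is the iterated directional derivative of \<open>f\<close> along the list \<open>vs\<close>.\<close>

primrec iter_deriv ::
  "'a::euclidean_space list \<Rightarrow> ('a \<Rightarrow> 'b::real_normed_vector) \<Rightarrow> 'a \<Rightarrow> 'b" where
  "iter_deriv [] f = f"
| "iter_deriv (v # vs) f = iter_deriv vs (\<lambda>x. frechet_derivative f (at x) v)"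

text \<open>Infinite differentiability; only used for open \<open>S\<close>.\<close>

definition smooth_on :: "'a::euclidean_space set \<Rightarrow> ('a \<Rightarrow> 'b::real_normed_vector) \<Rightarrow> bool" where
  "smooth_on S f \<longleftrightarrow> (\<forall>vs. \<forall>x\<in>S. iter_deriv vs f differentiable (at x))"

text \<open>
  A chart is a pair of its domain and its coordinate map. A manifold modelled on \<open>'e\<close> is given
  by an atlas indexed by the points of \<open>'m\<close>: \<open>\<kappa> p\<close> is a chart around \<open>p\<close>. The tangent space at
  \<open>p\<close> is then identified with \<open>'e\<close> by means of the chart \<open>\<kappa> p\<close>, so that a vector field is a
  function \<open>'m \<Rightarrow> 'e\<close>, a 1-form a function \<open>'m \<Rightarrow> 'e \<Rightarrow> real\<close> and a metric a
  function \<open>'m \<Rightarrow> 'e \<Rightarrow> 'e \<Rightarrow> real\<close>.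
\<close>

type_synonym ('m, 'e) chart = "'m set \<times> ('m \<Rightarrow> 'e)"
type_synonym ('m, 'e) mfd = "'m \<Rightarrow> ('m, 'e) chart"

definition coord_inv :: "('m, 'e) chart \<Rightarrow> 'e \<Rightarrow> 'm" where
  "coord_inv c = inv_into (fst c) (snd c)"

definition is_chart :: "('m::topological_space, 'e::euclidean_space) chart \<Rightarrow> bool" where
  "is_chart c \<longleftrightarrow> open (fst c) \<and> open (snd c ` fst c) \<and>
     homeomorphism (fst c) (snd c ` fst c) (snd c) (coord_inv c)"

definition smooth_manifold ::
  "('m::{t2_space,second_countable_topology}, 'e::euclidean_space) mfd \<Rightarrow> bool" where
  "smooth_manifold \<kappa> \<longleftrightarrow>
     (\<forall>p. is_chart (\<kappa> p) \<and> p \<in> fst (\<kappa> p)) \<and>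
     (\<forall>p q. smooth_on (snd (\<kappa> p) ` (fst (\<kappa> p) \<inter> fst (\<kappa> q))) (snd (\<kappa> q) \<circ> coord_inv (\<kappa> p)))"

definition coord_image :: "('m, 'e) mfd \<Rightarrow> 'm \<Rightarrow> 'e set" where
  "coord_image \<kappa> p = snd (\<kappa> p) ` fst (\<kappa> p)"

definition coord_at :: "('m, 'e) mfd \<Rightarrow> 'm \<Rightarrow> 'e" where
  "coord_at \<kappa> p = snd (\<kappa> p) p"

text \<open>\<open>tchange \<kappa> a b q\<close> sends the coordinates with respect to \<open>\<kappa> a\<close> of a tangent vector at \<open>q\<close> to
  its coordinates with respect to \<open>\<kappa> b\<close>.\<close>

definition tchange ::
  "('m, 'e::euclidean_space) mfd \<Rightarrow> 'm \<Rightarrow> 'm \<Rightarrow> 'm \<Rightarrow> 'e \<Rightarrow> 'e" where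
  "tchange \<kappa> a b q = frechet_derivative (snd (\<kappa> b) \<circ> coord_inv (\<kappa> a)) (at (snd (\<kappa> a) q))"

text \<open>Coordinate expressions of functions, vector fields, 1-forms and metrics in the chart
  \<open>\<kappa> p\<close>, as functions of the coordinate \<open>x\<close>.\<close>

definition fun_rep :: "('m, 'e) mfd \<Rightarrow> ('m \<Rightarrow> real) \<Rightarrow> 'm \<Rightarrow> 'e \<Rightarrow> real" where
  "fun_rep \<kappa> f p x = f (coord_inv (\<kappa> p) x)"

definition vf_rep :: "('m, 'e::euclidean_space) mfd \<Rightarrow> ('m \<Rightarrow> 'e) \<Rightarrow> 'm \<Rightarrow> 'e \<Rightarrow> 'e" where
  "vf_rep \<kappa> X p x = (let q = coord_inv (\<kappa> p) x in tchange \<kappa> q p q (X q))"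

definition form_rep ::
  "('m, 'e::euclidean_space) mfd \<Rightarrow> ('m \<Rightarrow> 'e \<Rightarrow> real) \<Rightarrow> 'm \<Rightarrow> 'e \<Rightarrow> 'e \<Rightarrow> real" where
  "form_rep \<kappa> \<omega> p x v = (let q = coord_inv (\<kappa> p) x in \<omega> q (tchange \<kappa> p q q v))"

definition metric_rep ::
  "('m, 'e::euclidean_space) mfd \<Rightarrow> ('m \<Rightarrow> 'e \<Rightarrow> 'e \<Rightarrow> real) \<Rightarrow> 'm \<Rightarrow> 'e \<Rightarrow> 'e \<Rightarrow> 'e \<Rightarrow> real" where
  "metric_rep \<kappa> g p x u v =
     (let q = coord_inv (\<kappa> p) x in g q (tchange \<kappa> p q q u) (tchange \<kappa> p q q v))"

definition CM :: "('m, 'e::euclidean_space) mfd \<Rightarrow> ('m \<Rightarrow> real) set" where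
  "CM \<kappa> = {f. \<forall>p. smooth_on (coord_image \<kappa> p) (fun_rep \<kappa> f p)}"

definition vector_field :: "('m, 'e::euclidean_space) mfd \<Rightarrow> ('m \<Rightarrow> 'e) \<Rightarrow> bool" where
  "vector_field \<kappa> X \<longleftrightarrow> (\<forall>p. smooth_on (coord_image \<kappa> p) (vf_rep \<kappa> X p))"

definition one_forms :: "('m, 'e::euclidean_space) mfd \<Rightarrow> ('m \<Rightarrow> 'e \<Rightarrow> real) set" where
  "one_forms \<kappa> = {\<omega>. \<forall>p. linear (\<omega> p) \<and>
     (\<forall>v. smooth_on (coord_image \<kappa> p) (\<lambda>x. form_rep \<kappa> \<omega> p x v))}"

definition riemannian_metric ::
  "('m, 'e::euclidean_space) mfd \<Rightarrow> ('m \<Rightarrow> 'e \<Rightarrow> 'e \<Rightarrow> real) \<Rightarrow> bool" where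
  "riemannian_metric \<kappa> g \<longleftrightarrow> (\<forall>p. bilinear (g p) \<and> (\<forall>u v. g p u v = g p v u) \<and>
     (\<forall>u. u \<noteq> 0 \<longrightarrow> g p u u > 0) \<and>
     (\<forall>u v. smooth_on (coord_image \<kappa> p) (\<lambda>x. metric_rep \<kappa> g p x u v)))"


section \<open>Tensor calculus\<close>

text \<open>In this section everything at \<open>p\<close> is computed in the chart \<open>\<kappa> p\<close> by the usual coordinate
  formulas; \<open>bdiff\<close>, \<open>blie\<close>, \<open>blaplace\<close> etc. stand for the barred (classical) operations.\<close>

definition bdiff :: "('m, 'e::euclidean_space) mfd \<Rightarrow> ('m \<Rightarrow> real) \<Rightarrow> 'm \<Rightarrow> 'e \<Rightarrow> real" where
  "bdiff \<kappa> f p v = frechet_derivative (fun_rep \<kappa> f p) (at (coord_at \<kappa> p)) v"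

definition vf_apply ::
  "('m, 'e::euclidean_space) mfd \<Rightarrow> ('m \<Rightarrow> 'e) \<Rightarrow> ('m \<Rightarrow> real) \<Rightarrow> 'm \<Rightarrow> real" where
  "vf_apply \<kappa> X f p = bdiff \<kappa> f p (X p)"

definition vf_deriv :: "('m, 'e::euclidean_space) mfd \<Rightarrow> ('m \<Rightarrow> 'e) \<Rightarrow> 'm \<Rightarrow> 'e \<Rightarrow> 'e" where
  "vf_deriv \<kappa> X p v = frechet_derivative (vf_rep \<kappa> X p) (at (coord_at \<kappa> p)) v"

text \<open>\<open>metric_deriv \<kappa> g p a u v\<close> is the derivative in direction \<open>a\<close> of \<open>g(u, v)\<close>, where \<open>u\<close> and \<open>v\<close>
  are constant in the coordinates \<open>\<kappa> p\<close>.\<close>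

definition metric_deriv ::
  "('m, 'e::euclidean_space) mfd \<Rightarrow> ('m \<Rightarrow> 'e \<Rightarrow> 'e \<Rightarrow> real) \<Rightarrow> 'm \<Rightarrow> 'e \<Rightarrow> 'e \<Rightarrow> 'e \<Rightarrow> real" where
  "metric_deriv \<kappa> g p a u v =
     frechet_derivative (\<lambda>x. metric_rep \<kappa> g p x u v) (at (coord_at \<kappa> p)) a"

definition blie_form ::
  "('m, 'e::euclidean_space) mfd \<Rightarrow> ('m \<Rightarrow> 'e) \<Rightarrow> ('m \<Rightarrow> 'e \<Rightarrow> real) \<Rightarrow> 'm \<Rightarrow> 'e \<Rightarrow> real" where
  "blie_form \<kappa> X \<omega> p v =
     frechet_derivative (\<lambda>x. form_rep \<kappa> \<omega> p x v) (at (coord_at \<kappa> p)) (X p)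
       + \<omega> p (vf_deriv \<kappa> X p v)"

definition blie_metric ::
  "('m, 'e::euclidean_space) mfd \<Rightarrow> ('m \<Rightarrow> 'e) \<Rightarrow> ('m \<Rightarrow> 'e \<Rightarrow> 'e \<Rightarrow> real) \<Rightarrow> 'm \<Rightarrow> 'e \<Rightarrow> 'e \<Rightarrow> real"
  where
  "blie_metric \<kappa> X g p u v =
     metric_deriv \<kappa> g p (X p) u v + g p (vf_deriv \<kappa> X p u) v + g p u (vf_deriv \<kappa> X p v)"

definition flat :: "('m \<Rightarrow> 'e \<Rightarrow> 'e \<Rightarrow> real) \<Rightarrow> ('m \<Rightarrow> 'e) \<Rightarrow> 'm \<Rightarrow> 'e \<Rightarrow> real" where
  "flat g X p v = g p (X p) v"

definition sharp :: "('m \<Rightarrow> 'e \<Rightarrow> 'e \<Rightarrow> real) \<Rightarrow> 'm \<Rightarrow> ('e \<Rightarrow> real) \<Rightarrow> 'e" where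
  "sharp g p a = (THE u. \<forall>v. g p u v = a v)"

text \<open>The inverse metric on 1-forms.\<close>

definition cometric ::
  "('m \<Rightarrow> 'e \<Rightarrow> 'e \<Rightarrow> real) \<Rightarrow> ('m \<Rightarrow> 'e \<Rightarrow> real) \<Rightarrow> ('m \<Rightarrow> 'e \<Rightarrow> real) \<Rightarrow> 'm \<Rightarrow> real" where
  "cometric g \<omega> \<eta> p = \<omega> p (sharp g p (\<eta> p))"

text \<open>Christoffel symbols of the Levi-Civita connection.\<close>

definition christoffel ::
  "('m, 'e::euclidean_space) mfd \<Rightarrow> ('m \<Rightarrow> 'e \<Rightarrow> 'e \<Rightarrow> real) \<Rightarrow> 'm \<Rightarrow> 'e \<Rightarrow> 'e \<Rightarrow> 'e" where
  "christoffel \<kappa> g p u v = sharp g p (\<lambda>z.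
     (metric_deriv \<kappa> g p u v z + metric_deriv \<kappa> g p v u z - metric_deriv \<kappa> g p z u v) / 2)"

definition cov_deriv ::
  "('m, 'e::euclidean_space) mfd \<Rightarrow> ('m \<Rightarrow> 'e \<Rightarrow> 'e \<Rightarrow> real) \<Rightarrow> ('m \<Rightarrow> 'e) \<Rightarrow> 'm \<Rightarrow> 'e \<Rightarrow> 'e" where
  "cov_deriv \<kappa> g X p v = vf_deriv \<kappa> X p v + christoffel \<kappa> g p v (X p)"

text \<open>The trace of \<open>v \<mapsto> \<nabla>\<^sub>v X\<close>; the inner product of \<open>'e\<close> only serves to read off coefficients.\<close>

definition divergence ::
  "('m, 'e::euclidean_space) mfd \<Rightarrow> ('m \<Rightarrow> 'e \<Rightarrow> 'e \<Rightarrow> real) \<Rightarrow> ('m \<Rightarrow> 'e) \<Rightarrow> 'm \<Rightarrow> real" where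
  "divergence \<kappa> g X p = (\<Sum>b\<in>Basis. cov_deriv \<kappa> g X p b \<bullet> b)"

text \<open>\<open>(\<nabla> df)(u, v)\<close>.\<close>

definition hessian ::
  "('m, 'e::euclidean_space) mfd \<Rightarrow> ('m \<Rightarrow> 'e \<Rightarrow> 'e \<Rightarrow> real) \<Rightarrow> ('m \<Rightarrow> real) \<Rightarrow> 'm \<Rightarrow> 'e \<Rightarrow> 'e \<Rightarrow> real"
  where
  "hessian \<kappa> g f p u v =
     frechet_derivative (\<lambda>x. frechet_derivative (fun_rep \<kappa> f p) (at x) v) (at (coord_at \<kappa> p)) u
       - bdiff \<kappa> f p (christoffel \<kappa> g p u v)"

text \<open>The metric trace \<open>g\<^sup>i\<^sup>j \<nabla>\<^sub>i \<partial>\<^sub>j f\<close> of the Hessian: \<open>sharp\<close> of the \<open>i\<close>-th coordinate 1-form has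
  components \<open>g\<^sup>i\<^sup>j\<close>. Positivity of \<open>g\<close> is not needed, so this applies to Lorentzian metrics.\<close>

definition laplace_beltrami ::
  "('m, 'e::euclidean_space) mfd \<Rightarrow> ('m \<Rightarrow> 'e \<Rightarrow> 'e \<Rightarrow> real) \<Rightarrow> ('m \<Rightarrow> real) \<Rightarrow> 'm \<Rightarrow> real" where
  "laplace_beltrami \<kappa> g f p = (\<Sum>b\<in>Basis. hessian \<kappa> g f p b (sharp g p (\<lambda>v. b \<bullet> v)))"

definition blaplace ::
  "('m, 'e::euclidean_space) mfd \<Rightarrow> ('m \<Rightarrow> 'e \<Rightarrow> 'e \<Rightarrow> real) \<Rightarrow> ('m \<Rightarrow> 'e) \<Rightarrow> ('m \<Rightarrow> real) \<Rightarrow> 'm \<Rightarrow> real"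
  where
  "blaplace \<kappa> g \<zeta> f p = laplace_beltrami \<kappa> g f p + vf_apply \<kappa> \<zeta> f p"

definition conformal_killing ::
  "('m, 'e::euclidean_space) mfd \<Rightarrow> ('m \<Rightarrow> 'e \<Rightarrow> 'e \<Rightarrow> real) \<Rightarrow> ('m \<Rightarrow> 'e) \<Rightarrow> bool" where
  "conformal_killing \<kappa> g \<tau> \<longleftrightarrow> vector_field \<kappa> \<tau> \<and>
     (\<exists>\<phi>\<in>CM \<kappa>. \<forall>p u v. blie_metric \<kappa> \<tau> g p u v = \<phi> p * g p u v)"

definition ck_alpha ::
  "('m, 'e::euclidean_space) mfd \<Rightarrow> ('m \<Rightarrow> 'e \<Rightarrow> 'e \<Rightarrow> real) \<Rightarrow> ('m \<Rightarrow> 'e) \<Rightarrow> 'm \<Rightarrow> real" where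
  "ck_alpha \<kappa> g \<tau> p = 2 / real DIM('e) * divergence \<kappa> g \<tau> p - 1"

text \<open>The product manifold of \<open>M\<close> and the real line, and the metric
  \<open>\<beta>\<^sup>-\<^sup>1 dt \<otimes> dt + g\<close> on it.\<close>

definition times_line :: "('m, 'e) mfd \<Rightarrow> ('m \<times> real, 'e \<times> real) mfd" where
  "times_line \<kappa> = (\<lambda>(p, s). (fst (\<kappa> p) \<times> UNIV, \<lambda>(q, r). (snd (\<kappa> p) q, r)))"

definition static_metric ::
  "('m \<Rightarrow> real) \<Rightarrow> ('m \<Rightarrow> 'e \<Rightarrow> 'e \<Rightarrow> real) \<Rightarrow> 'm \<times> real \<Rightarrow> 'e \<times> real \<Rightarrow> 'e \<times> real \<Rightarrow> real" where
  "static_metric \<beta> g = (\<lambda>(p, s) (u, a) (v, b). inverse (\<beta> p) * (a * b) + g p u v)"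


section \<open>The algebra and its calculus\<close>

text \<open>
  By normal ordering, an element \<open>\<Sum>\<^sub>n f\<^sub>n t\<^sup>n\<close> of the algebra is the sequence \<open>f\<close>, and an element
  \<open>\<Sum>\<^sub>n \<omega>\<^sub>n t\<^sup>n + \<Sum>\<^sub>n a\<^sub>n \<theta>' t\<^sup>n + \<Sum>\<^sub>n b\<^sub>n dt t\<^sup>n\<close> of the calculus is the triple \<open>(\<omega>, a, b)\<close>
  (coefficients on the left of the generators, powers of \<open>t\<close> on their right).
  Here \<open>tmon x n\<close> is the sequence with the single entry \<open>x\<close> at \<open>n\<close>.
\<close>

type_synonym 'm nord = "nat \<Rightarrow> 'm \<Rightarrow> real"
type_synonym ('m, 'e) nform = "(nat \<Rightarrow> 'm \<Rightarrow> 'e \<Rightarrow> real) \<times> (nat \<Rightarrow> 'm \<Rightarrow> real) \<times> (nat \<Rightarrow> 'm \<Rightarrow> real)"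

definition tmon :: "'a::zero \<Rightarrow> nat \<Rightarrow> nat \<Rightarrow> 'a" where
  "tmon x n = (\<lambda>k. if k = n then x else 0)"

abbreviation coef :: "('m \<Rightarrow> real) \<Rightarrow> 'm nord" where
  "coef f \<equiv> tmon f 0"

abbreviation tvar :: "'m nord" where
  "tvar \<equiv> tmon 1 1"

definition fin_seqs :: "'a::zero set \<Rightarrow> (nat \<Rightarrow> 'a) set" where
  "fin_seqs A = {F. finite {n. F n \<noteq> 0} \<and> (\<forall>n. F n \<in> A)}"

definition nord_carrier :: "('m, 'e::euclidean_space) mfd \<Rightarrow> 'm nord set" where
  "nord_carrier \<kappa> = fin_seqs (CM \<kappa>)"

definition nform_carrier :: "('m, 'e::euclidean_space) mfd \<Rightarrow> ('m, 'e) nform set" where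
  "nform_carrier \<kappa> = fin_seqs (one_forms \<kappa>) \<times> fin_seqs (CM \<kappa>) \<times> fin_seqs (CM \<kappa>)"

text \<open>The elements \<open>\<omega> t\<^sup>n\<close>, \<open>f \<theta>' t\<^sup>n\<close> and \<open>f dt t\<^sup>n\<close>.\<close>

definition gform :: "('m \<Rightarrow> 'e \<Rightarrow> real) \<Rightarrow> nat \<Rightarrow> ('m, 'e) nform" where
  "gform \<omega> n = (tmon \<omega> n, 0, 0)"

definition gtheta :: "('m \<Rightarrow> real) \<Rightarrow> nat \<Rightarrow> ('m, 'e) nform" where
  "gtheta f n = (0, tmon f n, 0)"

definition gdt :: "('m \<Rightarrow> real) \<Rightarrow> nat \<Rightarrow> ('m, 'e) nform" where
  "gdt f n = (0, 0, tmon f n)"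

text \<open>Product of the algebra, left and right action on the calculus, and the derivation \<open>d\<close>.\<close>

record ('m, 'e) st_calculus =
  amul :: "'m nord \<Rightarrow> 'm nord \<Rightarrow> 'm nord"
  lact :: "'m nord \<Rightarrow> ('m, 'e) nform \<Rightarrow> ('m, 'e) nform"
  ract :: "('m, 'e) nform \<Rightarrow> 'm nord \<Rightarrow> ('m, 'e) nform"
  der :: "'m nord \<Rightarrow> ('m, 'e) nform"

definition st_ring ::
  "('m, 'e::euclidean_space) mfd \<Rightarrow> ('m, 'e) st_calculus \<Rightarrow> 'm nord ring" where
  "st_ring \<kappa> S = \<lparr>carrier = nord_carrier \<kappa>, monoid.mult = amul S, one = coef 1,
     zero = 0, add = (+)\<rparr>"

text \<open>The algebra \<open>C(M) \<rtimes>\<^sub>\<tau> \<real>\<close>.\<close>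

definition crossed_product ::
  "('m, 'e::euclidean_space) mfd \<Rightarrow> ('m \<Rightarrow> 'e) \<Rightarrow> real \<Rightarrow> ('m, 'e) st_calculus \<Rightarrow> bool" where
  "crossed_product \<kappa> \<tau> lam S \<longleftrightarrow> ring (st_ring \<kappa> S) \<and>
     (\<forall>f\<in>CM \<kappa>. \<forall>g\<in>CM \<kappa>. amul S (coef f) (coef g) = coef (f * g)) \<and>
     (\<forall>f\<in>CM \<kappa>. \<forall>n. amul S (tmon f n) tvar = tmon f (Suc n)) \<and>
     (\<forall>f\<in>CM \<kappa>. amul S (coef f) tvar - amul S tvar (coef f) = coef (\<lambda>p. lam * vf_apply \<kappa> \<tau> f p))"

definition bimodule ::
  "('a, 'b) ring_scheme \<Rightarrow> 'w::ab_group_add set \<Rightarrow> ('a \<Rightarrow> 'w \<Rightarrow> 'w) \<Rightarrow> ('w \<Rightarrow> 'a \<Rightarrow> 'w) \<Rightarrow> bool" where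
  "bimodule R W l r \<longleftrightarrow>
     (\<forall>x\<in>W. l \<one>\<^bsub>R\<^esub> x = x \<and> r x \<one>\<^bsub>R\<^esub> = x) \<and>
     (\<forall>a\<in>carrier R. \<forall>x\<in>W. l a x \<in> W \<and> r x a \<in> W) \<and>
     (\<forall>a\<in>carrier R. \<forall>x\<in>W. \<forall>y\<in>W. l a (x + y) = l a x + l a y \<and> r (x + y) a = r x a + r y a) \<and>
     (\<forall>a\<in>carrier R. \<forall>b\<in>carrier R. \<forall>x\<in>W.
        l (a \<oplus>\<^bsub>R\<^esub> b) x = l a x + l b x \<and> r x (a \<oplus>\<^bsub>R\<^esub> b) = r x a + r x b \<and>
        l (a \<otimes>\<^bsub>R\<^esub> b) x = l a (l b x) \<and> r x (a \<otimes>\<^bsub>R\<^esub> b) = r (r x a) b \<and>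
        r (l a x) b = l a (r x b))"

text \<open>The generators are in normal form, as described at the start of this section.\<close>

definition normal_form_actions ::
  "('m, 'e::euclidean_space) mfd \<Rightarrow> ('m, 'e) st_calculus \<Rightarrow> bool" where
  "normal_form_actions \<kappa> S \<longleftrightarrow>
     (\<forall>f\<in>CM \<kappa>. \<forall>\<omega>\<in>one_forms \<kappa>. lact S (coef f) (gform \<omega> 0) = gform (\<lambda>p v. f p * \<omega> p v) 0) \<and>
     (\<forall>f\<in>CM \<kappa>. lact S (coef f) (gtheta 1 0) = gtheta f 0) \<and>
     (\<forall>f\<in>CM \<kappa>. lact S (coef f) (gdt 1 0) = gdt f 0) \<and>
     (\<forall>\<omega>\<in>one_forms \<kappa>. \<forall>n. ract S (gform \<omega> n) tvar = gform \<omega> (Suc n)) \<and>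
     (\<forall>f\<in>CM \<kappa>. \<forall>n. ract S (gtheta f n) tvar = gtheta f (Suc n)) \<and>
     (\<forall>f\<in>CM \<kappa>. \<forall>n. ract S (gdt f n) tvar = gdt f (Suc n))"

text \<open>\<open>comm S x F\<close> is the commutator \<open>[x, F]\<close> of an element of the calculus with an element of
  the algebra.\<close>

definition comm ::
  "('m, 'e) st_calculus \<Rightarrow> ('m, 'e) nform \<Rightarrow> 'm nord \<Rightarrow> ('m, 'e) nform" where
  "comm S x F = ract S x F - lact S F x"

text \<open>The relation \<open>[f, dt] = \<lambda> df\<close> appears below as \<open>-[dt, f] = \<lambda> df\<close>.\<close>

definition calculus_relations ::
  "('m, 'e::euclidean_space) mfd \<Rightarrow> ('m \<Rightarrow> 'e \<Rightarrow> 'e \<Rightarrow> real) \<Rightarrow> ('m \<Rightarrow> 'e) \<Rightarrow> ('m \<Rightarrow> 'e) \<Rightarrow>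
   ('m \<Rightarrow> real) \<Rightarrow> real \<Rightarrow> ('m, 'e) st_calculus \<Rightarrow> bool" where
  "calculus_relations \<kappa> g \<tau> \<zeta> \<beta> lam S \<longleftrightarrow>
     (let n = real DIM('e); \<alpha> = ck_alpha \<kappa> g \<tau> in
     (\<forall>\<omega>\<in>one_forms \<kappa>. \<forall>f\<in>CM \<kappa>.
        comm S (gform \<omega> 0) (coef f) = gtheta (\<lambda>p. lam * cometric g \<omega> (bdiff \<kappa> f) p) 0) \<and>
     (\<forall>f\<in>CM \<kappa>. comm S (gtheta 1 0) (coef f) = 0) \<and>
     comm S (gtheta 1 0) tvar = gtheta (\<lambda>p. lam * \<alpha> p) 0 \<and>
     (\<forall>f\<in>CM \<kappa>. - comm S (gdt 1 0) (coef f) = lact S (coef (\<lambda>p. lam)) (der S (coef f))) \<and>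
     comm S (gdt 1 0) tvar = gtheta (\<lambda>p. lam * \<beta> p) 0 - gdt (\<lambda>p. lam) 0 \<and>
     (\<forall>\<omega>\<in>one_forms \<kappa>. comm S (gform \<omega> 0) tvar =
        gform (\<lambda>p v. lam * (blie_form \<kappa> \<tau> \<omega> p v - \<omega> p v)) 0
        - gtheta (\<lambda>p. lam^2 * ((n - 2) / 4) * cometric g (bdiff \<kappa> \<alpha>) \<omega> p) 0
        - gtheta (\<lambda>p. lam^2 / 2 * cometric g (blie_form \<kappa> \<tau> (flat g \<zeta>)) \<omega> p) 0))"

definition calculus_derivation ::
  "('m, 'e::euclidean_space) mfd \<Rightarrow> ('m \<Rightarrow> 'e \<Rightarrow> 'e \<Rightarrow> real) \<Rightarrow> ('m \<Rightarrow> 'e) \<Rightarrow> real \<Rightarrow>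
   ('m, 'e) st_calculus \<Rightarrow> bool" where
  "calculus_derivation \<kappa> g \<zeta> lam S \<longleftrightarrow>
     (\<forall>F\<in>nord_carrier \<kappa>. der S F \<in> nform_carrier \<kappa>) \<and>
     (\<forall>F\<in>nord_carrier \<kappa>. \<forall>G\<in>nord_carrier \<kappa>. der S (F + G) = der S F + der S G) \<and>
     (\<forall>F\<in>nord_carrier \<kappa>. \<forall>G\<in>nord_carrier \<kappa>.
        der S (amul S F G) = ract S (der S F) G + lact S F (der S G)) \<and>
     der S tvar = gdt 1 0 \<and>
     (\<forall>f\<in>CM \<kappa>. der S (coef f) =
        gform (bdiff \<kappa> f) 0 + gtheta (\<lambda>p. lam / 2 * blaplace \<kappa> g \<zeta> f p) 0)"

text \<open>\<open>S\<close> is the algebra \<open>C(M) \<rtimes>\<^sub>\<tau> \<real>\<close> together with its calculus, at parameter \<open>lam\<close>.\<close>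

definition spacetime_calculus ::
  "('m, 'e::euclidean_space) mfd \<Rightarrow> ('m \<Rightarrow> 'e \<Rightarrow> 'e \<Rightarrow> real) \<Rightarrow> ('m \<Rightarrow> 'e) \<Rightarrow> ('m \<Rightarrow> 'e) \<Rightarrow>
   ('m \<Rightarrow> real) \<Rightarrow> real \<Rightarrow> ('m, 'e) st_calculus \<Rightarrow> bool" where
  "spacetime_calculus \<kappa> g \<tau> \<zeta> \<beta> lam S \<longleftrightarrow>
     crossed_product \<kappa> \<tau> lam S \<and>
     bimodule (st_ring \<kappa> S) (nform_carrier \<kappa>) (lact S) (ract S) \<and>
     normal_form_actions \<kappa> S \<and>
     calculus_relations \<kappa> g \<tau> \<zeta> \<beta> lam S \<and>
     calculus_derivation \<kappa> g \<zeta> lam S"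


section \<open>The wave operator\<close>

definition nscale :: "real \<Rightarrow> 'm nord \<Rightarrow> 'm nord" where
  "nscale c F = (\<lambda>n p. c * F n p)"

definition tdiff :: "'m nord \<Rightarrow> 'm nord" where
  "tdiff F = (\<lambda>n p. real (Suc n) * F (Suc n) p)"

definition coeff_laplace ::
  "('m, 'e::euclidean_space) mfd \<Rightarrow> ('m \<Rightarrow> 'e \<Rightarrow> 'e \<Rightarrow> real) \<Rightarrow> ('m \<Rightarrow> 'e) \<Rightarrow> 'm nord \<Rightarrow> 'm nord" where
  "coeff_laplace \<kappa> g \<zeta> F = (\<lambda>n. blaplace \<kappa> g \<zeta> (F n))"

definition coeff_diff ::
  "('m, 'e::euclidean_space) mfd \<Rightarrow> 'm nord \<Rightarrow> ('m, 'e) nform" where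
  "coeff_diff \<kappa> F = ((\<lambda>n. bdiff \<kappa> (F n)), 0, 0)"

text \<open>\<open>shift_by \<kappa> S lam a F\<close> is \<open>F(t + lam a)\<close>.\<close>

definition shift_by ::
  "('m, 'e::euclidean_space) mfd \<Rightarrow> ('m, 'e) st_calculus \<Rightarrow> real \<Rightarrow> ('m \<Rightarrow> real) \<Rightarrow> 'm nord \<Rightarrow> 'm nord"
  where
  "shift_by \<kappa> S lam a F = (\<Sum>n | F n \<noteq> 0.
     amul S (coef (F n)) ((tvar + coef (\<lambda>p. lam * a p)) [^]\<^bsub>st_ring \<kappa> S\<^esub> n))"

definition partial0 ::
  "('m, 'e::euclidean_space) mfd \<Rightarrow> ('m, 'e) st_calculus \<Rightarrow> real \<Rightarrow> 'm nord \<Rightarrow> 'm nord" where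
  "partial0 \<kappa> S lam F = nscale (inverse lam) (F - shift_by \<kappa> S lam (- 1) F)"

text \<open>The left \<open>C(M)\<close>-linear operator with
  \<open>d(t\<^sup>k) = (\<partial>\<^sub>0 t\<^sup>k) dt + \<lambda> (\<Delta>\<^sub>0 t\<^sup>k) \<theta>'\<close>.\<close>

definition Delta0 ::
  "('m, 'e::euclidean_space) mfd \<Rightarrow> ('m, 'e) st_calculus \<Rightarrow> real \<Rightarrow> 'm nord \<Rightarrow> 'm nord" where
  "Delta0 \<kappa> S lam F = (\<Sum>k | F k \<noteq> 0. amul S (coef (F k))
     (THE D. D \<in> nord_carrier \<kappa> \<and>
        der S (tmon 1 k) = lact S (partial0 \<kappa> S lam (tmon 1 k)) (gdt 1 0)
                           + lact S (nscale lam D) (gtheta 1 0)))"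

text \<open>The property \<open>df = \<bar>d f + (\<partial>\<^sub>0 f) dt + (\<lambda>/2) B \<theta>'\<close> defining \<open>B = \<box> f\<close>.\<close>

definition is_wave ::
  "('m, 'e::euclidean_space) mfd \<Rightarrow> ('m, 'e) st_calculus \<Rightarrow> real \<Rightarrow> 'm nord \<Rightarrow> 'm nord \<Rightarrow> bool" where
  "is_wave \<kappa> S lam F B \<longleftrightarrow> B \<in> nord_carrier \<kappa> \<and>
     der S F = coeff_diff \<kappa> F + lact S (partial0 \<kappa> S lam F) (gdt 1 0)
               + lact S (nscale (lam / 2) B) (gtheta 1 0)"

definition wave ::
  "('m, 'e::euclidean_space) mfd \<Rightarrow> ('m, 'e) st_calculus \<Rightarrow> real \<Rightarrow> 'm nord \<Rightarrow> 'm nord" where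
  "wave \<kappa> S lam F = (THE B. is_wave \<kappa> S lam F B)"

text \<open>Convergence in \<open>C\<^sup>\<infinity>(M)\<close> as \<open>\<lambda> \<rightarrow> 0\<close>: uniform convergence of all iterated coordinate
  derivatives on compact subsets of charts.\<close>

definition CM_limit ::
  "('m, 'e::euclidean_space) mfd \<Rightarrow> (real \<Rightarrow> 'm \<Rightarrow> real) \<Rightarrow> ('m \<Rightarrow> real) \<Rightarrow> bool" where
  "CM_limit \<kappa> f h \<longleftrightarrow> (\<forall>p vs K. compact K \<and> K \<subseteq> coord_image \<kappa> p \<longrightarrow>
     uniform_limit K (\<lambda>lam. iter_deriv vs (fun_rep \<kappa> (f lam) p))
       (iter_deriv vs (fun_rep \<kappa> h p)) (at 0))"

definition classical_limit ::
  "('m, 'e::euclidean_space) mfd \<Rightarrow> (real \<Rightarrow> 'm nord) \<Rightarrow> 'm nord \<Rightarrow> bool" where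
  "classical_limit \<kappa> F G \<longleftrightarrow> (\<forall>n. CM_limit \<kappa> (\<lambda>lam. F lam n) (G n))"

text \<open>A normal ordered element as a function on the product of \<open>M\<close> and the real line.\<close>

definition nord_eval :: "'m nord \<Rightarrow> 'm \<times> real \<Rightarrow> real" where
  "nord_eval F = (\<lambda>(p, s). \<Sum>n | F n \<noteq> 0. F n p * s ^ n)"

end

theory Submission
  imports Defs
begin

text \<open>
  By the Leibniz rule, the differential of \<open>\<Sum>\<^sub>n f\<^sub>n t\<^sup>n\<close> is built from \<open>(df\<^sub>n) t\<^sup>n\<close> and \<open>f\<^sub>n d(t\<^sup>n)\<close>.
  In the first of these the only part that is not yet of the required shape is
  \<open>\<lambda>/2 (\<Delta>f\<^sub>n) \<theta>' t\<^sup>n\<close>. The form \<open>\<theta>'\<close> commutes with functions and satisfies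
  \<open>\<theta>' t = (t + \<lambda>\<alpha>) \<theta>'\<close>, so this part is \<open>\<lambda>/2 (\<Delta>f\<^sub>n) (t + \<lambda>\<alpha>)\<^sup>n \<theta>'\<close> (\<open>theta_act_tpow\<close>); this is the
  origin of the shifted argument in the formula for the wave operator. For the second part,
  commuting \<open>t\<close> past \<open>dt\<close> and \<open>\<theta>'\<close> gives the recursions
  \<open>\<partial>\<^sub>0 t\<^sup>k\<^sup>+\<^sup>1 = (\<partial>\<^sub>0 t\<^sup>k)(t - \<lambda>) + t\<^sup>k\<close> and \<open>\<Delta>\<^sub>0 t\<^sup>k\<^sup>+\<^sup>1 = (\<partial>\<^sub>0 t\<^sup>k) \<beta> + (\<Delta>\<^sub>0 t\<^sup>k)(t + \<lambda>\<alpha>)\<close> (\<open>der_tpow\<close>).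
  That \<open>\<Delta>\<^sub>0\<close> and the wave operator are well defined means that \<open>F \<mapsto> F \<theta>'\<close> is injective. Moving \<open>\<theta>'\<close>
  to the left turns \<open>F\<close> into an element with the same leading coefficient, and \<open>\<theta>' G\<close> is the
  normal form with \<open>\<theta>'\<close>-coefficients \<open>G\<close>, so nothing is lost (\<open>act_theta_eq_zero\<close>).

  The classical limit exists because normal ordered coefficients are polynomials in \<open>\<lambda>\<close>: the
  relation \<open>t f = f t - \<lambda> \<tau>(f)\<close> is polynomial in \<open>\<lambda>\<close>, and both recursions start from elements that do
  not involve \<open>\<lambda>\<close>. The predicate \<open>lam_poly\<close> relates such a family to its constant term, and a
  polynomial with coefficients in \<open>C(M)\<close> tends to its constant term in \<open>C\<^sup>\<infinity>\<close>, because the derivatives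
  of the coefficients are bounded on compact sets. At \<open>\<lambda> = 0\<close> the recursions are commutative and
  solved by \<open>k t\<^sup>k\<^sup>-\<^sup>1\<close> and \<open>k(k-1)/2 \<beta> t\<^sup>k\<^sup>-\<^sup>2\<close>, which yields the term \<open>\<beta> \<partial>\<^sub>t\<^sup>2 f\<close> (\<open>lpoly_wave\<close>).

  For the metric \<open>\<beta>\<^sup>-\<^sup>1 dt \<otimes> dt + g\<close>, the trace of the Hessian only sees the Christoffel symbols of \<open>g\<close>
  and \<open>\<Gamma>(\<partial>\<^sub>t, \<partial>\<^sub>t) = 1/2 \<beta>\<^sup>-\<^sup>2 grad \<beta>\<close>. Hence its Laplace-Beltrami operator is
  \<open>f \<mapsto> \<Delta>\<^sub>L\<^sub>B f + \<beta> \<partial>\<^sub>t\<^sup>2 f - 1/2 \<beta>\<^sup>-\<^sup>1 (grad \<beta>)(f)\<close> (\<open>laplace_beltrami_static\<close>), and the last term is \<open>\<zeta>(f)\<close>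
  when \<open>\<zeta>\<close> is dual to \<open>- 1/2 \<beta>\<^sup>-\<^sup>1 d\<beta>\<close>.
\<close>

(* keeps the exponent of t = tmon 1 1 in the form in which the calculus is axiomatized *)
declare One_nat_def [simp del]

section \<open>Sequences of coefficients\<close>

lemma sum_fun_apply: "(\<Sum>i\<in>I. f i) x = (\<Sum>i\<in>I. f i x)"
  for f :: "'i \<Rightarrow> 'a \<Rightarrow> 'b::comm_monoid_add"
  by (induction I rule: infinite_finite_induct) simp_all

lemma tmon_same [simp]: "tmon x n n = x"
  by (simp add: tmon_def)

lemma tmon_other [simp]: "k \<noteq> n \<Longrightarrow> tmon x n k = 0"
  by (simp add: tmon_def)

lemma tmon_zero [simp]: "tmon 0 n = 0"
  by (simp add: tmon_def fun_eq_iff)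

lemma tmon_add: "tmon (x + y) n = tmon x n + tmon y n"
  for x y :: "'a::monoid_add"
  by (simp add: tmon_def fun_eq_iff)

lemma nscale_tmon: "nscale c (tmon f n) = tmon (\<lambda>p. c * f p) n"
  by (auto simp: nscale_def tmon_def fun_eq_iff)

lemma nscale_add: "nscale c (F + G) = nscale c F + nscale c G"
  by (simp add: nscale_def fun_eq_iff algebra_simps)

lemma nscale_diff: "nscale c (F - G) = nscale c F - nscale c G"
  by (simp add: nscale_def fun_eq_iff algebra_simps)

lemma nscale_nscale: "nscale a (nscale b F) = nscale (a * b) F"
  by (simp add: nscale_def mult.assoc)

lemma nscale_one [simp]: "nscale 1 F = F"
  by (simp add: nscale_def)

lemma nscale_zero [simp]: "nscale c 0 = 0"
  by (simp add: nscale_def fun_eq_iff)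

lemma nscale_zero_left [simp]: "nscale 0 F = 0"
  by (simp add: nscale_def fun_eq_iff)

lemma nscale_minus_one: "nscale (- 1) F = - F"
  by (simp add: nscale_def fun_eq_iff)

lemma nscale_sum: "nscale c (\<Sum>i\<in>I. F i) = (\<Sum>i\<in>I. nscale c (F i))"
  by (simp add: nscale_def sum_fun_apply fun_eq_iff sum_distrib_left)

lemma nscale_inj: "c \<noteq> 0 \<Longrightarrow> nscale c F = nscale c G \<Longrightarrow> F = G"
  by (simp add: nscale_def fun_eq_iff)

lemma tmon_sum:
  fixes F :: "nat \<Rightarrow> 'a::comm_monoid_add"
  assumes "finite I" and "{n. F n \<noteq> 0} \<subseteq> I"
  shows "F = (\<Sum>n\<in>I. tmon (F n) n)"
proof
  fix k
  have "(\<Sum>n\<in>I. tmon (F n) n) k = (\<Sum>n\<in>I. if n = k then F k else 0)"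
    unfolding sum_fun_apply by (rule sum.cong) (auto simp: tmon_def)
  also have "\<dots> = F k"
    using assms by auto
  finally show "F k = (\<Sum>n\<in>I. tmon (F n) n) k" by simp
qed

section \<open>Constants\<close>

lemma iter_deriv_const: "\<exists>d. iter_deriv vs (\<lambda>_. c) = (\<lambda>_. d)"
proof (induction vs arbitrary: c)
  case (Cons v vs)
  then show ?case by (simp add: frechet_derivative_const)
qed auto

lemma smooth_on_const: "smooth_on S (\<lambda>_. c)"
  unfolding smooth_on_def
proof (intro allI ballI)
  fix vs x
  obtain d where d: "iter_deriv vs (\<lambda>_. c) = (\<lambda>_. d)"
    using iter_deriv_const by blast
  show "iter_deriv vs (\<lambda>_. c) differentiable at x"
    unfolding d by simp
qed

lemma fun_rep_const [simp]: "fun_rep \<kappa> (\<lambda>_. c) p = (\<lambda>_. c)"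
  by (simp add: fun_rep_def fun_eq_iff)

lemma CM_const: "(\<lambda>_. c) \<in> CM \<kappa>"
  by (simp add: CM_def smooth_on_const)

lemma CM_one: "1 \<in> CM \<kappa>" and CM_zero: "0 \<in> CM \<kappa>"
  using CM_const[of 1 \<kappa>] CM_const[of 0 \<kappa>] by (simp_all add: one_fun_def zero_fun_def)

lemma bdiff_const: "bdiff \<kappa> (\<lambda>_. c) = 0"
  by (simp add: bdiff_def frechet_derivative_const fun_eq_iff)

lemma bdiff_zero: "bdiff \<kappa> 0 = 0"
  using bdiff_const[of \<kappa> 0] by (simp add: zero_fun_def)

lemma vf_apply_const: "vf_apply \<kappa> X (\<lambda>_. c) = 0"
  by (simp add: vf_apply_def bdiff_const fun_eq_iff)

lemma vf_apply_zero: "vf_apply \<kappa> X 0 = 0"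
  using vf_apply_const[of \<kappa> X 0] by (simp add: zero_fun_def)

lemma tmon_in_carrier: "f \<in> CM \<kappa> \<Longrightarrow> tmon f n \<in> nord_carrier \<kappa>"
  by (auto simp: nord_carrier_def fin_seqs_def tmon_def CM_zero intro: finite_subset[of _ "{n}"])

lemma carrier_coeff: "F \<in> nord_carrier \<kappa> \<Longrightarrow> F n \<in> CM \<kappa>"
  by (simp add: nord_carrier_def fin_seqs_def)

lemma carrier_finite: "F \<in> nord_carrier \<kappa> \<Longrightarrow> finite {n. F n \<noteq> 0}"
  by (simp add: nord_carrier_def fin_seqs_def)

lemma tmon_in_carrierD: "tmon f n \<in> nord_carrier \<kappa> \<Longrightarrow> f \<in> CM \<kappa>"
  using carrier_coeff[of "tmon f n" \<kappa> n] by simp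

section \<open>The normal ordered algebra\<close>

locale spacetime =
  fixes \<kappa> :: "('m::{t2_space,second_countable_topology}, 'e::euclidean_space) mfd"
    and g :: "'m \<Rightarrow> 'e \<Rightarrow> 'e \<Rightarrow> real"
    and \<tau> \<zeta> :: "'m \<Rightarrow> 'e"
    and \<beta> :: "'m \<Rightarrow> real"
    and lam :: real
    and S :: "('m, 'e) st_calculus"
  assumes calculus: "spacetime_calculus \<kappa> g \<tau> \<zeta> \<beta> lam S"
    and lam_nonzero: "lam \<noteq> 0"
    and beta_smooth: "\<beta> \<in> CM \<kappa>"
begin

abbreviation alg ("\<A>") where "\<A> \<equiv> nord_carrier \<kappa>"
abbreviation forms ("\<W>") where "\<W> \<equiv> nform_carrier \<kappa>"
abbreviation mul (infixl "\<star>" 70) where "F \<star> G \<equiv> amul S F G"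
abbreviation left_act (infixr "\<triangleright>" 70) where "F \<triangleright> x \<equiv> lact S F x"
abbreviation right_act (infixl "\<triangleleft>" 70) where "x \<triangleleft> F \<equiv> ract S x F"
abbreviation conf ("\<alpha>") where "\<alpha> \<equiv> ck_alpha \<kappa> g \<tau>"
abbreviation tpow where "tpow n \<equiv> tmon (1 :: 'm \<Rightarrow> real) n"
abbreviation theta ("\<theta>") where "\<theta> \<equiv> gtheta (1 :: 'm \<Rightarrow> real) 0 :: ('m, 'e) nform"
abbreviation dt where "dt \<equiv> gdt (1 :: 'm \<Rightarrow> real) 0 :: ('m, 'e) nform"
abbreviation scl where "scl c \<equiv> coef (\<lambda>_::'m. c)"

sublocale R: ring "st_ring \<kappa> S"
  using calculus by (simp add: spacetime_calculus_def crossed_product_def)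

lemma st_ring_simps [simp]:
  "carrier (st_ring \<kappa> S) = \<A>" "monoid.mult (st_ring \<kappa> S) = amul S"
  "one (st_ring \<kappa> S) = coef 1" "zero (st_ring \<kappa> S) = 0" "add (st_ring \<kappa> S) = (+)"
  by (simp_all add: st_ring_def)

lemmas mul_closed [simp, intro] = R.m_closed[simplified]
lemmas add_closed [simp, intro] = R.a_closed[simplified]
lemmas zero_closed [simp] = R.zero_closed[simplified]
lemmas mul_assoc = R.m_assoc[simplified]
lemmas mul_add_left = R.l_distr[simplified]
lemmas mul_add_right = R.r_distr[simplified]
lemmas one_mul [simp] = R.l_one[simplified]
lemmas mul_one [simp] = R.r_one[simplified]
lemmas zero_mul [simp] = R.l_null[simplified]
lemmas mul_zero [simp] = R.r_null[simplified]

lemma tmon_closed [simp, intro]: "f \<in> CM \<kappa> \<Longrightarrow> tmon f n \<in> \<A>"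
  by (rule tmon_in_carrier)

lemma scl_closed [simp, intro]: "scl c \<in> \<A>"
  by (simp add: CM_const)

lemma tpow_closed [simp, intro]: "tpow n \<in> \<A>"
  by (simp add: CM_one)

lemma coef_mul: "f \<in> CM \<kappa> \<Longrightarrow> h \<in> CM \<kappa> \<Longrightarrow> coef f \<star> coef h = coef (f * h)"
  using calculus by (simp add: spacetime_calculus_def crossed_product_def)

lemma tmon_mul_t: "f \<in> CM \<kappa> \<Longrightarrow> tmon f n \<star> tvar = tmon f (Suc n)"
  using calculus by (simp add: spacetime_calculus_def crossed_product_def)

lemma coef_t_comm:
  "f \<in> CM \<kappa> \<Longrightarrow> coef f \<star> tvar - tvar \<star> coef f = coef (\<lambda>p. lam * vf_apply \<kappa> \<tau> f p)"
  using calculus unfolding spacetime_calculus_def crossed_product_def by blast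

lemma CM_add: "f \<in> CM \<kappa> \<Longrightarrow> h \<in> CM \<kappa> \<Longrightarrow> f + h \<in> CM \<kappa>"
  using add_closed[of "coef f" "coef h"] tmon_in_carrierD[of "f + h" 0 \<kappa>] by (simp add: tmon_add)

lemma CM_mult: "f \<in> CM \<kappa> \<Longrightarrow> h \<in> CM \<kappa> \<Longrightarrow> f * h \<in> CM \<kappa>"
  using mul_closed[of "coef f" "coef h"] tmon_in_carrierD[of "f * h" 0 \<kappa>] by (simp add: coef_mul)

lemma CM_scale: "f \<in> CM \<kappa> \<Longrightarrow> (\<lambda>p. c * f p) \<in> CM \<kappa>"
  using CM_mult[OF CM_const[of c], of f] by (simp add: times_fun_def)

lemma CM_unscale: "(\<lambda>p. c * f p) \<in> CM \<kappa> \<Longrightarrow> c \<noteq> 0 \<Longrightarrow> f \<in> CM \<kappa>"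
  using CM_scale[of "\<lambda>p. c * f p" "inverse c"] by (simp add: mult.assoc[symmetric])

lemma CM_minus: "f \<in> CM \<kappa> \<Longrightarrow> - f \<in> CM \<kappa>"
  using CM_scale[of f "-1"] by (simp add: fun_Compl_def)

lemma minus_one_smooth [simp]: "- 1 \<in> CM \<kappa>"
  by (simp add: CM_minus CM_one)

lemma minus_closed [simp, intro]: "F \<in> \<A> \<Longrightarrow> - F \<in> \<A>"
  by (auto simp: nord_carrier_def fin_seqs_def intro: CM_minus)

lemma diff_closed [simp, intro]: "F \<in> \<A> \<Longrightarrow> G \<in> \<A> \<Longrightarrow> F - G \<in> \<A>"
  using add_closed[of F "- G"] by simp

lemma sum_closed [intro]: "(\<And>i. i \<in> I \<Longrightarrow> F i \<in> \<A>) \<Longrightarrow> (\<Sum>i\<in>I. F i) \<in> \<A>"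
  by (induction I rule: infinite_finite_induct) auto

lemma nscale_closed [simp, intro]: "F \<in> \<A> \<Longrightarrow> nscale c F \<in> \<A>"
  unfolding nord_carrier_def fin_seqs_def nscale_def
  by (auto intro: CM_scale elim!: rev_finite_subset simp: fun_eq_iff)

lemma mul_minus_left: "F \<in> \<A> \<Longrightarrow> G \<in> \<A> \<Longrightarrow> (- F) \<star> G = - (F \<star> G)"
  using mul_add_left[of F "- F" G] by (simp add: eq_neg_iff_add_eq_0 add.commute)

lemma mul_minus_right: "F \<in> \<A> \<Longrightarrow> G \<in> \<A> \<Longrightarrow> F \<star> (- G) = - (F \<star> G)"
  using mul_add_right[of G "- G" F] by (simp add: eq_neg_iff_add_eq_0 add.commute)

lemma mul_diff_left: "F \<in> \<A> \<Longrightarrow> G \<in> \<A> \<Longrightarrow> H \<in> \<A> \<Longrightarrow> (F - G) \<star> H = F \<star> H - G \<star> H"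
  using mul_add_left[of F "- G" H] by (simp add: mul_minus_left)

lemma mul_diff_right: "F \<in> \<A> \<Longrightarrow> G \<in> \<A> \<Longrightarrow> H \<in> \<A> \<Longrightarrow> F \<star> (G - H) = F \<star> G - F \<star> H"
  using mul_add_right[of G "- H" F] by (simp add: mul_minus_right)

lemma sum_mul:
  "(\<And>i. i \<in> I \<Longrightarrow> F i \<in> \<A>) \<Longrightarrow> G \<in> \<A> \<Longrightarrow> (\<Sum>i\<in>I. F i) \<star> G = (\<Sum>i\<in>I. F i \<star> G)"
  by (induction I rule: infinite_finite_induct) (auto simp: mul_add_left sum_closed)

lemma mul_sum:
  "(\<And>i. i \<in> I \<Longrightarrow> F i \<in> \<A>) \<Longrightarrow> G \<in> \<A> \<Longrightarrow> G \<star> (\<Sum>i\<in>I. F i) = (\<Sum>i\<in>I. G \<star> F i)"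
  by (induction I rule: infinite_finite_induct) (auto simp: mul_add_right sum_closed)

lemma tmon_decomp:
  assumes "F \<in> \<A>" shows "F = (\<Sum>n | F n \<noteq> 0. tmon (F n) n)"
  using carrier_finite[OF assms] by (rule tmon_sum) simp

lemma coef_mul_tmon:
  assumes "f \<in> CM \<kappa>" and "h \<in> CM \<kappa>"
  shows "coef f \<star> tmon h n = tmon (f * h) n"
proof (induction n)
  show "coef f \<star> coef h = coef (f * h)" using assms by (rule coef_mul)
next
  fix n assume IH: "coef f \<star> tmon h n = tmon (f * h) n"
  have "coef f \<star> tmon h (Suc n) = (coef f \<star> tmon h n) \<star> tvar"
    using assms by (simp add: tmon_mul_t[symmetric] mul_assoc CM_one)
  also have "\<dots> = tmon (f * h) (Suc n)"
    unfolding IH using assms by (simp only: tmon_mul_t CM_mult)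
  finally show "coef f \<star> tmon h (Suc n) = tmon (f * h) (Suc n)" .
qed

lemma tmon_eq_coef_mul: "f \<in> CM \<kappa> \<Longrightarrow> coef f \<star> tpow n = tmon f n"
  by (simp add: coef_mul_tmon CM_one)

lemma tpow_mul_t: "tpow n \<star> tvar = tpow (Suc n)"
  by (simp add: tmon_mul_t CM_one)

lemma t_mul_tpow: "tvar \<star> tpow n = tpow (Suc n)"
proof (induction n)
  show "tvar \<star> coef 1 = tpow (Suc 0)" by (simp add: CM_one One_nat_def)
next
  fix n assume Suc: "tvar \<star> tpow n = tpow (Suc n)"
  have "tvar \<star> tpow (Suc n) = (tvar \<star> tpow n) \<star> tvar"
    by (simp only: tpow_mul_t[symmetric, of n] mul_assoc tpow_closed)
  then show "tvar \<star> tpow (Suc n) = tpow (Suc (Suc n))" by (simp add: Suc tpow_mul_t)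
qed

lemma coef_mul_eq: 
  assumes "f \<in> CM \<kappa>" and "F \<in> \<A>"
  shows "coef f \<star> F = (\<lambda>n. f * F n)"
proof -
  let ?I = "{n. F n \<noteq> 0}"
  have "coef f \<star> F = (\<Sum>n\<in>?I. coef f \<star> tmon (F n) n)"
    by (subst tmon_decomp[OF assms(2)]) (use assms in \<open>auto simp: mul_sum carrier_coeff\<close>)
  also have "\<dots> = (\<Sum>n\<in>?I. tmon (f * F n) n)"
    using assms by (intro sum.cong refl coef_mul_tmon) (auto simp: carrier_coeff)
  also have "\<dots> = (\<lambda>n. f * F n)"
    by (rule tmon_sum[symmetric]) (use carrier_finite[OF assms(2)] in auto)
  finally show ?thesis .
qed

lemma scl_mul: "F \<in> \<A> \<Longrightarrow> scl c \<star> F = nscale c F"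
  by (simp add: coef_mul_eq CM_const nscale_def fun_eq_iff)

lemma scl_t_comm: "tvar \<star> scl c = scl c \<star> tvar"
  using coef_t_comm[OF CM_const, of c] by (simp add: vf_apply_const zero_fun_def[symmetric])

text \<open>Constants are central because \<open>\<tau>\<close> annihilates them; this makes the product and the actions real
  bilinear.\<close>

lemma scl_central: 
  assumes "F \<in> \<A>" shows "F \<star> scl c = scl c \<star> F"
proof -
  have mono: "tmon f n \<star> scl c = scl c \<star> tmon f n" if "f \<in> CM \<kappa>" for f n
  proof (induction n)
    case 0
    show ?case using that by (simp add: coef_mul CM_const mult.commute)
  next
    case (Suc n)
    have "tmon f (Suc n) \<star> scl c = tmon f n \<star> (scl c \<star> tvar)"
      using that by (simp add: tmon_mul_t[symmetric] mul_assoc scl_t_comm CM_one)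
    also have "\<dots> = (tmon f n \<star> scl c) \<star> tvar"
      using that by (simp add: mul_assoc CM_one)
    also have "\<dots> = scl c \<star> tmon f (Suc n)"
      unfolding Suc using that by (simp add: mul_assoc tmon_mul_t CM_one)
    finally show ?case .
  qed
  show ?thesis
    using assms
    by (subst (1 2) tmon_decomp[OF assms]) 
      (auto simp: mul_sum sum_mul carrier_coeff mono)
qed

lemma mul_scl: "F \<in> \<A> \<Longrightarrow> F \<star> scl c = nscale c F"
  by (simp add: scl_central scl_mul)

lemma nscale_mul_left: "F \<in> \<A> \<Longrightarrow> G \<in> \<A> \<Longrightarrow> nscale c F \<star> G = nscale c (F \<star> G)"
  by (simp add: scl_mul[symmetric] mul_assoc)

lemma nscale_mul_right: "F \<in> \<A> \<Longrightarrow> G \<in> \<A> \<Longrightarrow> F \<star> nscale c G = nscale c (F \<star> G)"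
  by (simp add: mul_scl[symmetric] mul_assoc)

text \<open>Since products are normal ordered elements, the commutator \<open>[f, t] = \<lambda> \<tau>(f)\<close> already shows that
  \<open>\<tau>(f)\<close> is smooth. The smoothness of \<open>\<alpha>\<close>, \<open>\<Delta>f\<close> and \<open>df\<close> is read off from the calculus in the same
  way below.\<close>

lemma tau_smooth: "f \<in> CM \<kappa> \<Longrightarrow> vf_apply \<kappa> \<tau> f \<in> CM \<kappa>"
  using diff_closed[of "coef f \<star> tvar" "tvar \<star> coef f"] lam_nonzero
  by (auto simp: coef_t_comm CM_one dest!: tmon_in_carrierD intro: CM_unscale[of lam])

lemma t_mul_coef:
  "f \<in> CM \<kappa> \<Longrightarrow> tvar \<star> coef f = tmon f 1 - nscale lam (coef (vf_apply \<kappa> \<tau> f))"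
  using coef_t_comm[of f] tmon_mul_t[of f 0] by (simp add: nscale_tmon algebra_simps One_nat_def)

definition shift_pow :: "('m \<Rightarrow> real) \<Rightarrow> nat \<Rightarrow> 'm nord" where
  "shift_pow a n = (tvar + coef (\<lambda>p. lam * a p)) [^]\<^bsub>st_ring \<kappa> S\<^esub> n"

lemma shift_pow_0 [simp]: "shift_pow a 0 = coef 1"
  by (simp add: shift_pow_def)

lemma shift_pow_Suc:
  "a \<in> CM \<kappa> \<Longrightarrow> shift_pow a (Suc n) = shift_pow a n \<star> (tvar + nscale lam (coef a))"
  by (simp add: shift_pow_def nscale_tmon)

lemma shift_pow_closed [simp, intro]: "a \<in> CM \<kappa> \<Longrightarrow> shift_pow a n \<in> \<A>"
proof (induction n)
  case (Suc n)
  then show ?case by (simp add: shift_pow_Suc)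
qed (simp add: CM_one)

lemma shift_by_eq:
  assumes "a \<in> CM \<kappa>" and "F \<in> \<A>" and "finite I" and "{n. F n \<noteq> 0} \<subseteq> I"
  shows "shift_by \<kappa> S lam a F = (\<Sum>n\<in>I. coef (F n) \<star> shift_pow a n)"
  unfolding shift_by_def shift_pow_def[symmetric]
  using assms by (intro sum.mono_neutral_left) auto

lemma shift_by_tpow:
  assumes "a \<in> CM \<kappa>" shows "shift_by \<kappa> S lam a (tpow k) = shift_pow a k"
proof -
  have "{n. tpow k n \<noteq> 0} \<subseteq> {k}" by (auto simp: tmon_def)
  then show ?thesis
    using assms by (subst shift_by_eq[where I = "{k}"]) auto
qed

lemma shift_by_closed [intro]: "a \<in> CM \<kappa> \<Longrightarrow> F \<in> \<A> \<Longrightarrow> shift_by \<kappa> S lam a F \<in> \<A>"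
  by (subst shift_by_eq[where I = "{n. F n \<noteq> 0}"]) (auto simp: carrier_finite carrier_coeff)

text \<open>Left multiplication by \<open>t\<close> raises the degree by exactly one and keeps the leading coefficient,
  since the correction \<open>- \<lambda> \<tau>\<close> does not change the power of \<open>t\<close>.\<close>

lemma t_mul_coeff:
  assumes "F \<in> \<A>"
  shows "(tvar \<star> F) 0 = (\<lambda>p. - lam * vf_apply \<kappa> \<tau> (F 0) p)"
    and "(tvar \<star> F) (Suc k) = (\<lambda>p. F k p - lam * vf_apply \<kappa> \<tau> (F (Suc k)) p)"
proof -
  let ?I = "{n. F n \<noteq> 0}"
  have tmon: "tvar \<star> tmon f n = tmon f (Suc n) - tmon (\<lambda>p. lam * vf_apply \<kappa> \<tau> f p) n" if f: "f \<in> CM \<kappa>" for f n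
  proof -
    have "tvar \<star> tmon f n = (tvar \<star> coef f) \<star> tpow n"
      using f by (simp add: mul_assoc tmon_eq_coef_mul)
    also have "\<dots> = tmon f 1 \<star> tpow n - nscale lam (coef (vf_apply \<kappa> \<tau> f)) \<star> tpow n"
      using f by (simp add: t_mul_coef mul_diff_left tau_smooth)
    also have "tmon f 1 \<star> tpow n = coef f \<star> (tvar \<star> tpow n)"
      using f tmon_mul_t[of f 0, symmetric] by (simp add: mul_assoc One_nat_def)
    also have "\<dots> = tmon f (Suc n)"
      using f by (simp add: t_mul_tpow tmon_eq_coef_mul)
    also have "nscale lam (coef (vf_apply \<kappa> \<tau> f)) \<star> tpow n = tmon (\<lambda>p. lam * vf_apply \<kappa> \<tau> f p) n"
      using f by (simp add: nscale_mul_left[OF tmon_closed] tmon_eq_coef_mul tau_smooth)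
        (simp add: nscale_tmon)
    finally show ?thesis .
  qed
  let ?G = "\<lambda>k. \<lambda>p. lam * vf_apply \<kappa> \<tau> (F k) p"
  have "tvar \<star> F = (\<Sum>n\<in>?I. tmon (F n) (Suc n) - tmon (?G n) n)"
    by (subst tmon_decomp[OF assms]) (use assms in \<open>auto simp: mul_sum carrier_coeff tmon\<close>)
  also have "\<dots> = (\<Sum>n\<in>?I. tmon (F n) (Suc n)) - ?G"
    unfolding sum_subtractf
    by (subst tmon_sum[where F = "?G" and I = "?I"]) 
      (use assms in \<open>auto simp: carrier_finite vf_apply_def bdiff_zero zero_fun_def[symmetric]\<close>)
  finally have *: "tvar \<star> F = (\<Sum>n\<in>?I. tmon (F n) (Suc n)) - ?G" .
  have "(\<Sum>n\<in>?I. tmon (F n) (Suc n)) 0 = 0"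
    by (simp add: sum_fun_apply)
  then show "(tvar \<star> F) 0 = (\<lambda>p. - lam * vf_apply \<kappa> \<tau> (F 0) p)"
    by (simp add: * fun_eq_iff)
  have "(\<Sum>n\<in>?I. tmon (F n) (Suc n)) (Suc k) = (\<Sum>n\<in>?I. tmon (F n) n) k"
    by (simp add: sum_fun_apply tmon_def)
  also have "\<dots> = F k"
    by (rule fun_cong[OF tmon_decomp[OF assms, symmetric]])
  finally show "(tvar \<star> F) (Suc k) = (\<lambda>p. F k p - lam * vf_apply \<kappa> \<tau> (F (Suc k)) p)"
    by (simp add: * fun_eq_iff)
qed

section \<open>The bimodule of forms\<close>

lemma bimodule_axioms: "bimodule (st_ring \<kappa> S) \<W> (lact S) (ract S)"
  using calculus by (simp add: spacetime_calculus_def)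

lemma act_closed [simp, intro]:
  "F \<in> \<A> \<Longrightarrow> x \<in> \<W> \<Longrightarrow> F \<triangleright> x \<in> \<W>" "F \<in> \<A> \<Longrightarrow> x \<in> \<W> \<Longrightarrow> x \<triangleleft> F \<in> \<W>"
  using bimodule_axioms by (simp_all add: bimodule_def)

lemma act_one [simp]: "x \<in> \<W> \<Longrightarrow> coef 1 \<triangleright> x = x" "x \<in> \<W> \<Longrightarrow> x \<triangleleft> coef 1 = x"
  using bimodule_axioms by (simp_all add: bimodule_def)

lemma act_add_form:
  "F \<in> \<A> \<Longrightarrow> x \<in> \<W> \<Longrightarrow> y \<in> \<W> \<Longrightarrow> F \<triangleright> (x + y) = F \<triangleright> x + F \<triangleright> y"
  "F \<in> \<A> \<Longrightarrow> x \<in> \<W> \<Longrightarrow> y \<in> \<W> \<Longrightarrow> (x + y) \<triangleleft> F = x \<triangleleft> F + y \<triangleleft> F"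
  using bimodule_axioms by (simp_all add: bimodule_def)

lemma act_add_alg:
  "F \<in> \<A> \<Longrightarrow> G \<in> \<A> \<Longrightarrow> x \<in> \<W> \<Longrightarrow> (F + G) \<triangleright> x = F \<triangleright> x + G \<triangleright> x"
  "F \<in> \<A> \<Longrightarrow> G \<in> \<A> \<Longrightarrow> x \<in> \<W> \<Longrightarrow> x \<triangleleft> (F + G) = x \<triangleleft> F + x \<triangleleft> G"
  using bimodule_axioms by (simp_all add: bimodule_def)

lemma act_mul:
  "F \<in> \<A> \<Longrightarrow> G \<in> \<A> \<Longrightarrow> x \<in> \<W> \<Longrightarrow> (F \<star> G) \<triangleright> x = F \<triangleright> (G \<triangleright> x)"
  "F \<in> \<A> \<Longrightarrow> G \<in> \<A> \<Longrightarrow> x \<in> \<W> \<Longrightarrow> x \<triangleleft> (F \<star> G) = x \<triangleleft> F \<triangleleft> G"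
  using bimodule_axioms by (simp_all add: bimodule_def)

lemma act_assoc: "F \<in> \<A> \<Longrightarrow> G \<in> \<A> \<Longrightarrow> x \<in> \<W> \<Longrightarrow> (F \<triangleright> x) \<triangleleft> G = F \<triangleright> (x \<triangleleft> G)"
  using bimodule_axioms by (simp add: bimodule_def)

lemma act_minus_alg:
  assumes "F \<in> \<A>" "x \<in> \<W>"
  shows "(- F) \<triangleright> x = - (F \<triangleright> x)" "x \<triangleleft> (- F) = - (x \<triangleleft> F)"
proof -
  have zero: "0 \<triangleright> x = 0" "x \<triangleleft> 0 = 0"
    using act_add_alg[of 0 0 x] assms by simp_all
  show "(- F) \<triangleright> x = - (F \<triangleright> x)" "x \<triangleleft> (- F) = - (x \<triangleleft> F)"
    using act_add_alg[of F "- F" x] zero assms by (simp_all add: eq_neg_iff_add_eq_0 add.commute)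
qed

lemma act_diff_alg:
  "F \<in> \<A> \<Longrightarrow> G \<in> \<A> \<Longrightarrow> x \<in> \<W> \<Longrightarrow> (F - G) \<triangleright> x = F \<triangleright> x - G \<triangleright> x"
  "F \<in> \<A> \<Longrightarrow> G \<in> \<A> \<Longrightarrow> x \<in> \<W> \<Longrightarrow> x \<triangleleft> (F - G) = x \<triangleleft> F - x \<triangleleft> G"
  using act_add_alg[of F "- G" x] by (simp_all add: act_minus_alg)

lemma act_zero_alg [simp]: "x \<in> \<W> \<Longrightarrow> 0 \<triangleright> x = 0" "x \<in> \<W> \<Longrightarrow> x \<triangleleft> 0 = 0"
  using act_diff_alg[of 0 0 x] by simp_all

lemma act_sum_alg:
  assumes x: "x \<in> \<W>"
  shows "(\<And>i. i \<in> I \<Longrightarrow> F i \<in> \<A>) \<Longrightarrow> (\<Sum>i\<in>I. F i) \<triangleright> x = (\<Sum>i\<in>I. F i \<triangleright> x)"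
    and "(\<And>i. i \<in> I \<Longrightarrow> F i \<in> \<A>) \<Longrightarrow> x \<triangleleft> (\<Sum>i\<in>I. F i) = (\<Sum>i\<in>I. x \<triangleleft> F i)"
  by (induction I rule: infinite_finite_induct) (auto simp: act_add_alg sum_closed x)

lemma zero_form: "0 \<in> one_forms \<kappa>"
  by (simp add: one_forms_def form_rep_def zero_fun_def smooth_on_const linear_zero)

lemma gtheta_closed [simp, intro]: "f \<in> CM \<kappa> \<Longrightarrow> gtheta f n \<in> \<W>"
  and gdt_closed [simp, intro]: "f \<in> CM \<kappa> \<Longrightarrow> gdt f n \<in> \<W>"
  and gform_closed [simp, intro]: "\<omega> \<in> one_forms \<kappa> \<Longrightarrow> gform \<omega> n \<in> \<W>"
proof -
  have z: "0 \<in> fin_seqs (one_forms \<kappa>)" "0 \<in> fin_seqs (CM \<kappa>)"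
    by (simp_all add: fin_seqs_def zero_form CM_zero)
  have t: "tmon \<omega> n \<in> fin_seqs (one_forms \<kappa>)" if "\<omega> \<in> one_forms \<kappa>" for \<omega>
    using that zero_form
    by (auto simp: fin_seqs_def tmon_def intro: finite_subset[of _ "{n}"])
  show "f \<in> CM \<kappa> \<Longrightarrow> gtheta f n \<in> \<W>" "f \<in> CM \<kappa> \<Longrightarrow> gdt f n \<in> \<W>"
    using z tmon_closed[of f n] by (simp_all add: gtheta_def gdt_def nform_carrier_def nord_carrier_def)
  show "\<omega> \<in> one_forms \<kappa> \<Longrightarrow> gform \<omega> n \<in> \<W>"
    using z t by (simp add: gform_def nform_carrier_def)
qed

lemma theta_gen_closed [simp, intro]: "\<theta> \<in> \<W>" and dt_gen_closed [simp, intro]: "dt \<in> \<W>"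
  by (simp_all add: CM_one)

lemma normal_form: "normal_form_actions \<kappa> S"
  using calculus by (simp add: spacetime_calculus_def)

lemma relations: "calculus_relations \<kappa> g \<tau> \<zeta> \<beta> lam S"
  using calculus by (simp add: spacetime_calculus_def)

lemma derivation: "calculus_derivation \<kappa> g \<zeta> lam S"
  using calculus by (simp add: spacetime_calculus_def)

lemma coef_act_theta: "f \<in> CM \<kappa> \<Longrightarrow> coef f \<triangleright> \<theta> = gtheta f 0"
  and coef_act_dt: "f \<in> CM \<kappa> \<Longrightarrow> coef f \<triangleright> dt = gdt f 0"
  and gform_act_t: "\<omega> \<in> one_forms \<kappa> \<Longrightarrow> gform \<omega> n \<triangleleft> tvar = gform \<omega> (Suc n)"
  and gtheta_act_t: "f \<in> CM \<kappa> \<Longrightarrow> gtheta f n \<triangleleft> tvar = gtheta f (Suc n)"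
  using normal_form unfolding normal_form_actions_def by blast+

lemma gform_act_tpow:
  assumes "\<omega> \<in> one_forms \<kappa>"
  shows "gform \<omega> 0 \<triangleleft> tpow n = gform \<omega> n"
proof (induction n)
  show "gform \<omega> 0 \<triangleleft> coef 1 = gform \<omega> 0" using assms by simp
next
  fix n assume "gform \<omega> 0 \<triangleleft> tpow n = gform \<omega> n"
  then show "gform \<omega> 0 \<triangleleft> tpow (Suc n) = gform \<omega> (Suc n)"
    using assms by (simp add: tpow_mul_t[symmetric] act_mul gform_act_t CM_one)
qed

lemma gtheta_act_tpow:
  assumes "f \<in> CM \<kappa>"
  shows "gtheta f 0 \<triangleleft> tpow n = gtheta f n"
proof (induction n)
  show "gtheta f 0 \<triangleleft> coef 1 = gtheta f 0" using assms by simp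
next
  fix n assume "gtheta f 0 \<triangleleft> tpow n = gtheta f n"
  then show "gtheta f 0 \<triangleleft> tpow (Suc n) = gtheta f (Suc n)"
    using assms by (simp add: tpow_mul_t[symmetric] act_mul gtheta_act_t CM_one)
qed

lemma theta_comm_coef: "f \<in> CM \<kappa> \<Longrightarrow> \<theta> \<triangleleft> coef f = coef f \<triangleright> \<theta>"
  using relations unfolding calculus_relations_def Let_def comm_def right_minus_eq by blast

lemma theta_comm_t: "\<theta> \<triangleleft> tvar - tvar \<triangleright> \<theta> = gtheta (\<lambda>p. lam * \<alpha> p) 0"
  using relations unfolding calculus_relations_def Let_def comm_def by blast

lemma dt_comm_t:
  "dt \<triangleleft> tvar - tvar \<triangleright> dt = gtheta (\<lambda>p. lam * \<beta> p) 0 - gdt (\<lambda>p. lam) 0"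
  using relations unfolding calculus_relations_def Let_def comm_def by blast

lemma der_closed [simp, intro]: "F \<in> \<A> \<Longrightarrow> der S F \<in> \<W>"
  and der_add: "F \<in> \<A> \<Longrightarrow> G \<in> \<A> \<Longrightarrow> der S (F + G) = der S F + der S G"
  and der_mul: "F \<in> \<A> \<Longrightarrow> G \<in> \<A> \<Longrightarrow> der S (F \<star> G) = der S F \<triangleleft> G + F \<triangleright> der S G"
  and der_t: "der S tvar = dt"
  and der_coef: "f \<in> CM \<kappa> \<Longrightarrow>
        der S (coef f) = gform (bdiff \<kappa> f) 0 + gtheta (\<lambda>p. lam / 2 * blaplace \<kappa> g \<zeta> f p) 0"
  using derivation unfolding calculus_derivation_def by blast+

text \<open>As \<open>\<theta>'\<close> commutes with functions, the right multiples of \<open>\<theta>'\<close> are exactly the forms whose normal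
  form has only \<open>\<theta>'\<close>-coefficients.\<close>

lemma theta_act:
  assumes "F \<in> \<A>" shows "\<theta> \<triangleleft> F = (0, F, 0)"
proof -
  let ?I = "{n. F n \<noteq> 0}"
  have mono: "\<theta> \<triangleleft> tmon f n = gtheta f n" if "f \<in> CM \<kappa>" for f n
  proof -
    have "\<theta> \<triangleleft> (coef f \<star> tpow n) = gtheta f 0 \<triangleleft> tpow n"
      using that by (simp only: act_mul tmon_closed tpow_closed theta_gen_closed theta_comm_coef coef_act_theta)
    with that show ?thesis by (simp add: tmon_eq_coef_mul gtheta_act_tpow)
  qed
  have "\<theta> \<triangleleft> F = (\<Sum>n\<in>?I. gtheta (F n) n)"
    by (subst tmon_decomp[OF assms]) (use assms in \<open>auto simp: act_sum_alg carrier_coeff mono\<close>)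
  also have "\<dots> = (0, \<Sum>n\<in>?I. tmon (F n) n, 0)"
    by (simp add: prod_eq_iff fst_sum snd_sum gtheta_def)
  also have "(\<Sum>n\<in>?I. tmon (F n) n) = F"
    by (rule tmon_decomp[OF assms, symmetric])
  finally show ?thesis .
qed

lemma theta_coeff_smooth: "x \<in> \<W> \<Longrightarrow> fst (snd x) n \<in> CM \<kappa>"
  by (auto simp: nform_carrier_def fin_seqs_def)

lemma conf_smooth: "\<alpha> \<in> CM \<kappa>"
proof (rule CM_unscale)
  let ?x = "\<theta> \<triangleleft> tvar" and ?y = "tvar \<triangleright> \<theta>"
  have "(\<lambda>p. lam * \<alpha> p) = fst (snd (?x - ?y)) 0"
    by (simp only: theta_comm_t) (simp add: gtheta_def)
  also have "\<dots> = fst (snd ?x) 0 + - fst (snd ?y) 0"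
    by simp
  also have "\<dots> \<in> CM \<kappa>"
    by (intro CM_add CM_minus theta_coeff_smooth act_closed tpow_closed theta_gen_closed)
  finally show "(\<lambda>p. lam * \<alpha> p) \<in> CM \<kappa>" .
qed (fact lam_nonzero)

lemma blaplace_smooth:
  assumes "f \<in> CM \<kappa>" shows "blaplace \<kappa> g \<zeta> f \<in> CM \<kappa>"
proof (rule CM_unscale)
  have "(\<lambda>p. lam / 2 * blaplace \<kappa> g \<zeta> f p) = fst (snd (der S (coef f))) 0"
    using assms by (simp add: der_coef gtheta_def gform_def)
  also have "\<dots> \<in> CM \<kappa>"
    using assms by (intro theta_coeff_smooth der_closed tmon_closed)
  finally show "(\<lambda>p. lam / 2 * blaplace \<kappa> g \<zeta> f p) \<in> CM \<kappa>" .
qed (simp add: lam_nonzero)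

lemma bdiff_form:
  assumes "f \<in> CM \<kappa>" shows "bdiff \<kappa> f \<in> one_forms \<kappa>"
proof -
  have "bdiff \<kappa> f = fst (der S (coef f)) 0"
    using assms by (simp add: der_coef gtheta_def gform_def)
  also have "\<dots> \<in> one_forms \<kappa>"
    using der_closed[OF tmon_closed[OF assms, of 0]]
    by (auto simp: nform_carrier_def fin_seqs_def mem_Times_iff)
  finally show ?thesis .
qed

lemma t_act_theta: "tvar \<triangleright> \<theta> = \<theta> \<triangleleft> (tvar - nscale lam (coef \<alpha>))"
  using theta_comm_t
  by (simp add: act_diff_alg conf_smooth nscale_tmon theta_comm_coef CM_scale coef_act_theta algebra_simps)

lemma theta_act_t: "\<theta> \<triangleleft> tvar = (tvar + nscale lam (coef \<alpha>)) \<triangleright> \<theta>"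
  using theta_comm_t
  by (simp add: act_add_alg conf_smooth nscale_tmon CM_scale coef_act_theta algebra_simps)

text \<open>Iterates \<open>\<theta>' t = (t + \<lambda>\<alpha>) \<theta>'\<close>; the powers on the right are those of the algebra, in which \<open>t\<close>
  and \<open>\<alpha>\<close> need not commute.\<close>

lemma theta_act_tpow: "\<theta> \<triangleleft> tpow n = shift_pow \<alpha> n \<triangleright> \<theta>"
proof (induction n)
  show "\<theta> \<triangleleft> coef 1 = shift_pow \<alpha> 0 \<triangleright> \<theta>" by simp
next
  fix n assume IH: "\<theta> \<triangleleft> tpow n = shift_pow \<alpha> n \<triangleright> \<theta>"
  have "\<theta> \<triangleleft> tpow (Suc n) = (shift_pow \<alpha> n \<triangleright> \<theta>) \<triangleleft> tvar"
    by (simp add: tpow_mul_t[symmetric] act_mul IH)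
  also have "\<dots> = shift_pow \<alpha> (Suc n) \<triangleright> \<theta>"
    by (simp add: act_assoc theta_act_t act_mul shift_pow_Suc conf_smooth)
  finally show "\<theta> \<triangleleft> tpow (Suc n) = shift_pow \<alpha> (Suc n) \<triangleright> \<theta>" .
qed

text \<open>The opposite direction, \<open>t \<theta>' = \<theta>' (t - \<lambda>\<alpha>)\<close>. Only the leading coefficient of the result matters
  for injectivity, and it is unaffected by the lower order terms that the commutators create.\<close>

lemma tpow_act_theta:
  "\<exists>G\<in>\<A>. tpow n \<triangleright> \<theta> = \<theta> \<triangleleft> G \<and> G n = 1 \<and> (\<forall>k>n. G k = 0)"
proof (induction n)
  show "\<exists>G\<in>\<A>. coef 1 \<triangleright> \<theta> = \<theta> \<triangleleft> G \<and> G 0 = 1 \<and> (\<forall>k>0. G k = 0)"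
    by (rule bexI[of _ "coef 1"]) simp_all
next
  fix n assume "\<exists>G\<in>\<A>. tpow n \<triangleright> \<theta> = \<theta> \<triangleleft> G \<and> G n = 1 \<and> (\<forall>k>n. G k = 0)"
  then obtain G where G: "G \<in> \<A>" "tpow n \<triangleright> \<theta> = \<theta> \<triangleleft> G" "G n = 1" "\<And>k. k > n \<Longrightarrow> G k = 0"
    by blast
  let ?H = "tvar \<star> G - nscale lam (coef \<alpha> \<star> G)"
  have "tpow (Suc n) \<triangleright> \<theta> = tvar \<triangleright> (\<theta> \<triangleleft> G)"
    by (simp add: t_mul_tpow[symmetric] act_mul G)
  also have "\<dots> = \<theta> \<triangleleft> ((tvar - nscale lam (coef \<alpha>)) \<star> G)"
    by (simp add: act_assoc[symmetric] G t_act_theta act_mul conf_smooth)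
  also have "(tvar - nscale lam (coef \<alpha>)) \<star> G = ?H"
    by (simp add: mul_diff_left nscale_mul_left conf_smooth G)
  finally have "tpow (Suc n) \<triangleright> \<theta> = \<theta> \<triangleleft> ?H" .
  moreover have H: "?H (Suc k) = G k" if "k \<ge> n" for k
  proof -
    have "G (Suc k) = 0" using that by (intro G(4)) simp
    then show ?thesis
      by (simp add: t_mul_coeff(2) coef_mul_eq G(1) conf_smooth nscale_def vf_apply_zero)
         (simp add: fun_eq_iff)
  qed
  have "?H (Suc n) = 1"
    using H[of n] G(3) by simp
  moreover have "?H k = 0" if "k > Suc n" for k
    using that H[of "k - 1"] G(4)[of "k - 1"] by (cases k) simp_all
  moreover have "?H \<in> \<A>"
    using G(1) by (simp add: conf_smooth)
  ultimately show "\<exists>G\<in>\<A>. tpow (Suc n) \<triangleright> \<theta> = \<theta> \<triangleleft> G \<and> G (Suc n) = 1 \<and> (\<forall>k>Suc n. G k = 0)"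
    by blast
qed

text \<open>If \<open>F\<close> has leading coefficient \<open>F\<^sub>N\<close>, then \<open>F \<theta>' = \<theta>' G\<close> where \<open>G\<close> has the same leading coefficient in
  degree \<open>N\<close>, and \<open>\<theta>' G = 0\<close> forces \<open>G = 0\<close>.\<close>

lemma act_theta_eq_zero:
  assumes F: "F \<in> \<A>" and "F \<triangleright> \<theta> = 0"
  shows "F = 0"
proof (rule ccontr)
  assume "F \<noteq> 0"
  let ?I = "{n. F n \<noteq> 0}"
  have fin: "finite ?I"
    using carrier_finite[OF F] .
  have "\<exists>n. F n \<noteq> 0"
    using \<open>F \<noteq> 0\<close> by (metis ext zero_fun_apply)
  then have ne: "?I \<noteq> {}"
    by simp
  define N where "N = Max ?I"
  have N: "N \<in> ?I"
    unfolding N_def using fin ne by (rule Max_in)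
  have N_max: "n \<le> N" if "n \<in> ?I" for n
    unfolding N_def using fin that by (rule Max_ge)
  obtain G where G: "\<And>n. G n \<in> \<A>" "\<And>n. tpow n \<triangleright> \<theta> = \<theta> \<triangleleft> G n" "\<And>n. G n n = 1"
      "\<And>n k. k > n \<Longrightarrow> G n k = 0"
    using tpow_act_theta by metis
  have mono: "tmon f n \<triangleright> \<theta> = \<theta> \<triangleleft> (coef f \<star> G n)" if "f \<in> CM \<kappa>" for f n
  proof -
    have "tmon f n \<triangleright> \<theta> = coef f \<triangleright> (tpow n \<triangleright> \<theta>)"
      using that by (simp only: act_mul[symmetric] tmon_eq_coef_mul tmon_closed tpow_closed theta_gen_closed)
    also have "\<dots> = (coef f \<triangleright> \<theta>) \<triangleleft> G n"
      using that G(1) by (simp add: G(2) act_assoc)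
    also have "\<dots> = \<theta> \<triangleleft> (coef f \<star> G n)"
      using that G(1) by (simp add: theta_comm_coef[symmetric] act_mul)
    finally show ?thesis .
  qed
  have "F \<triangleright> \<theta> = (\<Sum>n\<in>?I. \<theta> \<triangleleft> (coef (F n) \<star> G n))"
    by (subst tmon_decomp[OF F]) (use F in \<open>auto simp: act_sum_alg carrier_coeff mono\<close>)
  also have "\<dots> = \<theta> \<triangleleft> (\<Sum>n\<in>?I. coef (F n) \<star> G n)"
    using F G(1) by (simp add: act_sum_alg carrier_coeff)
  finally have eq0: "\<theta> \<triangleleft> (\<Sum>n\<in>?I. coef (F n) \<star> G n) = 0"
    using assms(2) by simp
  moreover have "(\<Sum>n\<in>?I. coef (F n) \<star> G n) \<in> \<A>"
    using F G(1) by (auto simp: carrier_coeff)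
  ultimately have "(\<Sum>n\<in>?I. coef (F n) \<star> G n) = 0"
    by (simp add: theta_act prod_eq_iff)
  then have "(\<Sum>n\<in>?I. coef (F n) \<star> G n) N = 0"
    by simp
  moreover have "(\<Sum>n\<in>?I. coef (F n) \<star> G n) N = (\<Sum>n\<in>?I. F n * G n N)"
    using F G(1) by (simp add: sum_fun_apply coef_mul_eq carrier_coeff)
  moreover have "\<dots> = (\<Sum>n\<in>?I. if n = N then F N else 0)"
  proof (rule sum.cong)
    fix n assume "n \<in> ?I"
    then consider "n = N" | "n < N" using N_max[of n] by linarith
    then show "F n * G n N = (if n = N then F N else 0)"
      by cases (simp_all add: G(3,4))
  qed simp
  ultimately show False
    using N fin by simp
qed

lemma act_theta_inj:
  assumes "F \<in> \<A>" "G \<in> \<A>" "F \<triangleright> \<theta> = G \<triangleright> \<theta>" shows "F = G"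
  using act_theta_eq_zero[of "F - G"] assms by (simp add: act_diff_alg)

section \<open>The differential of a power of t\<close>

lemma shift_minus_one_pow_Suc:
  "shift_pow (- 1) (Suc n) = shift_pow (- 1) n \<star> (tvar - scl lam)"
proof -
  have "nscale lam (coef (- 1)) = - scl lam"
    by (auto simp: nscale_def tmon_def fun_eq_iff)
  then show ?thesis
    by (simp add: shift_pow_Suc CM_minus CM_one)
qed

definition partial_pow :: "nat \<Rightarrow> 'm nord" where
  "partial_pow k = partial0 \<kappa> S lam (tpow k)"

lemma partial_pow_eq: "partial_pow k = nscale (inverse lam) (tpow k - shift_pow (- 1) k)"
  by (simp add: partial_pow_def partial0_def shift_by_tpow)

lemma partial_pow_closed [simp, intro]: "partial_pow k \<in> \<A>"
  by (simp add: partial_pow_eq)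

lemma partial_pow_0: "partial_pow 0 = 0"
  by (simp add: partial_pow_eq)

lemma partial_pow_Suc: "partial_pow (Suc k) = partial_pow k \<star> (tvar - scl lam) + tpow k"
proof -
  let ?c = "tvar - scl lam"
  have "tpow (Suc k) - shift_pow (- 1) (Suc k) = (tpow k - shift_pow (- 1) k) \<star> ?c + nscale lam (tpow k)"
    by (simp add: shift_minus_one_pow_Suc mul_diff_left mul_diff_right tpow_mul_t mul_scl nscale_diff)
  then show ?thesis
    using lam_nonzero by (simp add: partial_pow_eq nscale_add nscale_nscale nscale_mul_left)
qed

text \<open>The recursion for \<open>\<Delta>\<^sub>0 t\<^sup>k\<close> that results from \<open>d(t\<^sup>k\<^sup>+\<^sup>1) = d(t\<^sup>k) t + t\<^sup>k dt\<close>; that it computes \<open>\<Delta>\<^sub>0\<close> is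
  \<open>Delta0_tpow\<close>.\<close>

primrec Delta_pow :: "nat \<Rightarrow> 'm nord" where
  "Delta_pow 0 = 0"
| "Delta_pow (Suc k) = partial_pow k \<star> coef \<beta> + Delta_pow k \<star> (tvar + nscale lam (coef \<alpha>))"

lemma Delta_pow_closed [simp, intro]: "Delta_pow k \<in> \<A>"
proof (induction k)
  show "Delta_pow 0 \<in> \<A>" by simp
next
  fix k assume "Delta_pow k \<in> \<A>"
  then show "Delta_pow (Suc k) \<in> \<A>" by (simp add: beta_smooth conf_smooth)
qed

lemma dt_act_t: "dt \<triangleleft> tvar = (tvar - scl lam) \<triangleright> dt + nscale lam (coef \<beta>) \<triangleright> \<theta>"
  using dt_comm_t
  by (simp add: act_diff_alg nscale_tmon CM_scale CM_const beta_smooth coef_act_dt coef_act_theta algebra_simps)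

lemma der_one: "der S (coef 1) = 0"
  using der_mul[of "coef 1" "coef 1"] by (simp add: CM_one)

text \<open>In \<open>d(t\<^sup>k) t\<close>, moving \<open>t\<close> to the left of \<open>dt\<close> produces both the shift by \<open>- \<lambda>\<close> in \<open>\<partial>\<^sub>0\<close> and the source term
  \<open>(\<partial>\<^sub>0 t\<^sup>k) \<lambda>\<beta> \<theta>'\<close> of \<open>\<Delta>\<^sub>0\<close>, while moving it to the left of \<open>\<theta>'\<close> produces the shift by \<open>\<lambda>\<alpha>\<close>.\<close>

lemma der_tpow: "der S (tpow k) = partial_pow k \<triangleright> dt + nscale lam (Delta_pow k) \<triangleright> \<theta>"
proof (induction k)
  show "der S (coef 1) = partial_pow 0 \<triangleright> dt + nscale lam (Delta_pow 0) \<triangleright> \<theta>"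
    by (simp add: der_one partial_pow_0)
next
  fix k assume IH: "der S (tpow k) = partial_pow k \<triangleright> dt + nscale lam (Delta_pow k) \<triangleright> \<theta>"
  let ?c = "tvar - scl lam" and ?a = "tvar + nscale lam (coef \<alpha>)"
  have cl: "?c \<in> \<A>" "?a \<in> \<A>" "nscale lam (coef \<beta>) \<in> \<A>"
    by (simp_all add: beta_smooth conf_smooth)
  have "der S (tpow (Suc k)) = (partial_pow k \<triangleright> dt) \<triangleleft> tvar + (nscale lam (Delta_pow k) \<triangleright> \<theta>) \<triangleleft> tvar + tpow k \<triangleright> dt"
    by (simp add: tpow_mul_t[symmetric] der_mul der_t IH act_add_form)
  also have "(partial_pow k \<triangleright> dt) \<triangleleft> tvar = (partial_pow k \<star> ?c) \<triangleright> dt + (partial_pow k \<star> nscale lam (coef \<beta>)) \<triangleright> \<theta>"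
    using cl by (simp add: act_assoc dt_act_t act_add_form act_mul)
  also have "(nscale lam (Delta_pow k) \<triangleright> \<theta>) \<triangleleft> tvar = (nscale lam (Delta_pow k) \<star> ?a) \<triangleright> \<theta>"
    using cl by (simp add: act_assoc theta_act_t act_mul)
  also have "(partial_pow k \<star> ?c) \<triangleright> dt + (partial_pow k \<star> nscale lam (coef \<beta>)) \<triangleright> \<theta> + (nscale lam (Delta_pow k) \<star> ?a) \<triangleright> \<theta> + tpow k \<triangleright> dt
      = (partial_pow k \<star> ?c + tpow k) \<triangleright> dt + (partial_pow k \<star> nscale lam (coef \<beta>) + nscale lam (Delta_pow k) \<star> ?a) \<triangleright> \<theta>"
    using cl by (simp add: act_add_alg)
  also have "partial_pow k \<star> nscale lam (coef \<beta>) + nscale lam (Delta_pow k) \<star> ?a = nscale lam (Delta_pow (Suc k))"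
    using cl by (simp add: nscale_mul_right nscale_mul_left nscale_add beta_smooth)
  finally have "der S (tpow (Suc k)) = (partial_pow k \<star> ?c + tpow k) \<triangleright> dt + nscale lam (Delta_pow (Suc k)) \<triangleright> \<theta>" .
  then show "der S (tpow (Suc k)) = partial_pow (Suc k) \<triangleright> dt + nscale lam (Delta_pow (Suc k)) \<triangleright> \<theta>"
    by (simp only: partial_pow_Suc)
qed

lemma Delta0_tpow:
  "(THE D. D \<in> \<A> \<and> der S (tpow k) = lact S (partial0 \<kappa> S lam (tpow k)) dt + lact S (nscale lam D) \<theta>) = Delta_pow k"
proof (rule the_equality)
  show "Delta_pow k \<in> \<A> \<and> der S (tpow k) = lact S (partial0 \<kappa> S lam (tpow k)) dt + lact S (nscale lam (Delta_pow k)) \<theta>"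
    by (simp add: der_tpow partial_pow_def[symmetric])
next
  fix D assume "D \<in> \<A> \<and> der S (tpow k) = lact S (partial0 \<kappa> S lam (tpow k)) dt + lact S (nscale lam D) \<theta>"
  then have D: "D \<in> \<A>" and "nscale lam D \<triangleright> \<theta> = nscale lam (Delta_pow k) \<triangleright> \<theta>"
    by (simp_all add: der_tpow partial_pow_def[symmetric])
  then have "nscale lam D = nscale lam (Delta_pow k)"
    by (intro act_theta_inj) simp_all
  then show "D = Delta_pow k"
    using lam_nonzero by (rule nscale_inj[rotated])
qed

lemma Delta0_eq:
  assumes "F \<in> \<A>"
  shows "Delta0 \<kappa> S lam F = (\<Sum>n | F n \<noteq> 0. coef (F n) \<star> Delta_pow n)"
  unfolding Delta0_def Delta0_tpow ..

lemma Delta0_closed [intro]: "F \<in> \<A> \<Longrightarrow> Delta0 \<kappa> S lam F \<in> \<A>"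
  by (auto simp: Delta0_eq carrier_coeff)

lemma partial0_eq:
  assumes "F \<in> \<A>"
  shows "partial0 \<kappa> S lam F = (\<Sum>n | F n \<noteq> 0. coef (F n) \<star> partial_pow n)"
proof -
  let ?I = "{n. F n \<noteq> 0}"
  have "F - shift_by \<kappa> S lam (- 1) F = (\<Sum>n\<in>?I. tmon (F n) n) - (\<Sum>n\<in>?I. coef (F n) \<star> shift_pow (- 1) n)"
    using assms tmon_decomp[OF assms] shift_by_eq[of "- 1" F ?I] carrier_finite[OF assms] by simp
  also have "\<dots> = (\<Sum>n\<in>?I. coef (F n) \<star> (tpow n - shift_pow (- 1) n))"
    using assms by (simp add: sum_subtractf[symmetric] mul_diff_right carrier_coeff tmon_eq_coef_mul)
  finally show ?thesis
    using assms by (simp add: partial0_def nscale_sum partial_pow_eq nscale_mul_right carrier_coeff)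
qed

section \<open>The wave operator at a fixed parameter\<close>

text \<open>Additivity of \<open>d\<close> gives \<open>d0 = 0\<close>, whose \<open>\<theta>'\<close>-part is \<open>\<lambda>/2 \<Delta>0\<close>.\<close>

lemma blaplace_zero: "blaplace \<kappa> g \<zeta> 0 = 0" 
proof -
  have "der S (0 + 0) = der S 0 + der S 0" by (intro der_add) simp_all
  then have "gform (bdiff \<kappa> 0) 0 + gtheta (\<lambda>p. lam / 2 * blaplace \<kappa> g \<zeta> 0 p) 0 = 0"
    using der_coef[OF CM_zero] by simp
  then have "tmon (\<lambda>p. lam / 2 * blaplace \<kappa> g \<zeta> 0 p) 0 (0::nat) = 0"
    by (simp add: gform_def gtheta_def prod_eq_iff)
  then show ?thesis
    using lam_nonzero by (simp add: fun_eq_iff)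
qed

lemma coeff_laplace_closed: "F \<in> \<A> \<Longrightarrow> coeff_laplace \<kappa> g \<zeta> F \<in> \<A>"
  unfolding nord_carrier_def fin_seqs_def coeff_laplace_def
  by (auto intro: blaplace_smooth blaplace_zero elim!: rev_finite_subset)

definition wave_formula :: "'m nord \<Rightarrow> 'm nord" where
  "wave_formula F = shift_by \<kappa> S lam \<alpha> (coeff_laplace \<kappa> g \<zeta> F) + nscale 2 (Delta0 \<kappa> S lam F)"

lemma wave_formula_closed [simp, intro]: "F \<in> \<A> \<Longrightarrow> wave_formula F \<in> \<A>"
  by (auto simp: wave_formula_def conf_smooth coeff_laplace_closed Delta0_closed shift_by_closed)

lemma wave_formula_eq:
  assumes "F \<in> \<A>"
  shows "wave_formula F = (\<Sum>n | F n \<noteq> 0. coef (blaplace \<kappa> g \<zeta> (F n)) \<star> shift_pow \<alpha> n + nscale 2 (coef (F n) \<star> Delta_pow n))"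
proof -
  let ?I = "{n. F n \<noteq> 0}"
  have "shift_by \<kappa> S lam \<alpha> (coeff_laplace \<kappa> g \<zeta> F) = (\<Sum>n\<in>?I. coef (blaplace \<kappa> g \<zeta> (F n)) \<star> shift_pow \<alpha> n)"
  proof -
    have "{n. coeff_laplace \<kappa> g \<zeta> F n \<noteq> 0} \<subseteq> ?I"
      by (auto simp: coeff_laplace_def blaplace_zero)
    from shift_by_eq[OF conf_smooth coeff_laplace_closed[OF assms] carrier_finite[OF assms] this]
    show ?thesis unfolding coeff_laplace_def .
  qed
  then show ?thesis
    using assms by (simp add: wave_formula_def Delta0_eq nscale_sum sum.distrib)
qed

lemma der_tmon:
  assumes f: "f \<in> CM \<kappa>"
  shows "der S (tmon f n) = gform (bdiff \<kappa> f) n + (coef f \<star> partial_pow n) \<triangleright> dt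
     + nscale (lam / 2) (coef (blaplace \<kappa> g \<zeta> f) \<star> shift_pow \<alpha> n + nscale 2 (coef f \<star> Delta_pow n)) \<triangleright> \<theta>"
proof -
  let ?L = "blaplace \<kappa> g \<zeta> f"
  note sm = f conf_smooth blaplace_smooth[OF f] bdiff_form[OF f]
  have L: "gtheta (\<lambda>p. lam / 2 * ?L p) 0 = nscale (lam / 2) (coef ?L) \<triangleright> \<theta>"
    unfolding nscale_tmon using sm by (intro coef_act_theta[symmetric] CM_scale)
  have "der S (tmon f n) = der S (coef f) \<triangleleft> tpow n + coef f \<triangleright> der S (tpow n)"
    using der_mul[of "coef f" "tpow n"] f by (simp add: tmon_eq_coef_mul)
  also have "der S (coef f) \<triangleleft> tpow n = gform (bdiff \<kappa> f) n + (nscale (lam / 2) (coef ?L) \<star> shift_pow \<alpha> n) \<triangleright> \<theta>"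
    unfolding der_coef[OF f] L
    using sm by (simp add: act_add_form gform_act_tpow act_assoc theta_act_tpow act_mul)
  also have "nscale (lam / 2) (coef ?L) \<star> shift_pow \<alpha> n = nscale (lam / 2) (coef ?L \<star> shift_pow \<alpha> n)"
    using sm by (simp add: nscale_mul_left)
  also have "coef f \<triangleright> der S (tpow n) = (coef f \<star> partial_pow n) \<triangleright> dt + nscale (lam / 2) (nscale 2 (coef f \<star> Delta_pow n)) \<triangleright> \<theta>"
    using sm by (simp add: der_tpow act_add_form act_mul[symmetric] nscale_mul_right nscale_nscale)
  finally have "der S (tmon f n) = gform (bdiff \<kappa> f) n + nscale (lam / 2) (coef ?L \<star> shift_pow \<alpha> n) \<triangleright> \<theta>
    + ((coef f \<star> partial_pow n) \<triangleright> dt + nscale (lam / 2) (nscale 2 (coef f \<star> Delta_pow n)) \<triangleright> \<theta>)" .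
  then show ?thesis
    using sm by (simp add: nscale_add act_add_alg add.assoc add.left_commute)
qed

lemma der_sum:
  fixes G :: "'i \<Rightarrow> 'm nord"
  shows "(\<And>i. i \<in> I \<Longrightarrow> G i \<in> \<A>) \<Longrightarrow> der S (\<Sum>i\<in>I. G i) = (\<Sum>i\<in>I. der S (G i))"
proof (induction I rule: infinite_finite_induct)
  have "der S (0 + 0) = der S 0 + der S 0" by (intro der_add) simp_all
  then have *: "der S 0 = 0" by simp
  then show "der S (\<Sum>i\<in>{}. G i) = (\<Sum>i\<in>{}. der S (G i))" by simp
  fix I :: "'i set" assume "infinite I"
  with * show "der S (\<Sum>i\<in>I. G i) = (\<Sum>i\<in>I. der S (G i))" by simp
next
  fix x :: 'i and I assume I: "finite I" "x \<notin> I"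
    and IH: "(\<And>i. i \<in> I \<Longrightarrow> G i \<in> \<A>) \<Longrightarrow> der S (\<Sum>i\<in>I. G i) = (\<Sum>i\<in>I. der S (G i))"
    and G: "\<And>i. i \<in> insert x I \<Longrightarrow> G i \<in> \<A>"
  have "der S (\<Sum>i\<in>I. G i) = (\<Sum>i\<in>I. der S (G i))" "(\<Sum>i\<in>I. G i) \<in> \<A>"
    using G by (auto intro!: IH sum_closed)
  then show "der S (\<Sum>i\<in>insert x I. G i) = (\<Sum>i\<in>insert x I. der S (G i))"
    using I G by (simp add: der_add)
qed

lemma coeff_diff_eq:
  assumes "F \<in> \<A>" shows "coeff_diff \<kappa> F = (\<Sum>n | F n \<noteq> 0. gform (bdiff \<kappa> (F n)) n)"
proof -
  have "(\<lambda>n. bdiff \<kappa> (F n)) = (\<Sum>n | F n \<noteq> 0. tmon (bdiff \<kappa> (F n)) n)"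
    by (rule tmon_sum) (use carrier_finite[OF assms] in \<open>auto simp: bdiff_zero\<close>)
  then show ?thesis
    by (simp add: coeff_diff_def gform_def prod_eq_iff fst_sum snd_sum)
qed

text \<open>Existence is the sum of \<open>der_tmon\<close> over the coefficients of \<open>F\<close>; uniqueness is the injectivity of
  \<open>F \<mapsto> F \<theta>'\<close>.\<close>

lemma is_wave_iff:
  assumes F: "F \<in> \<A>"
  shows "is_wave \<kappa> S lam F B \<longleftrightarrow> B = wave_formula F"
proof -
  let ?I = "{n. F n \<noteq> 0}"
  have sm: "F n \<in> CM \<kappa>" "blaplace \<kappa> g \<zeta> (F n) \<in> CM \<kappa>" for n
    using F by (simp_all add: carrier_coeff blaplace_smooth)
  let ?B = "\<lambda>n. coef (blaplace \<kappa> g \<zeta> (F n)) \<star> shift_pow \<alpha> n + nscale 2 (coef (F n) \<star> Delta_pow n)"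
  have "der S F = (\<Sum>n\<in>?I. der S (tmon (F n) n))"
    by (subst tmon_decomp[OF F]) (simp add: der_sum sm)
  also have "\<dots> = (\<Sum>n\<in>?I. gform (bdiff \<kappa> (F n)) n) + (\<Sum>n\<in>?I. (coef (F n) \<star> partial_pow n) \<triangleright> dt)
      + (\<Sum>n\<in>?I. nscale (lam / 2) (?B n) \<triangleright> \<theta>)"
    by (simp only: der_tmon[OF sm(1)] sum.distrib)
  also have "\<dots> = coeff_diff \<kappa> F + partial0 \<kappa> S lam F \<triangleright> dt + nscale (lam / 2) (wave_formula F) \<triangleright> \<theta>"
    using F sm conf_smooth by (simp add: coeff_diff_eq partial0_eq wave_formula_eq act_sum_alg nscale_sum)
  finally have d: "der S F = coeff_diff \<kappa> F + partial0 \<kappa> S lam F \<triangleright> dt + nscale (lam / 2) (wave_formula F) \<triangleright> \<theta>" .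
  show ?thesis
  proof
    assume "is_wave \<kappa> S lam F B"
    then have B: "B \<in> \<A>"
      and "coeff_diff \<kappa> F + partial0 \<kappa> S lam F \<triangleright> dt + nscale (lam / 2) (wave_formula F) \<triangleright> \<theta>
         = coeff_diff \<kappa> F + partial0 \<kappa> S lam F \<triangleright> dt + nscale (lam / 2) B \<triangleright> \<theta>"
      unfolding is_wave_def d by blast+
    from this(2) have "nscale (lam / 2) B \<triangleright> \<theta> = nscale (lam / 2) (wave_formula F) \<triangleright> \<theta>"
      by (metis add_left_imp_eq)
    with nscale_closed[OF B] nscale_closed[OF wave_formula_closed[OF F]]
    have "nscale (lam / 2) B = nscale (lam / 2) (wave_formula F)"
      by (rule act_theta_inj)
    moreover have "lam / 2 \<noteq> 0"
      using lam_nonzero by simp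
    ultimately show "B = wave_formula F"
      by (rule nscale_inj[rotated])
  next
    assume "B = wave_formula F"
    then show "is_wave \<kappa> S lam F B"
      using F by (simp add: is_wave_def d)
  qed
qed

lemma wave_eq: "F \<in> \<A> \<Longrightarrow> wave \<kappa> S lam F = wave_formula F"
  by (simp add: wave_def is_wave_iff)

end

section \<open>Smooth functions\<close>

text \<open>Near \<open>x\<close> the two functions have the same derivatives, if any, so the same one is chosen.\<close>

lemma frechet_derivative_cong_open:
  assumes "open S" "x \<in> S" "\<And>y. y \<in> S \<Longrightarrow> f y = h y"
  shows "frechet_derivative f (at x) = frechet_derivative h (at x)"
proof -
  have "(f has_derivative D) (at x) \<longleftrightarrow> (h has_derivative D) (at x)" for D
    using assms has_derivative_transform_within_open[of f D x UNIV S h]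
      has_derivative_transform_within_open[of h D x UNIV S f] by auto
  then show ?thesis
    by (simp add: frechet_derivative_def)
qed

text \<open>\<open>iter_deriv\<close> differentiates functions on the whole space, but only their values on an open set
  enter. This is what makes sum and scaling rules available for functions that are smooth on a
  coordinate domain only.\<close>

lemma iter_deriv_cong:
  assumes "open S" "x \<in> S" "\<And>y. y \<in> S \<Longrightarrow> f y = h y"
  shows "iter_deriv vs f x = iter_deriv vs h x"
  using assms(3)
proof (induction vs arbitrary: f h)
  case Nil
  then show ?case using assms(2) by simp
next
  case (Cons v vs)
  have "frechet_derivative f (at y) v = frechet_derivative h (at y) v" if "y \<in> S" for y
    using frechet_derivative_cong_open[OF assms(1) that Cons.prems] by (rule fun_cong)
  then show ?case unfolding iter_deriv.simps by (rule Cons.IH)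
qed

lemma smooth_on_deriv: "smooth_on S f \<Longrightarrow> smooth_on S (\<lambda>x. frechet_derivative f (at x) v)"
  unfolding smooth_on_def by (metis iter_deriv.simps(2))

lemma smooth_on_differentiable: "smooth_on S f \<Longrightarrow> x \<in> S \<Longrightarrow> f differentiable at x"
  unfolding smooth_on_def by (metis iter_deriv.simps(1))

lemma frechet_derivative_add:
  assumes "f differentiable at x" "h differentiable at x"
  shows "frechet_derivative (\<lambda>x. f x + h x) (at x) = (\<lambda>v. frechet_derivative f (at x) v + frechet_derivative h (at x) v)"
  by (rule frechet_derivative_at[symmetric], rule has_derivative_add)
    (use assms frechet_derivative_works in blast)+

lemma frechet_derivative_scale:
  fixes f :: "'a::euclidean_space \<Rightarrow> real"
  assumes "f differentiable at x"
  shows "frechet_derivative (\<lambda>x. c * f x) (at x) = (\<lambda>v. c * frechet_derivative f (at x) v)"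
  by (rule frechet_derivative_at[symmetric], rule has_derivative_mult_right)
    (use assms frechet_derivative_works in blast)

lemma iter_deriv_add:
  assumes S: "open S" "x \<in> S" and "smooth_on S f" "smooth_on S h"
  shows "iter_deriv vs (\<lambda>x. f x + h x) x = iter_deriv vs f x + iter_deriv vs h x"
  using assms(3,4)
proof (induction vs arbitrary: f h)
  case (Cons v vs)
  have "iter_deriv vs (\<lambda>x. frechet_derivative (\<lambda>x. f x + h x) (at x) v) x
      = iter_deriv vs (\<lambda>x. frechet_derivative f (at x) v + frechet_derivative h (at x) v) x"
    using Cons.prems by (intro iter_deriv_cong[OF S]) (simp add: frechet_derivative_add smooth_on_differentiable)
  also have "\<dots> = iter_deriv vs (\<lambda>x. frechet_derivative f (at x) v) x + iter_deriv vs (\<lambda>x. frechet_derivative h (at x) v) x"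
    using Cons.prems by (intro Cons.IH smooth_on_deriv)
  finally show ?case by simp
qed simp

lemma iter_deriv_scale:
  fixes f :: "'a::euclidean_space \<Rightarrow> real"
  assumes S: "open S" "x \<in> S" and "smooth_on S f"
  shows "iter_deriv vs (\<lambda>x. c * f x) x = c * iter_deriv vs f x"
  using assms(3)
proof (induction vs arbitrary: f)
  case (Cons v vs)
  have "iter_deriv vs (\<lambda>x. frechet_derivative (\<lambda>x. c * f x) (at x) v) x
      = iter_deriv vs (\<lambda>x. c * frechet_derivative f (at x) v) x"
    using Cons.prems by (intro iter_deriv_cong[OF S]) (simp add: frechet_derivative_scale smooth_on_differentiable)
  also have "\<dots> = c * iter_deriv vs (\<lambda>x. frechet_derivative f (at x) v) x"
    using Cons.prems by (intro Cons.IH smooth_on_deriv)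
  finally show ?case by simp
qed simp

lemma smooth_on_continuous: "smooth_on S f \<Longrightarrow> continuous_on S (iter_deriv vs f)"
  unfolding smooth_on_def
  by (meson continuous_at_imp_continuous_on differentiable_imp_continuous_within)

lemma open_coord_image: "smooth_manifold \<kappa> \<Longrightarrow> open (coord_image \<kappa> p)"
  by (simp add: smooth_manifold_def is_chart_def coord_image_def)

section \<open>Limits of smooth functions\<close>

lemma CM_limit_cong:
  assumes "CM_limit \<kappa> f h" and "\<And>lam. lam \<noteq> 0 \<Longrightarrow> f' lam = f lam"
  shows "CM_limit \<kappa> f' h"
  unfolding CM_limit_def
proof (intro allI impI)
  fix p vs K assume "compact K \<and> K \<subseteq> coord_image \<kappa> p"
  with assms(1) have *: "uniform_limit K (\<lambda>lam. iter_deriv vs (fun_rep \<kappa> (f lam) p))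
       (iter_deriv vs (fun_rep \<kappa> h p)) (at 0)"
    unfolding CM_limit_def by blast
  have "\<forall>\<^sub>F lam in at 0. \<forall>x\<in>K. iter_deriv vs (fun_rep \<kappa> (f' lam) p) x = iter_deriv vs (fun_rep \<kappa> (f lam) p) x"
    by (auto simp: eventually_at_filter assms(2))
  with * show "uniform_limit K (\<lambda>lam. iter_deriv vs (fun_rep \<kappa> (f' lam) p))
       (iter_deriv vs (fun_rep \<kappa> h p)) (at 0)"
    by (subst uniform_limit_cong) auto
qed

lemma CM_limit_const: "CM_limit \<kappa> (\<lambda>_. h) h"
  by (simp add: CM_limit_def uniform_limit_const)

lemma CM_limit_add:
  assumes \<kappa>: "smooth_manifold \<kappa>"
    and lim: "CM_limit \<kappa> f h" "CM_limit \<kappa> f' h'"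
    and smooth: "\<And>lam. lam \<noteq> 0 \<Longrightarrow> f lam \<in> CM \<kappa>" "\<And>lam. lam \<noteq> 0 \<Longrightarrow> f' lam \<in> CM \<kappa>"
      "h \<in> CM \<kappa>" "h' \<in> CM \<kappa>"
  shows "CM_limit \<kappa> (\<lambda>lam. f lam + f' lam) (h + h')"
  unfolding CM_limit_def
proof (intro allI impI)
  fix p vs K assume K: "compact K \<and> K \<subseteq> coord_image \<kappa> p"
  have add: "iter_deriv vs (fun_rep \<kappa> (u + v) p) x = iter_deriv vs (fun_rep \<kappa> u p) x + iter_deriv vs (fun_rep \<kappa> v p) x"
    if "u \<in> CM \<kappa>" "v \<in> CM \<kappa>" "x \<in> K" for u v x
  proof -
    have "fun_rep \<kappa> (u + v) p = (\<lambda>x. fun_rep \<kappa> u p x + fun_rep \<kappa> v p x)"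
      by (simp add: fun_rep_def fun_eq_iff)
    then show ?thesis
      using that K open_coord_image[OF \<kappa>, of p] by (auto simp: CM_def intro!: iter_deriv_add)
  qed
  have "uniform_limit K (\<lambda>lam x. iter_deriv vs (fun_rep \<kappa> (f lam) p) x + iter_deriv vs (fun_rep \<kappa> (f' lam) p) x)
       (\<lambda>x. iter_deriv vs (fun_rep \<kappa> h p) x + iter_deriv vs (fun_rep \<kappa> h' p) x) (at 0)"
    using lim K unfolding CM_limit_def by (intro uniform_limit_add) blast+
  moreover have "\<forall>\<^sub>F lam in at 0. \<forall>x\<in>K. iter_deriv vs (fun_rep \<kappa> (f lam + f' lam) p) x
      = iter_deriv vs (fun_rep \<kappa> (f lam) p) x + iter_deriv vs (fun_rep \<kappa> (f' lam) p) x"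
    using smooth by (auto simp: eventually_at_filter add)
  ultimately show "uniform_limit K (\<lambda>lam. iter_deriv vs (fun_rep \<kappa> (f lam + f' lam) p))
       (iter_deriv vs (fun_rep \<kappa> (h + h') p)) (at 0)"
    using smooth by (subst uniform_limit_cong) (auto simp: add)
qed

text \<open>The derivatives of \<open>f\<close> converge to those of \<open>h\<close>, which are bounded on the compact set, so the
  factor \<open>\<lambda>\<close> wins.\<close>

lemma CM_limit_vanish:
  assumes \<kappa>: "smooth_manifold \<kappa>"
    and lim: "CM_limit \<kappa> f h"
    and smooth: "\<And>lam. lam \<noteq> 0 \<Longrightarrow> f lam \<in> CM \<kappa>" "h \<in> CM \<kappa>"
  shows "CM_limit \<kappa> (\<lambda>lam p. lam * f lam p) 0"
  unfolding CM_limit_def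
proof (intro allI impI)
  fix p vs K assume K: "compact K \<and> K \<subseteq> coord_image \<kappa> p"
  have scale: "iter_deriv vs (fun_rep \<kappa> (\<lambda>p. c * u p) p) x = c * iter_deriv vs (fun_rep \<kappa> u p) x"
    if "u \<in> CM \<kappa>" "x \<in> K" for u x c
  proof -
    have "fun_rep \<kappa> (\<lambda>p. c * u p) p = (\<lambda>x. c * fun_rep \<kappa> u p x)"
      by (simp add: fun_rep_def fun_eq_iff)
    then show ?thesis
      using that K open_coord_image[OF \<kappa>, of p] by (auto simp: CM_def intro!: iter_deriv_scale)
  qed
  have "continuous_on K (iter_deriv vs (fun_rep \<kappa> h p))"
    using smooth(2) K smooth_on_continuous continuous_on_subset unfolding CM_def by blast
  then have bdd: "bounded (iter_deriv vs (fun_rep \<kappa> h p) ` K)"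
    using K compact_continuous_image compact_imp_bounded by blast
  have "uniform_limit K (\<lambda>lam x. lam) (\<lambda>x. 0) (at (0::real))"
    by (rule uniform_limitI) (auto simp: eventually_at)
  moreover have "uniform_limit K (\<lambda>lam x. iter_deriv vs (fun_rep \<kappa> (f lam) p) x) (iter_deriv vs (fun_rep \<kappa> h p)) (at 0)"
    using lim K unfolding CM_limit_def by blast
  moreover have "bounded ((\<lambda>x. 0::real) ` K)"
    by (rule bounded_subset[of "{0}"]) auto
  ultimately have "uniform_limit K (\<lambda>lam x. lam * iter_deriv vs (fun_rep \<kappa> (f lam) p) x)
       (\<lambda>x. 0 * iter_deriv vs (fun_rep \<kappa> h p) x) (at 0)"
    using bdd by (intro uniform_lim_mult)
  moreover have "\<forall>\<^sub>F lam in at 0. \<forall>x\<in>K. iter_deriv vs (fun_rep \<kappa> (\<lambda>p. lam * f lam p) p) x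
      = lam * iter_deriv vs (fun_rep \<kappa> (f lam) p) x"
    using smooth by (auto simp: eventually_at_filter scale)
  moreover have "iter_deriv vs (fun_rep \<kappa> 0 p) x = 0 * iter_deriv vs (fun_rep \<kappa> h p) x" if "x \<in> K" for x
    using scale[OF smooth(2) that, of 0] by (simp add: zero_fun_def)
  ultimately show "uniform_limit K (\<lambda>lam. iter_deriv vs (fun_rep \<kappa> (\<lambda>p. lam * f lam p) p))
       (iter_deriv vs (fun_rep \<kappa> 0 p)) (at 0)"
    by (subst uniform_limit_cong) auto
qed

section \<open>Polynomial dependence on the deformation parameter\<close>

text \<open>\<open>lam_poly \<kappa> G G0\<close>: for \<open>\<lambda> \<noteq> 0\<close> the family \<open>G\<close> is a polynomial in \<open>\<lambda>\<close> with coefficients in the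
  carrier and constant term \<open>G0\<close>. The Horner-like generation by sums and multiplication by \<open>\<lambda>\<close> makes
  every closure property a rule induction. The last rule discards the value at \<open>\<lambda> = 0\<close>, where there
  is no calculus that would determine it.\<close>

inductive lam_poly :: "('m, 'e::euclidean_space) mfd \<Rightarrow> (real \<Rightarrow> 'm nord) \<Rightarrow> 'm nord \<Rightarrow> bool" for \<kappa> where
  const: "c \<in> nord_carrier \<kappa> \<Longrightarrow> lam_poly \<kappa> (\<lambda>_. c) c"
| add: "lam_poly \<kappa> G G0 \<Longrightarrow> lam_poly \<kappa> H H0 \<Longrightarrow> lam_poly \<kappa> (\<lambda>lam. G lam + H lam) (G0 + H0)"
| vanish: "lam_poly \<kappa> G G0 \<Longrightarrow> lam_poly \<kappa> (\<lambda>lam. nscale lam (G lam)) 0"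
| cong: "lam_poly \<kappa> G G0 \<Longrightarrow> (\<And>lam. lam \<noteq> 0 \<Longrightarrow> H lam = G lam) \<Longrightarrow> lam_poly \<kappa> H G0"

locale spacetime_family =
  fixes \<kappa> :: "('m::{t2_space,second_countable_topology}, 'e::euclidean_space) mfd"
    and g :: "'m \<Rightarrow> 'e \<Rightarrow> 'e \<Rightarrow> real"
    and \<tau> \<zeta> :: "'m \<Rightarrow> 'e"
    and \<beta> :: "'m \<Rightarrow> real"
    and S :: "real \<Rightarrow> ('m, 'e) st_calculus"
  assumes manifold: "smooth_manifold \<kappa>"
    and family: "lam \<noteq> 0 \<Longrightarrow> spacetime_calculus \<kappa> g \<tau> \<zeta> \<beta> lam (S lam)"
    and beta: "\<beta> \<in> CM \<kappa>"
begin

lemma at_param: "lam \<noteq> 0 \<Longrightarrow> spacetime \<kappa> g \<tau> \<zeta> \<beta> lam (S lam)"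
  using family beta by (simp add: spacetime_def)

sublocale one: spacetime \<kappa> g \<tau> \<zeta> \<beta> 1 "S 1"
  using at_param by simp

abbreviation lpoly where "lpoly \<equiv> lam_poly \<kappa>"

lemma lpoly_closed:
  assumes "lpoly G G0" shows "(\<forall>lam. lam \<noteq> 0 \<longrightarrow> G lam \<in> \<A>) \<and> G0 \<in> \<A>"
  using assms
proof (induction rule: lam_poly.induct)
  case (const c)
  then show ?case by blast
next
  case (add G G0 H H0)
  then show ?case by (metis one.add_closed)
next
  case (vanish G G0)
  then show ?case by (metis one.zero_closed one.nscale_closed)
next
  case (cong G G0 H)
  then show ?case by metis
qed

lemma lpoly_limit:
  assumes "lpoly G G0" shows "classical_limit \<kappa> G G0"
  using assms
proof (induction rule: lam_poly.induct)
  fix c :: "'m nord"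
  show "classical_limit \<kappa> (\<lambda>_. c) c"
    by (simp add: classical_limit_def CM_limit_const)
next
  fix G G0 H H0 assume *: "lpoly G G0" "lpoly H H0" "classical_limit \<kappa> G G0" "classical_limit \<kappa> H H0"
  have "CM_limit \<kappa> (\<lambda>lam. G lam n + H lam n) (G0 n + H0 n)" for n
    using *(3,4) lpoly_closed[OF *(1)] lpoly_closed[OF *(2)] unfolding classical_limit_def
    by (intro CM_limit_add[OF manifold]) (auto intro: carrier_coeff)
  then show "classical_limit \<kappa> (\<lambda>lam. G lam + H lam) (G0 + H0)"
    by (simp add: classical_limit_def)
next
  fix G G0 assume *: "lpoly G G0" "classical_limit \<kappa> G G0"
  have "CM_limit \<kappa> (\<lambda>lam p. lam * G lam n p) 0" for n
    using *(2) lpoly_closed[OF *(1)] unfolding classical_limit_def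
    by (intro CM_limit_vanish[OF manifold, of _ "G0 n"]) (auto intro: carrier_coeff)
  then show "classical_limit \<kappa> (\<lambda>lam. nscale lam (G lam)) 0"
    by (simp add: classical_limit_def nscale_def)
next
  fix G H :: "real \<Rightarrow> 'm nord" and G0
  assume *: "classical_limit \<kappa> G G0" "\<And>lam. lam \<noteq> 0 \<Longrightarrow> H lam = G lam"
  have "CM_limit \<kappa> (\<lambda>lam. H lam n) (G0 n)" for n
  proof (rule CM_limit_cong)
    show "CM_limit \<kappa> (\<lambda>lam. G lam n) (G0 n)"
      using *(1) by (simp add: classical_limit_def)
  qed (simp add: *(2))
  then show "classical_limit \<kappa> H G0"
    by (simp add: classical_limit_def)
qed

text \<open>An operation that is additive and \<open>\<lambda>\<close>-homogeneous at each parameter preserves polynomial families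
  as soon as it does so on constant ones; \<open>T0\<close> is its effect on constant terms.\<close>

lemma lpoly_linear:
  assumes "lpoly G G0"
    and const: "\<And>c. c \<in> \<A> \<Longrightarrow> lpoly (\<lambda>lam. T lam c) (T0 c)"
    and T_add: "\<And>lam F H. lam \<noteq> 0 \<Longrightarrow> F \<in> \<A> \<Longrightarrow> H \<in> \<A> \<Longrightarrow> T lam (F + H) = T lam F + T lam H"
    and T_scale: "\<And>lam F. lam \<noteq> 0 \<Longrightarrow> F \<in> \<A> \<Longrightarrow> T lam (nscale lam F) = nscale lam (T lam F)"
    and T0_add: "\<And>F H. F \<in> \<A> \<Longrightarrow> H \<in> \<A> \<Longrightarrow> T0 (F + H) = T0 F + T0 H"
  shows "lpoly (\<lambda>lam. T lam (G lam)) (T0 G0)"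
  using assms(1)
proof (induction rule: lam_poly.induct)
  fix c assume "c \<in> \<A>"
  then show "lpoly (\<lambda>lam. T lam c) (T0 c)" by (rule const)
next
  fix G G0 H H0
  assume *: "lpoly G G0" "lpoly H H0"
    and IH: "lpoly (\<lambda>lam. T lam (G lam)) (T0 G0)" "lpoly (\<lambda>lam. T lam (H lam)) (T0 H0)"
  have T: "T lam (G lam + H lam) = T lam (G lam) + T lam (H lam)" if "lam \<noteq> 0" for lam
    using that lpoly_closed[OF *(1)] lpoly_closed[OF *(2)] by (intro T_add) auto
  have "T0 (G0 + H0) = T0 G0 + T0 H0"
    using lpoly_closed[OF *(1)] lpoly_closed[OF *(2)] by (intro T0_add) auto
  then show "lpoly (\<lambda>lam. T lam (G lam + H lam)) (T0 (G0 + H0))"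
    using lam_poly.cong[OF lam_poly.add[OF IH], of "\<lambda>lam. T lam (G lam + H lam)"] T by metis
next
  fix G G0 assume *: "lpoly G G0" and IH: "lpoly (\<lambda>lam. T lam (G lam)) (T0 G0)"
  have T: "T lam (nscale lam (G lam)) = nscale lam (T lam (G lam))" if "lam \<noteq> 0" for lam
    using that lpoly_closed[OF *] by (intro T_scale) auto
  have "T0 (0 + 0) = T0 0 + T0 0" by (intro T0_add) simp_all
  then have "T0 0 = 0" by simp
  then show "lpoly (\<lambda>lam. T lam (nscale lam (G lam))) (T0 0)"
    using lam_poly.cong[OF lam_poly.vanish[OF IH], of "\<lambda>lam. T lam (nscale lam (G lam))"] T by metis
next
  fix G H :: "real \<Rightarrow> 'm nord" and G0
  assume IH: "lpoly (\<lambda>lam. T lam (G lam)) (T0 G0)" and *: "\<And>lam. lam \<noteq> 0 \<Longrightarrow> H lam = G lam"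
  show "lpoly (\<lambda>lam. T lam (H lam)) (T0 G0)"
    using IH by (rule lam_poly.cong) (simp add: *)
qed

lemma lpoly_scale: 
  assumes "lpoly G G0" shows "lpoly (\<lambda>lam. nscale c (G lam)) (nscale c G0)"
  using assms by (rule lpoly_linear[where T = "\<lambda>_. nscale c" and ?T0.0 = "nscale c"])
    (auto simp: nscale_add nscale_nscale mult.commute intro: lam_poly.const)

lemma lpoly_minus:
  assumes "lpoly G G0" shows "lpoly (\<lambda>lam. - G lam) (- G0)"
  using lpoly_scale[OF assms, of "- 1"] by (simp add: nscale_minus_one)

lemma lpoly_sum:
  assumes "finite I" and "\<And>i. i \<in> I \<Longrightarrow> lpoly (G i) (G0 i)"
  shows "lpoly (\<lambda>lam. \<Sum>i\<in>I. G i lam) (\<Sum>i\<in>I. G0 i)"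
  using assms
proof (induction I)
  show "lpoly (\<lambda>lam. \<Sum>i\<in>{}. G i lam) (\<Sum>i\<in>{}. G0 i)"
    using lam_poly.const[OF one.zero_closed] by simp
next
  fix x I
  assume I: "finite I" "x \<notin> I"
    and IH: "(\<And>i. i \<in> I \<Longrightarrow> lpoly (G i) (G0 i)) \<Longrightarrow> lpoly (\<lambda>lam. \<Sum>i\<in>I. G i lam) (\<Sum>i\<in>I. G0 i)"
    and prem: "\<And>i. i \<in> insert x I \<Longrightarrow> lpoly (G i) (G0 i)"
  have "lpoly (G x) (G0 x)" "lpoly (\<lambda>lam. \<Sum>i\<in>I. G i lam) (\<Sum>i\<in>I. G0 i)"
    using prem by (simp, intro IH, simp)
  from lam_poly.add[OF this] show "lpoly (\<lambda>lam. \<Sum>i\<in>insert x I. G i lam) (\<Sum>i\<in>insert x I. G0 i)"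
    using I by simp
qed

lemma mul_t_indep:
  assumes F: "F \<in> \<A>" and "lam \<noteq> 0"
  shows "amul (S lam) F tvar = (\<Sum>n | F n \<noteq> 0. tmon (F n) (Suc n))"
proof -
  interpret L: spacetime \<kappa> g \<tau> \<zeta> \<beta> lam "S lam" using \<open>lam \<noteq> 0\<close> by (rule at_param)
  show ?thesis
    by (subst L.tmon_decomp[OF F]) (use F in \<open>auto simp: L.sum_mul carrier_coeff L.tmon_mul_t\<close>)
qed

text \<open>In normal order, right multiplication by \<open>t\<close> is the same shift of coefficients for every
  parameter. The product at \<open>\<lambda> = 1\<close> serves as a name for this shift here and below.\<close>

lemma lpoly_mul_t:
  assumes "lpoly G G0" shows "lpoly (\<lambda>lam. amul (S lam) (G lam) tvar) (amul (S 1) G0 tvar)"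
  using assms
proof (rule lpoly_linear)
  fix c assume c: "c \<in> \<A>"
  have "lpoly (\<lambda>_. amul (S 1) c tvar) (amul (S 1) c tvar)"
    using c by (intro lam_poly.const) simp
  then show "lpoly (\<lambda>lam. amul (S lam) c tvar) (amul (S 1) c tvar)"
    by (rule lam_poly.cong) (simp add: mul_t_indep[OF c])
next
  fix lam :: real and F H assume "lam \<noteq> 0" and FH: "F \<in> \<A>" "H \<in> \<A>"
  interpret L: spacetime \<kappa> g \<tau> \<zeta> \<beta> lam "S lam" using \<open>lam \<noteq> 0\<close> by (rule at_param)
  show "amul (S lam) (F + H) tvar = amul (S lam) F tvar + amul (S lam) H tvar"
    using FH by (simp add: L.mul_add_left)
next
  fix lam :: real and F assume "lam \<noteq> 0" and F: "F \<in> \<A>"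
  interpret L: spacetime \<kappa> g \<tau> \<zeta> \<beta> lam "S lam" using \<open>lam \<noteq> 0\<close> by (rule at_param)
  show "amul (S lam) (nscale lam F) tvar = nscale lam (amul (S lam) F tvar)"
    using F by (simp add: L.nscale_mul_left)
next
  fix F H assume "F \<in> \<A>" "H \<in> \<A>"
  then show "amul (S 1) (F + H) tvar = amul (S 1) F tvar + amul (S 1) H tvar"
    by (simp add: one.mul_add_left)
qed

lemma lpoly_coef_mul:
  assumes f: "f \<in> CM \<kappa>" and "lpoly G G0"
  shows "lpoly (\<lambda>lam. amul (S lam) (coef f) (G lam)) (\<lambda>n. f * G0 n)"
proof -
  have *: "amul (S lam) (coef f) F = (\<lambda>n. f * F n)" if "lam \<noteq> 0" "F \<in> \<A>" for lam F
    by (rule spacetime.coef_mul_eq[OF at_param[OF that(1)] f that(2)])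
  have "lpoly (\<lambda>lam. (\<lambda>n. f * G lam n)) (\<lambda>n. f * G0 n)"
    using assms(2)
  proof (rule lpoly_linear[where T = "\<lambda>lam F n. f * F n" and ?T0.0 = "\<lambda>F n. f * F n"])
    fix c assume c: "c \<in> \<A>"
    have "(\<lambda>n. f * c n) \<in> \<A>"
      using one.mul_closed[of "coef f" c] f c *[of 1 c] by simp
    then show "lpoly (\<lambda>lam n. f * c n) (\<lambda>n. f * c n)" by (rule lam_poly.const)
  qed (simp_all add: nscale_def fun_eq_iff algebra_simps)
  then show ?thesis
    by (rule lam_poly.cong) (use lpoly_closed[OF assms(2)] in \<open>auto simp: *\<close>)
qed

text \<open>The commutation rule \<open>t\<^sup>n\<^sup>+\<^sup>1 f = (t\<^sup>n f) t - \<lambda> t\<^sup>n \<tau>(f)\<close> shows by induction on \<open>n\<close>, for all \<open>f\<close> at once, that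
  normal ordering \<open>t\<^sup>n f\<close> involves \<open>\<lambda>\<close> polynomially, with the commutative product as constant term.\<close>

lemma tmon_mul_coef:
  assumes h: "h \<in> CM \<kappa>" and "f \<in> CM \<kappa>"
  shows "lpoly (\<lambda>lam. amul (S lam) (tmon h n) (coef f)) (tmon (h * f) n)"
  using assms(2)
proof (induction n arbitrary: f)
  fix f assume f: "f \<in> CM \<kappa>"
  have "lpoly (\<lambda>_. coef (h * f)) (coef (h * f))"
    using h f by (intro lam_poly.const) (simp add: one.CM_mult)
  then show "lpoly (\<lambda>lam. amul (S lam) (coef h) (coef f)) (coef (h * f))"
    by (rule lam_poly.cong) (rule spacetime.coef_mul[OF at_param h f])
next
  fix n f
  assume IH: "\<And>f. f \<in> CM \<kappa> \<Longrightarrow> lpoly (\<lambda>lam. amul (S lam) (tmon h n) (coef f)) (tmon (h * f) n)"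
    and f: "f \<in> CM \<kappa>"
  let ?X = "vf_apply \<kappa> \<tau> f"
  have P: "lpoly (\<lambda>lam. amul (S lam) (amul (S lam) (tmon h n) (coef f)) tvar + - nscale lam (amul (S lam) (tmon h n) (coef ?X)))
     (amul (S 1) (tmon (h * f) n) tvar + - 0)"
    using f by (intro lam_poly.add lpoly_minus lam_poly.vanish[OF IH] lpoly_mul_t IH one.tau_smooth)
  have e: "amul (S lam) (tmon h (Suc n)) (coef f) = 
     amul (S lam) (amul (S lam) (tmon h n) (coef f)) tvar + - nscale lam (amul (S lam) (tmon h n) (coef ?X))"
    if lam: "lam \<noteq> 0" for lam
  proof -
    interpret L: spacetime \<kappa> g \<tau> \<zeta> \<beta> lam "S lam" using lam by (rule at_param)
    have 1: "amul (S lam) (tmon h (Suc n)) (coef f) = amul (S lam) (tmon h n) (amul (S lam) tvar (coef f))"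
      using h f L.mul_assoc[of "tmon h n" tvar "coef f"] by (simp add: L.tmon_mul_t)
    have 2: "amul (S lam) tvar (coef f) = amul (S lam) (coef f) tvar - nscale lam (coef ?X)"
      using f L.t_mul_coef[OF f] L.tmon_mul_t[OF f, of 0] by (simp add: One_nat_def)
    show ?thesis
      unfolding 1 2 using h f by (simp add: L.mul_diff_right L.tau_smooth L.nscale_mul_right L.mul_assoc)
  qed
  have lim: "amul (S 1) (tmon (h * f) n) tvar + - 0 = tmon (h * f) (Suc n)"
    using one.tmon_mul_t[OF one.CM_mult[OF h f]] by simp
  from P[unfolded lim] show "lpoly (\<lambda>lam. amul (S lam) (tmon h (Suc n)) (coef f)) (tmon (h * f) (Suc n))"
    by (rule lam_poly.cong) (rule e)
qed

lemma lpoly_mul_coef: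
  assumes f: "f \<in> CM \<kappa>" and "lpoly G G0"
  shows "lpoly (\<lambda>lam. amul (S lam) (G lam) (coef f)) (\<lambda>n. G0 n * f)"
  using assms(2)
proof (rule lpoly_linear)
  fix c assume c: "c \<in> \<A>"
  let ?I = "{n. c n \<noteq> 0}"
  have P: "lpoly (\<lambda>lam. \<Sum>n\<in>?I. amul (S lam) (tmon (c n) n) (coef f)) (\<Sum>n\<in>?I. tmon (c n * f) n)"
    using c f by (intro lpoly_sum tmon_mul_coef) (simp_all add: carrier_finite carrier_coeff)
  have lim: "(\<Sum>n\<in>?I. tmon (c n * f) n) = (\<lambda>n. c n * f)"
    by (rule tmon_sum[symmetric]) (use carrier_finite[OF c] in auto)
  have e: "amul (S lam) c (coef f) = (\<Sum>n\<in>?I. amul (S lam) (tmon (c n) n) (coef f))" if lam: "lam \<noteq> 0" for lam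
  proof -
    interpret L: spacetime \<kappa> g \<tau> \<zeta> \<beta> lam "S lam" using lam by (rule at_param)
    show ?thesis
      by (subst L.tmon_decomp[OF c]) (use c f in \<open>auto simp: L.sum_mul carrier_coeff\<close>)
  qed
  from P[unfolded lim] show "lpoly (\<lambda>lam. amul (S lam) c (coef f)) (\<lambda>n. c n * f)"
    by (rule lam_poly.cong) (rule e)
next
  fix lam :: real and F H assume "lam \<noteq> 0" and FH: "F \<in> \<A>" "H \<in> \<A>"
  interpret L: spacetime \<kappa> g \<tau> \<zeta> \<beta> lam "S lam" using \<open>lam \<noteq> 0\<close> by (rule at_param)
  show "amul (S lam) (F + H) (coef f) = amul (S lam) F (coef f) + amul (S lam) H (coef f)"
    using FH f by (simp add: L.mul_add_left)
next
  fix lam :: real and F assume "lam \<noteq> 0" and F: "F \<in> \<A>"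
  interpret L: spacetime \<kappa> g \<tau> \<zeta> \<beta> lam "S lam" using \<open>lam \<noteq> 0\<close> by (rule at_param)
  show "amul (S lam) (nscale lam F) (coef f) = nscale lam (amul (S lam) F (coef f))"
    using F f by (simp add: L.nscale_mul_left)
qed (simp add: fun_eq_iff algebra_simps)

lemma lpoly_mul_shift:
  assumes "lpoly G G0" and a: "a \<in> CM \<kappa>"
  shows "lpoly (\<lambda>lam. amul (S lam) (G lam) (tvar + nscale lam (coef a))) (amul (S 1) G0 tvar)"
proof -
  have "lpoly (\<lambda>lam. amul (S lam) (G lam) tvar + nscale lam (amul (S lam) (G lam) (coef a))) (amul (S 1) G0 tvar + 0)"
    by (intro lam_poly.add lpoly_mul_t lam_poly.vanish[OF lpoly_mul_coef[OF a assms(1)]] assms)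
  then have "lpoly (\<lambda>lam. amul (S lam) (G lam) (tvar + nscale lam (coef a))) (amul (S 1) G0 tvar + 0)"
  proof (rule lam_poly.cong)
    fix lam :: real assume lam: "lam \<noteq> 0"
    interpret L: spacetime \<kappa> g \<tau> \<zeta> \<beta> lam "S lam" using lam by (rule at_param)
    show "amul (S lam) (G lam) (tvar + nscale lam (coef a)) =
        amul (S lam) (G lam) tvar + nscale lam (amul (S lam) (G lam) (coef a))"
      using lpoly_closed[OF assms(1)] lam a by (simp add: L.mul_add_right L.nscale_mul_right)
  qed
  then show ?thesis by simp
qed

lemma lpoly_shift_pow:
  assumes a: "a \<in> CM \<kappa>"
  shows "lpoly (\<lambda>lam. spacetime.shift_pow \<kappa> lam (S lam) a n) (tmon 1 n)"
proof (induction n)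
  have "lpoly (\<lambda>_. coef 1) (coef 1)" by (intro lam_poly.const) simp
  then show "lpoly (\<lambda>lam. spacetime.shift_pow \<kappa> lam (S lam) a 0) (coef 1)"
    by (rule lam_poly.cong) (rule spacetime.shift_pow_0[OF at_param])
next
  fix n assume IH: "lpoly (\<lambda>lam. spacetime.shift_pow \<kappa> lam (S lam) a n) (tmon 1 n)"
  have "amul (S 1) (tmon 1 n) tvar = tmon 1 (Suc n)"
    by (rule one.tpow_mul_t)
  with lpoly_mul_shift[OF IH a]
  have "lpoly (\<lambda>lam. amul (S lam) (spacetime.shift_pow \<kappa> lam (S lam) a n) (tvar + nscale lam (coef a))) (tmon 1 (Suc n))"
    by simp
  then show "lpoly (\<lambda>lam. spacetime.shift_pow \<kappa> lam (S lam) a (Suc n)) (tmon 1 (Suc n))"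
    by (rule lam_poly.cong) (rule spacetime.shift_pow_Suc[OF at_param a])
qed

lemma lpoly_partial_pow: "lpoly (\<lambda>lam. spacetime.partial_pow \<kappa> lam (S lam) n) (nscale (real n) (tmon 1 (n - 1)))"
proof (induction n)
  have "lpoly (\<lambda>_. 0) 0" by (intro lam_poly.const) simp
  then have "lpoly (\<lambda>lam. spacetime.partial_pow \<kappa> lam (S lam) 0) 0"
    by (rule lam_poly.cong) (rule spacetime.partial_pow_0[OF at_param])
  then show "lpoly (\<lambda>lam. spacetime.partial_pow \<kappa> lam (S lam) 0) (nscale (real 0) (tmon 1 (0 - 1)))" by simp
next
  fix n let ?p = "\<lambda>lam n. spacetime.partial_pow \<kappa> lam (S lam) n"
  assume IH: "lpoly (\<lambda>lam. ?p lam n) (nscale (real n) (tmon 1 (n - 1)))"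
  have "amul (S 1) (nscale (real n) (tmon 1 (n - 1))) tvar + tmon 1 n = nscale (real (Suc n)) (tmon 1 n)"
  proof (cases n)
    case (Suc k)
    then have "amul (S 1) (nscale (real n) (tmon 1 (n - 1))) tvar = nscale (real n) (tmon 1 n)"
      by (simp add: one.nscale_mul_left one.tpow_mul_t)
    then show ?thesis by (simp add: nscale_def fun_eq_iff algebra_simps)
  qed simp
  moreover have "lpoly (\<lambda>lam. amul (S lam) (?p lam n) (tvar + nscale lam (coef (- 1))) + tmon 1 n)
     (amul (S 1) (nscale (real n) (tmon 1 (n - 1))) tvar + tmon 1 n)"
    by (intro lam_poly.add lam_poly.const lpoly_mul_shift IH) simp_all
  ultimately have "lpoly (\<lambda>lam. amul (S lam) (?p lam n) (tvar + nscale lam (coef (- 1))) + tmon 1 n) (nscale (real (Suc n)) (tmon 1 n))"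
    by metis
  then have "lpoly (\<lambda>lam. ?p lam (Suc n)) (nscale (real (Suc n)) (tmon 1 n))"
  proof (rule lam_poly.cong)
    fix lam :: real assume lam: "lam \<noteq> 0"
    interpret L: spacetime \<kappa> g \<tau> \<zeta> \<beta> lam "S lam" using lam by (rule at_param)
    have e: "tvar - coef (\<lambda>_. lam) = tvar + nscale lam (coef (- 1))"
      by (auto simp: nscale_def tmon_def fun_eq_iff)
    show "?p lam (Suc n) = amul (S lam) (?p lam n) (tvar + nscale lam (coef (- 1))) + tmon 1 n"
      unfolding L.partial_pow_Suc e ..
  qed
  then show "lpoly (\<lambda>lam. ?p lam (Suc n)) (nscale (real (Suc n)) (tmon 1 (Suc n - 1)))"
    by simp
qed

text \<open>The constant terms satisfy the commutative recursion \<open>D\<^sub>n\<^sub>+\<^sub>1 = n \<beta> t\<^sup>n\<^sup>-\<^sup>1 + D\<^sub>n t\<close>. For \<open>n \<le> 1\<close> the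
  truncated exponent \<open>n - 2\<close> is harmless because the factor \<open>n (n - 1) / 2\<close> vanishes.\<close>

lemma lpoly_Delta_pow:
  "lpoly (\<lambda>lam. spacetime.Delta_pow \<kappa> g \<tau> \<beta> lam (S lam) n) (nscale (real n * (real n - 1) / 2) (tmon \<beta> (n - 2)))"
proof (induction n)
  have "lpoly (\<lambda>_. 0) 0" by (intro lam_poly.const) simp
  then have "lpoly (\<lambda>lam. spacetime.Delta_pow \<kappa> g \<tau> \<beta> lam (S lam) 0) 0"
    by (rule lam_poly.cong) (rule spacetime.Delta_pow.simps(1)[OF at_param])
  then show "lpoly (\<lambda>lam. spacetime.Delta_pow \<kappa> g \<tau> \<beta> lam (S lam) 0) (nscale (real 0 * (real 0 - 1) / 2) (tmon \<beta> (0 - 2)))" by simp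
next
  fix n let ?D = "\<lambda>lam n. spacetime.Delta_pow \<kappa> g \<tau> \<beta> lam (S lam) n" and ?p = "\<lambda>lam n. spacetime.partial_pow \<kappa> lam (S lam) n"
  let ?c = "real n * (real n - 1) / 2"
  assume IH: "lpoly (\<lambda>lam. ?D lam n) (nscale ?c (tmon \<beta> (n - 2)))"
  have "(\<lambda>k. nscale (real n) (tmon 1 (n - 1)) k * \<beta>) + amul (S 1) (nscale ?c (tmon \<beta> (n - 2))) tvar
     = nscale (real (Suc n) * (real (Suc n) - 1) / 2) (tmon \<beta> (Suc n - 2))"
  proof -
    have a: "amul (S 1) (nscale ?c (tmon \<beta> (n - 2))) tvar = nscale ?c (tmon \<beta> (n - 1))"
    proof (cases "n \<le> 1")
      case True
      then have "?c = 0" by (auto simp: le_Suc_eq One_nat_def)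
      then show ?thesis by (simp only: nscale_zero_left) simp
    next
      case False
      then have "Suc (n - 2) = n - 1" by simp
      then show ?thesis using beta by (simp add: one.nscale_mul_left one.tmon_mul_t)
    qed
    have b: "(\<lambda>k. nscale (real n) (tmon 1 (n - 1)) k * \<beta>) = nscale (real n) (tmon \<beta> (n - 1))"
      by (auto simp: nscale_def tmon_def fun_eq_iff)
    have c: "Suc n - 2 = n - 1" by simp
    show ?thesis
      unfolding a b c
      by (simp add: nscale_def fun_eq_iff field_simps)
  qed
  moreover have "lpoly (\<lambda>lam. amul (S lam) (?p lam n) (coef \<beta>) + amul (S lam) (?D lam n) (tvar + nscale lam (coef \<alpha>)))
     ((\<lambda>k. nscale (real n) (tmon 1 (n - 1)) k * \<beta>) + amul (S 1) (nscale ?c (tmon \<beta> (n - 2))) tvar)"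
    by (intro lam_poly.add lpoly_mul_coef lpoly_mul_shift lpoly_partial_pow IH beta one.conf_smooth)
  ultimately have "lpoly (\<lambda>lam. amul (S lam) (?p lam n) (coef \<beta>) + amul (S lam) (?D lam n) (tvar + nscale lam (coef \<alpha>)))
     (nscale (real (Suc n) * (real (Suc n) - 1) / 2) (tmon \<beta> (Suc n - 2)))"
    by metis
  then show "lpoly (\<lambda>lam. ?D lam (Suc n)) (nscale (real (Suc n) * (real (Suc n) - 1) / 2) (tmon \<beta> (Suc n - 2)))"
    by (rule lam_poly.cong) (rule spacetime.Delta_pow.simps(2)[OF at_param])
qed

lemma lpoly_wave:
  assumes F: "F \<in> \<A>"
  shows "lpoly (\<lambda>lam. wave \<kappa> (S lam) lam F) (coeff_laplace \<kappa> g \<zeta> F + (\<lambda>n. \<beta> * tdiff (tdiff F) n))"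
proof -
  let ?I = "{n. F n \<noteq> 0}"
  let ?L = "\<lambda>n. blaplace \<kappa> g \<zeta> (F n)"
  let ?c = "\<lambda>n. real n * (real n - 1) / 2"
  have fin: "finite ?I" using F by (rule carrier_finite)
  have sm: "F n \<in> CM \<kappa>" "?L n \<in> CM \<kappa>" for n
    using F by (simp_all add: carrier_coeff one.blaplace_smooth)
  have "lpoly (\<lambda>lam. \<Sum>n\<in>?I. amul (S lam) (coef (?L n)) (spacetime.shift_pow \<kappa> lam (S lam) \<alpha> n)
       + nscale 2 (amul (S lam) (coef (F n)) (spacetime.Delta_pow \<kappa> g \<tau> \<beta> lam (S lam) n)))
     (\<Sum>n\<in>?I. (\<lambda>k. ?L n * tmon 1 n k) + nscale 2 (\<lambda>k. F n * nscale (?c n) (tmon \<beta> (n - 2)) k))"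
    by (intro lpoly_sum fin lam_poly.add lpoly_scale lpoly_coef_mul sm lpoly_shift_pow lpoly_Delta_pow one.conf_smooth)
  moreover have "(\<Sum>n\<in>?I. (\<lambda>k. ?L n * tmon 1 n k) + nscale 2 (\<lambda>k. F n * nscale (?c n) (tmon \<beta> (n - 2)) k))
     = coeff_laplace \<kappa> g \<zeta> F + (\<lambda>n. \<beta> * tdiff (tdiff F) n)"
  proof -
    have a: "(\<lambda>k. ?L n * tmon 1 n k) = tmon (?L n) n" for n
      by (auto simp: tmon_def fun_eq_iff)
    have b: "(\<Sum>n\<in>?I. tmon (?L n) n) = ?L"
      by (rule tmon_sum[OF fin, symmetric]) (auto simp: one.blaplace_zero)
    have c: "(\<Sum>n\<in>?I. nscale 2 (\<lambda>k. F n * nscale (?c n) (tmon \<beta> (n - 2)) k)) k p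
       = \<beta> p * (real (Suc k) * (real (Suc (Suc k)) * F (Suc (Suc k)) p))" for k p
    proof -
      have "(\<Sum>n\<in>?I. nscale 2 (\<lambda>k. F n * nscale (?c n) (tmon \<beta> (n - 2)) k)) k p
          = (\<Sum>n\<in>?I. if n = k + 2 then \<beta> p * (real (Suc k) * (real (Suc (Suc k)) * F (k + 2) p)) else 0)"
        unfolding sum_fun_apply
      proof (rule sum.cong)
        fix n
        consider "n = k + 2" | "n - 2 \<noteq> k" | "n \<le> 1" by linarith
        then show "nscale 2 (\<lambda>k. F n * nscale (?c n) (tmon \<beta> (n - 2)) k) k p
            = (if n = k + 2 then \<beta> p * (real (Suc k) * (real (Suc (Suc k)) * F (k + 2) p)) else 0)"
        proof cases
          case 1
          then show ?thesis by (simp add: nscale_def algebra_simps)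
        next
          case 2
          then show ?thesis by (auto simp: nscale_def)
        next
          case 3
          then have "?c n = 0" by (auto simp: le_Suc_eq One_nat_def)
          with 3 show ?thesis by (simp add: nscale_def)
        qed
      qed simp
      also have "\<dots> = \<beta> p * (real (Suc k) * (real (Suc (Suc k)) * F (k + 2) p))"
        using fin by simp
      finally show ?thesis by simp
    qed
    show ?thesis
      unfolding sum.distrib a b coeff_laplace_def
      by (intro ext, unfold plus_fun_apply c) (simp add: tdiff_def)
  qed
  ultimately have "lpoly (\<lambda>lam. \<Sum>n\<in>?I. amul (S lam) (coef (?L n)) (spacetime.shift_pow \<kappa> lam (S lam) \<alpha> n)
       + nscale 2 (amul (S lam) (coef (F n)) (spacetime.Delta_pow \<kappa> g \<tau> \<beta> lam (S lam) n)))
     (coeff_laplace \<kappa> g \<zeta> F + (\<lambda>n. \<beta> * tdiff (tdiff F) n))"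
    by metis
  then show ?thesis
    by (rule lam_poly.cong)
      (rule trans[OF spacetime.wave_eq[OF at_param F] spacetime.wave_formula_eq[OF at_param F]])
qed

end

section \<open>Charts of the product with a line\<close>

context
  fixes \<kappa> :: "('m::{t2_space,second_countable_topology}, 'e::euclidean_space) mfd"
  assumes manifold: "smooth_manifold \<kappa>"
begin

lemma chart_homeo: "homeomorphism (fst (\<kappa> p)) (coord_image \<kappa> p) (snd (\<kappa> p)) (coord_inv (\<kappa> p))"
  using manifold by (simp add: smooth_manifold_def is_chart_def coord_image_def)

lemma chart_self: "p \<in> fst (\<kappa> p)"
  using manifold by (simp add: smooth_manifold_def)

lemma coord_inv_in: "x \<in> coord_image \<kappa> p \<Longrightarrow> coord_inv (\<kappa> p) x \<in> fst (\<kappa> p)"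
  and coord_coord_inv: "x \<in> coord_image \<kappa> p \<Longrightarrow> snd (\<kappa> p) (coord_inv (\<kappa> p) x) = x"
  and coord_inv_coord: "q \<in> fst (\<kappa> p) \<Longrightarrow> coord_inv (\<kappa> p) (snd (\<kappa> p) q) = q"
  using chart_homeo[of p] by (auto simp: homeomorphism_def)

lemma coord_at_in: "coord_at \<kappa> p \<in> coord_image \<kappa> p"
  using chart_self by (simp add: coord_at_def coord_image_def)

lemma fun_rep_coord_at [simp]: "fun_rep \<kappa> f p (coord_at \<kappa> p) = f p"
  by (simp add: fun_rep_def coord_at_def coord_inv_coord chart_self)

lemma tchange_deriv:
  assumes "q \<in> fst (\<kappa> a)" "q \<in> fst (\<kappa> b)"
  shows "((snd (\<kappa> b) \<circ> coord_inv (\<kappa> a)) has_derivative tchange \<kappa> a b q) (at (snd (\<kappa> a) q))"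
proof -
  have "smooth_on (snd (\<kappa> a) ` (fst (\<kappa> a) \<inter> fst (\<kappa> b))) (snd (\<kappa> b) \<circ> coord_inv (\<kappa> a))"
    using manifold by (simp add: smooth_manifold_def)
  then have "(snd (\<kappa> b) \<circ> coord_inv (\<kappa> a)) differentiable at (snd (\<kappa> a) q)"
    by (rule smooth_on_differentiable) (use assms in auto)
  then show ?thesis
    unfolding tchange_def frechet_derivative_works .
qed

lemma tchange_linear: "q \<in> fst (\<kappa> a) \<Longrightarrow> q \<in> fst (\<kappa> b) \<Longrightarrow> linear (tchange \<kappa> a b q)"
  using has_derivative_linear[OF tchange_deriv] .

lemma coord_inv_times_line:
  assumes "x \<in> coord_image \<kappa> p"
  shows "coord_inv (times_line \<kappa> (p, s)) (x, r) = (coord_inv (\<kappa> p) x, r)"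
  unfolding coord_inv_def[of "times_line \<kappa> (p, s)"]
proof (rule inv_into_f_eq)
  show "inj_on (snd (times_line \<kappa> (p, s))) (fst (times_line \<kappa> (p, s)))"
    by (rule inj_on_inverseI[where g = "\<lambda>(x, r). (coord_inv (\<kappa> p) x, r)"])
      (auto simp: times_line_def coord_inv_coord)
qed (use assms in \<open>auto simp: times_line_def coord_inv_in coord_coord_inv\<close>)

lemma open_product_coords: "open (coord_image \<kappa> p \<times> (UNIV :: real set))"
  by (intro open_Times open_coord_image manifold open_UNIV)

text \<open>The charts of the product are those of \<open>M\<close> times the identity, so coordinate changes act on the
  second component trivially.\<close>

lemma tchange_times_line:
  assumes q: "q \<in> fst (\<kappa> a)" "q \<in> fst (\<kappa> b)"
  shows "tchange (times_line \<kappa>) (a, s) (b, s') (q, r) (v, c) = (tchange \<kappa> a b q v, c)"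
proof -
  let ?F = "snd (times_line \<kappa> (b, s')) \<circ> coord_inv (times_line \<kappa> (a, s))"
  let ?f = "snd (\<kappa> b) \<circ> coord_inv (\<kappa> a)"
  let ?z = "(snd (\<kappa> a) q, r)"
  have fst: "(fst has_derivative fst) (at ?z)"
    by (rule bounded_linear_imp_has_derivative[OF bounded_linear_fst])
  have snd: "(snd has_derivative snd) (at ?z)"
    by (rule bounded_linear_imp_has_derivative[OF bounded_linear_snd])
  have "((\<lambda>z. (?f (fst z), snd z)) has_derivative (\<lambda>w. (tchange \<kappa> a b q (fst w), snd w))) (at ?z)"
    by (intro has_derivative_Pair snd has_derivative_compose[OF fst, of ?f])
      (simp add: tchange_deriv[OF q, unfolded comp_def] comp_def)
  then have "(?F has_derivative (\<lambda>w. (tchange \<kappa> a b q (fst w), snd w))) (at ?z)"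
  proof (rule has_derivative_transform_within_open)
    show "open (coord_image \<kappa> a \<times> (UNIV :: real set))" by (rule open_product_coords)
    show "?z \<in> coord_image \<kappa> a \<times> UNIV" using q by (auto simp: coord_image_def)
    fix z assume "z \<in> coord_image \<kappa> a \<times> (UNIV :: real set)"
    then show "(?f (fst z), snd z) = ?F z"
      by (cases z) (simp add: coord_inv_times_line, simp add: times_line_def)
  qed
  from frechet_derivative_at[OF this] show ?thesis
    unfolding tchange_def[of "times_line \<kappa>"] by (simp add: times_line_def fun_eq_iff)
qed

lemma fun_rep_times_line:
  assumes "x \<in> coord_image \<kappa> p"
  shows "fun_rep (times_line \<kappa>) f (p, s) (x, r) = f (coord_inv (\<kappa> p) x, r)"
  using assms by (simp add: fun_rep_def coord_inv_times_line)

lemma coord_at_times_line: "coord_at (times_line \<kappa>) (p, s) = (coord_at \<kappa> p, s)"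
  by (simp add: coord_at_def times_line_def)

lemma metric_rep_times_line:
  assumes "x \<in> coord_image \<kappa> p"
  shows "metric_rep (times_line \<kappa>) (static_metric \<beta> g) (p, s) (x, r) (u, a) (v, b)
     = inverse (fun_rep \<kappa> \<beta> p x) * (a * b) + metric_rep \<kappa> g p x u v"
  using assms coord_inv_in[OF assms]
  by (simp add: metric_rep_def Let_def coord_inv_times_line tchange_times_line chart_self static_metric_def fun_rep_def)

end

lemma CM_differentiable:
  "f \<in> CM \<kappa> \<Longrightarrow> x \<in> coord_image \<kappa> p \<Longrightarrow> fun_rep \<kappa> f p differentiable at x"
  by (auto simp: CM_def intro: smooth_on_differentiable)

lemma CM_deriv_differentiable:
  "f \<in> CM \<kappa> \<Longrightarrow> x \<in> coord_image \<kappa> p \<Longrightarrow> (\<lambda>y. frechet_derivative (fun_rep \<kappa> f p) (at y) v) differentiable at x"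
  by (auto simp: CM_def intro: smooth_on_differentiable smooth_on_deriv)

section \<open>Riemannian metrics in coordinates\<close>

locale riemannian =
  fixes \<kappa> :: "('m::{t2_space,second_countable_topology}, 'e::euclidean_space) mfd"
    and g :: "'m \<Rightarrow> 'e \<Rightarrow> 'e \<Rightarrow> real"
  assumes manifold: "smooth_manifold \<kappa>"
    and metric: "riemannian_metric \<kappa> g"
begin

lemma metric_bilinear: "bilinear (g p)"
  and metric_pos: "u \<noteq> 0 \<Longrightarrow> g p u u > 0"
  using metric by (simp_all add: riemannian_metric_def)

lemma metric_linear: "linear (g p u)" "linear (\<lambda>u. g p u v)"
  using metric_bilinear[of p] by (simp_all add: bilinear_def)

lemma metric_inj: assumes "\<And>v. g p u v = g p u' v" shows "u = u'"
proof (rule ccontr)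
  assume "u \<noteq> u'"
  then have "g p (u - u') (u - u') > 0" by (intro metric_pos) simp
  moreover have "g p (u - u') (u - u') = 0"
    using assms[of "u - u'"] linear_diff[OF metric_linear(2), of p u u' "u - u'"] by simp
  ultimately show False by simp
qed

lemma sharp_eq: "(\<And>v. g p u v = a v) \<Longrightarrow> sharp g p a = u"
  unfolding sharp_def using metric_inj[of p] by (intro the_equality) auto

text \<open>Existence of the Riesz representative: the linear map with coordinates \<open>u \<mapsto> (g(u, b))\<^sub>b\<close> has trivial
  kernel by positivity, hence is onto in finite dimension.\<close>

lemma sharp_works:
  assumes a: "linear a" shows "g p (sharp g p a) v = a v"
proof -
  define L where "L u = (\<Sum>b\<in>Basis. g p u b *\<^sub>R b)" for u
  have "linear L"
    by (rule linearI)
      (simp_all add: L_def linear_add[OF metric_linear(2)] linear_cmul[OF metric_linear(2)]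
        scaleR_left_distrib sum.distrib scaleR_right.sum)
  moreover have "inj L"
    unfolding linear_injective_0[OF \<open>linear L\<close>]
  proof (intro allI impI)
    fix u assume "L u = 0"
    then have "g p u b = 0" if "b \<in> Basis" for b
      using inner_sum_left_Basis[OF that, of "g p u"] by (simp add: L_def)
    then have "g p u = (\<lambda>_. 0)"
      by (intro linear_eq_stdbasis metric_linear linear_zero) auto
    then show "u = 0" using metric_pos[of u p] by (cases "u = 0") simp_all
  qed
  ultimately have "surj L"
    by (rule linear_injective_imp_surjective) simp
  then obtain u where u: "L u = (\<Sum>b\<in>Basis. a b *\<^sub>R b)"
    by (metis surjE)
  have "g p u b = a b" if "b \<in> Basis" for b
    using inner_sum_left_Basis[OF that, of "g p u"] inner_sum_left_Basis[OF that, of a] u by (simp add: L_def)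
  then have "g p u = a"
    by (intro linear_eq_stdbasis metric_linear a) auto
  then show ?thesis
    using sharp_eq[of p u a] by simp
qed

lemma sharp_zero: "sharp g p (\<lambda>_. 0) = 0"
  by (rule sharp_eq) (rule linear_0[OF metric_linear(2)])

lemma metric_rep_linear:
  assumes x: "x \<in> coord_image \<kappa> p"
  shows "linear (metric_rep \<kappa> g p x u)" 
proof -
  let ?q = "coord_inv (\<kappa> p) x"
  have "linear (tchange \<kappa> p ?q ?q)"
    using coord_inv_in[OF manifold x] chart_self[OF manifold] by (intro tchange_linear[OF manifold])
  moreover have "metric_rep \<kappa> g p x u = g ?q (tchange \<kappa> p ?q ?q u) \<circ> tchange \<kappa> p ?q ?q"
    by (simp add: metric_rep_def Let_def fun_eq_iff)
  ultimately show ?thesis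
    using linear_compose[OF _ metric_linear(1)] by simp
qed

lemma metric_rep_differentiable:
  "x \<in> coord_image \<kappa> p \<Longrightarrow> (\<lambda>x. metric_rep \<kappa> g p x u v) differentiable at x"
  by (rule smooth_on_differentiable[where S = "coord_image \<kappa> p"])
    (use metric in \<open>simp_all add: riemannian_metric_def\<close>)

lemma metric_deriv_linear_dir: "linear (\<lambda>w. metric_deriv \<kappa> g p w u v)"
  unfolding metric_deriv_def
  by (intro linear_frechet_derivative metric_rep_differentiable coord_at_in manifold)

text \<open>The Christoffel symbols are defined by applying \<open>sharp\<close> to an expression in the last argument of
  \<open>metric_deriv\<close>; linearity guarantees that this expression is a covector.\<close>

lemma metric_deriv_linear: "linear (metric_deriv \<kappa> g p w u)"
proof (rule linearI)
  let ?x = "coord_at \<kappa> p"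
  note S = open_coord_image[OF manifold] coord_at_in[OF manifold]
  note d = metric_rep_differentiable[OF coord_at_in[OF manifold]]
  fix v v' :: 'e and c :: real
  have "frechet_derivative (\<lambda>x. metric_rep \<kappa> g p x u (v + v')) (at ?x)
      = frechet_derivative (\<lambda>x. metric_rep \<kappa> g p x u v + metric_rep \<kappa> g p x u v') (at ?x)"
    by (rule frechet_derivative_cong_open[OF S]) (rule linear_add[OF metric_rep_linear])
  then show "metric_deriv \<kappa> g p w u (v + v') = metric_deriv \<kappa> g p w u v + metric_deriv \<kappa> g p w u v'"
    by (simp add: metric_deriv_def frechet_derivative_add[OF d d])
  have "frechet_derivative (\<lambda>x. metric_rep \<kappa> g p x u (c *\<^sub>R v)) (at ?x)
      = frechet_derivative (\<lambda>x. c * metric_rep \<kappa> g p x u v) (at ?x)"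
    by (rule frechet_derivative_cong_open[OF S]) (simp add: linear_cmul[OF metric_rep_linear])
  then show "metric_deriv \<kappa> g p w u (c *\<^sub>R v) = c *\<^sub>R metric_deriv \<kappa> g p w u v"
    by (simp add: metric_deriv_def frechet_derivative_scale[OF d])
qed

end

section \<open>Static metrics\<close>

locale static = riemannian \<kappa> g
  for \<kappa> :: "('m::{t2_space,second_countable_topology}, 'e::euclidean_space) mfd"
    and g :: "'m \<Rightarrow> 'e \<Rightarrow> 'e \<Rightarrow> real" +
  fixes \<beta> :: "'m \<Rightarrow> real"
  assumes beta: "\<beta> \<in> CM \<kappa>" and beta_nonzero: "\<beta> p \<noteq> 0"
begin

abbreviation "\<kappa>' \<equiv> times_line \<kappa>"
abbreviation "g' \<equiv> static_metric \<beta> g"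

text \<open>The differential of \<open>\<beta>\<^sup>-\<^sup>1\<close>, the coefficient of \<open>dt \<otimes> dt\<close>, written in the form in which the rule for the
  derivative of an inverse delivers it.\<close>

definition dlapse :: "'m \<Rightarrow> 'e \<Rightarrow> real" where
  "dlapse p w = - (inverse (\<beta> p) * bdiff \<kappa> \<beta> p w * inverse (\<beta> p))"

lemma bdiff_deriv: "f \<in> CM \<kappa> \<Longrightarrow> (fun_rep \<kappa> f p has_derivative bdiff \<kappa> f p) (at (coord_at \<kappa> p))"
  unfolding bdiff_def using CM_differentiable[OF _ coord_at_in[OF manifold], of f p]
  by (simp add: frechet_derivative_works)

lemma bdiff_linear: "f \<in> CM \<kappa> \<Longrightarrow> linear (bdiff \<kappa> f p)"
  by (rule has_derivative_linear[OF bdiff_deriv])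

lemma dlapse_linear: "linear (dlapse p)"
proof -
  have "dlapse p = (\<lambda>w. (- (inverse (\<beta> p) * inverse (\<beta> p))) *\<^sub>R bdiff \<kappa> \<beta> p w)"
    by (simp add: dlapse_def fun_eq_iff)
  then show ?thesis
    by (simp only: linear_compose_scale_right[OF bdiff_linear[OF beta]])
qed

lemma metric_deriv_static:
  "metric_deriv \<kappa>' g' (p, s) (w, c) (u, a) (v, b) = dlapse p w * (a * b) + metric_deriv \<kappa> g p w u v"
proof -
  let ?x = "coord_at \<kappa> p" and ?z = "(coord_at \<kappa> p, s)"
  have fst: "(fst has_derivative fst) (at ?z)"
    by (rule bounded_linear_imp_has_derivative[OF bounded_linear_fst])
  have "((\<lambda>x. inverse (fun_rep \<kappa> \<beta> p x) * (a * b) + metric_rep \<kappa> g p x u v) has_derivative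
      (\<lambda>w. dlapse p w * (a * b) + metric_deriv \<kappa> g p w u v)) (at ?x)"
    unfolding dlapse_def
  proof (intro has_derivative_add has_derivative_mult_left)
    show "((\<lambda>x. inverse (fun_rep \<kappa> \<beta> p x)) has_derivative (\<lambda>x. - (inverse (\<beta> p) * bdiff \<kappa> \<beta> p x * inverse (\<beta> p)))) (at ?x)"
      using Deriv.has_derivative_inverse[OF _ bdiff_deriv[OF beta], of p] beta_nonzero fun_rep_coord_at[OF manifold, of \<beta> p]
      by simp
    show "((\<lambda>x. metric_rep \<kappa> g p x u v) has_derivative (\<lambda>w. metric_deriv \<kappa> g p w u v)) (at ?x)"
      unfolding metric_deriv_def using metric_rep_differentiable[OF coord_at_in[OF manifold]]
      by (simp add: frechet_derivative_works)
  qed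
  from has_derivative_compose[OF fst, simplified, OF this]
  have "((\<lambda>z. inverse (fun_rep \<kappa> \<beta> p (fst z)) * (a * b) + metric_rep \<kappa> g p (fst z) u v) has_derivative
      (\<lambda>w. dlapse p (fst w) * (a * b) + metric_deriv \<kappa> g p (fst w) u v)) (at ?z)" .
  then have "((\<lambda>z. metric_rep \<kappa>' g' (p, s) z (u, a) (v, b)) has_derivative
      (\<lambda>w. dlapse p (fst w) * (a * b) + metric_deriv \<kappa> g p (fst w) u v)) (at ?z)"
    by (rule has_derivative_transform_within_open[OF _ open_product_coords[OF manifold, of p]])
      (auto simp: coord_at_in[OF manifold] metric_rep_times_line[OF manifold])
  from frechet_derivative_at[OF this, symmetric] show ?thesis
    by (simp add: metric_deriv_def[of \<kappa>'] coord_at_times_line[OF manifold])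
qed

lemma sharp_static:
  assumes \<eta>: "linear \<eta>"
  shows "sharp g' (p, s) \<eta> = (sharp g p (\<lambda>v. \<eta> (v, 0)), \<beta> p * \<eta> (0, 1))"
  unfolding sharp_def[of g']
proof (rule the_equality)
  have lin: "linear (\<lambda>v. \<eta> (v, 0))"
    using linear_compose[OF bounded_linear.linear[OF bounded_linear_Pair[OF bounded_linear_ident bounded_linear_zero]] \<eta>]
    by (simp add: comp_def)
  have split: "\<eta> (v, b) = \<eta> (v, 0) + b * \<eta> (0, 1)" for v and b :: real
    using linear_add[OF \<eta>, of "(v, 0)" "(0, b)"] linear_cmul[OF \<eta>, of b "(0, 1)"] by simp
  show "\<forall>v. g' (p, s) (sharp g p (\<lambda>v. \<eta> (v, 0)), \<beta> p * \<eta> (0, 1)) v = \<eta> v"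
  proof (intro allI)
    fix w :: "'e \<times> real"
    obtain v b where w: "w = (v, b)" by (cases w)
    show "g' (p, s) (sharp g p (\<lambda>v. \<eta> (v, 0)), \<beta> p * \<eta> (0, 1)) w = \<eta> w"
      unfolding w split[of v b] using beta_nonzero[of p]
      by (simp add: static_metric_def sharp_works[OF lin])
  qed
next
  fix w assume w: "\<forall>v. g' (p, s) w v = \<eta> v"
  have "sharp g p (\<lambda>v. \<eta> (v, 0)) = fst w"
  proof (rule sharp_eq)
    fix v show "g p (fst w) v = \<eta> (v, 0)"
      using w[rule_format, of "(v, 0)"] by (cases w) (simp add: static_metric_def)
  qed
  moreover have "\<beta> p * \<eta> (0, 1) = snd w"
    using w[rule_format, of "(0, 1)"] beta_nonzero[of p] linear_0[OF metric_linear(1)]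
    by (cases w) (simp add: static_metric_def field_simps)
  ultimately show "w = (sharp g p (\<lambda>v. \<eta> (v, 0)), \<beta> p * \<eta> (0, 1))"
    by (cases w) simp
qed

text \<open>The metric is block diagonal and independent of time, so besides the symbols of \<open>g\<close> only
  derivatives of the coefficient \<open>\<beta>\<^sup>-\<^sup>1\<close> of \<open>dt \<otimes> dt\<close> contribute: along \<open>M\<close> through \<open>dt(X) dt(Y)\<close>, and in the
  time direction through mixed arguments.\<close>

lemma christoffel_static:
  "christoffel \<kappa>' g' (p, s) (u, a) (v, b) =
     (sharp g p (\<lambda>z. (metric_deriv \<kappa> g p u v z + metric_deriv \<kappa> g p v u z - metric_deriv \<kappa> g p z u v) / 2
        - dlapse p z * (a * b) / 2),
      \<beta> p * ((dlapse p u * b + dlapse p v * a) / 2))"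
proof -
  let ?\<eta> = "\<lambda>z. (metric_deriv \<kappa>' g' (p, s) (u, a) (v, b) z + metric_deriv \<kappa>' g' (p, s) (v, b) (u, a) z
     - metric_deriv \<kappa>' g' (p, s) z (u, a) (v, b)) / 2"
  note lin = metric_deriv_linear metric_deriv_linear_dir dlapse_linear
  have "linear ?\<eta>"
  proof (rule linearI)
    fix y z :: "'e \<times> real" and c :: real
    show "?\<eta> (y + z) = ?\<eta> y + ?\<eta> z"
      by (cases y; cases z)
        (simp add: metric_deriv_static linear_add[OF lin(1)] linear_add[OF lin(2)] linear_add[OF lin(3)] field_simps)
    show "?\<eta> (c *\<^sub>R z) = c *\<^sub>R ?\<eta> z"
      by (cases z)
        (simp add: metric_deriv_static linear_cmul[OF lin(1)] linear_cmul[OF lin(2)] linear_cmul[OF lin(3)] field_simps)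
  qed
  moreover have "(\<lambda>z. ?\<eta> (z, 0)) = (\<lambda>z. (metric_deriv \<kappa> g p u v z + metric_deriv \<kappa> g p v u z
      - metric_deriv \<kappa> g p z u v) / 2 - dlapse p z * (a * b) / 2)"
    by (simp add: metric_deriv_static fun_eq_iff field_simps)
  moreover have "?\<eta> (0, 1) = (dlapse p u * b + dlapse p v * a) / 2"
    by (simp add: metric_deriv_static linear_0[OF lin(1)] linear_0[OF lin(2)] linear_0[OF lin(3)])
  ultimately show ?thesis
    unfolding christoffel_def[of \<kappa>'] by (simp only: sharp_static)
qed

lemma christoffel_static_space:
  "christoffel \<kappa>' g' (p, s) (u, 0) (v, 0) = (christoffel \<kappa> g p u v, 0)"
  by (subst christoffel_static) (simp add: christoffel_def)

text \<open>The second argument is the vector that \<open>sharp\<close> assigns to \<open>dt\<close>, as it occurs in the metric trace of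
  the Hessian.\<close>

lemma christoffel_static_time:
  "christoffel \<kappa>' g' (p, s) (0, 1) (0, \<beta> p) = (sharp g p (\<lambda>z. inverse (\<beta> p) * bdiff \<kappa> \<beta> p z / 2), 0)"
proof -
  note lin = metric_deriv_linear metric_deriv_linear_dir dlapse_linear
  have z: "metric_deriv \<kappa> g p z 0 0 = 0" for z
    using linear_0[OF lin(1)] .
  have z': "metric_deriv \<kappa> g p 0 u z = 0" for u z
    using linear_0[OF lin(2)] .
  have e: "- (dlapse p z * \<beta> p / 2) = inverse (\<beta> p) * bdiff \<kappa> \<beta> p z / 2" for z
    using beta_nonzero[of p] by (simp add: dlapse_def field_simps)
  show ?thesis
    by (simp add: christoffel_static z z' linear_0[OF lin(3)] e)
qed

section \<open>Laplace-Beltrami operator of a static metric\<close>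

text \<open>In coordinates \<open>nord_eval F\<close> and its first derivatives are finite sums of products of a function on
  \<open>M\<close> and a function of time; this is the differentiation rule for all of them.\<close>

lemma separated_deriv:
  fixes h :: "'i \<Rightarrow> 'e \<Rightarrow> real"
  assumes "\<And>n. n \<in> I \<Longrightarrow> h n differentiable at x"
    and "\<And>n. n \<in> I \<Longrightarrow> (\<phi> n has_field_derivative \<phi>' n) (at r)"
  shows "((\<lambda>z. \<Sum>n\<in>I. h n (fst z) * \<phi> n (snd z)) has_derivative
     (\<lambda>w. \<Sum>n\<in>I. frechet_derivative (h n) (at x) (fst w) * \<phi> n r + h n x * (\<phi>' n * snd w))) (at (x, r))"
proof (rule has_derivative_sum)
  fix n assume n: "n \<in> I"
  have fst: "(fst has_derivative fst) (at (x, r))"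
    by (rule bounded_linear_imp_has_derivative[OF bounded_linear_fst])
  have snd: "(snd has_derivative snd) (at (x, r))"
    by (rule bounded_linear_imp_has_derivative[OF bounded_linear_snd])
  have "((\<lambda>z. h n (fst z)) has_derivative (\<lambda>w. frechet_derivative (h n) (at x) (fst w))) (at (x, r))"
    by (rule has_derivative_compose[OF fst]) (use assms(1)[OF n] in \<open>simp add: frechet_derivative_works\<close>)
  moreover have "((\<lambda>z. \<phi> n (snd z)) has_derivative (\<lambda>w. \<phi>' n * snd w)) (at (x, r))"
    by (rule has_derivative_compose[OF snd])
      (use assms(2)[OF n] in \<open>simp add: has_field_derivative_def\<close>)
  ultimately show "((\<lambda>z. h n (fst z) * \<phi> n (snd z)) has_derivative
     (\<lambda>w. frechet_derivative (h n) (at x) (fst w) * \<phi> n r + h n x * (\<phi>' n * snd w))) (at (x, r))"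
    by (rule has_derivative_eq_rhs[OF has_derivative_mult]) (simp add: fun_eq_iff algebra_simps)
qed

lemma power_deriv: "((\<lambda>r. r ^ n) has_field_derivative real n * r ^ (n - 1)) (at (r::real))"
  by (rule derivative_eq_intros refl)+ (simp add: One_nat_def)

lemma power_deriv2: "((\<lambda>r. real n * r ^ (n - 1) * b) has_field_derivative real n * (real (n - 1) * r ^ (n - 2)) * b) (at (r::real))"
  by (rule DERIV_cmult_right, rule DERIV_cmult) (use power_deriv[of "n - 1" r] in simp)

context
  fixes F :: "nat \<Rightarrow> 'm \<Rightarrow> real"
  assumes F: "F \<in> nord_carrier \<kappa>"
begin

lemma F_smooth: "F n \<in> CM \<kappa>"
  using F by (rule carrier_coeff)

lemma nord_eval_rep:
  assumes "x \<in> coord_image \<kappa> p"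
  shows "fun_rep \<kappa>' (nord_eval F) (p, s) (x, r) = (\<Sum>n | F n \<noteq> 0. fun_rep \<kappa> (F n) p x * r ^ n)"
  unfolding fun_rep_times_line[OF manifold assms] by (simp add: nord_eval_def fun_rep_def)

lemma nord_eval_rep_deriv:
  assumes x: "x \<in> coord_image \<kappa> p"
  shows "frechet_derivative (fun_rep \<kappa>' (nord_eval F) (p, s)) (at (x, r)) (v, b)
     = (\<Sum>n | F n \<noteq> 0. frechet_derivative (fun_rep \<kappa> (F n) p) (at x) v * r ^ n
          + fun_rep \<kappa> (F n) p x * (real n * r ^ (n - 1) * b))"
proof -
  have "((\<lambda>z. \<Sum>n | F n \<noteq> 0. fun_rep \<kappa> (F n) p (fst z) * snd z ^ n) has_derivative
     (\<lambda>w. \<Sum>n | F n \<noteq> 0. frechet_derivative (fun_rep \<kappa> (F n) p) (at x) (fst w) * r ^ n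
        + fun_rep \<kappa> (F n) p x * (real n * r ^ (n - 1) * snd w))) (at (x, r))"
    by (rule separated_deriv) (auto intro: CM_differentiable[OF F_smooth x] power_deriv)
  then have "(fun_rep \<kappa>' (nord_eval F) (p, s) has_derivative
     (\<lambda>w. \<Sum>n | F n \<noteq> 0. frechet_derivative (fun_rep \<kappa> (F n) p) (at x) (fst w) * r ^ n
        + fun_rep \<kappa> (F n) p x * (real n * r ^ (n - 1) * snd w))) (at (x, r))"
    by (rule has_derivative_transform_within_open[OF _ open_product_coords[OF manifold, of p]])
      (use x in \<open>auto simp: nord_eval_rep\<close>)
  from frechet_derivative_at[OF this, symmetric] show ?thesis
    by simp
qed

lemma bdiff_nord_eval:
  "bdiff \<kappa>' (nord_eval F) (p, s) (v, 0) = (\<Sum>n | F n \<noteq> 0. bdiff \<kappa> (F n) p v * s ^ n)"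
  by (simp add: bdiff_def coord_at_times_line[OF manifold] nord_eval_rep_deriv coord_at_in[OF manifold])

lemma hessian_space:
  "hessian \<kappa>' g' (nord_eval F) (p, s) (u, 0) (v, 0) = (\<Sum>n | F n \<noteq> 0. hessian \<kappa> g (F n) p u v * s ^ n)"
proof -
  let ?x = "coord_at \<kappa> p"
  let ?D = "\<lambda>n x. frechet_derivative (fun_rep \<kappa> (F n) p) (at x) v"
  have "((\<lambda>z. \<Sum>n | F n \<noteq> 0. ?D n (fst z) * snd z ^ n) has_derivative
     (\<lambda>w. \<Sum>n | F n \<noteq> 0. frechet_derivative (?D n) (at ?x) (fst w) * s ^ n
        + ?D n ?x * (real n * s ^ (n - 1) * snd w))) (at (?x, s))"
    by (rule separated_deriv)
      (auto intro: CM_deriv_differentiable[OF F_smooth coord_at_in[OF manifold]] power_deriv)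
  then have "((\<lambda>z. frechet_derivative (fun_rep \<kappa>' (nord_eval F) (p, s)) (at z) (v, 0)) has_derivative
     (\<lambda>w. \<Sum>n | F n \<noteq> 0. frechet_derivative (?D n) (at ?x) (fst w) * s ^ n
        + ?D n ?x * (real n * s ^ (n - 1) * snd w))) (at (?x, s))"
    by (rule has_derivative_transform_within_open[OF _ open_product_coords[OF manifold, of p]])
      (auto simp: nord_eval_rep_deriv coord_at_in[OF manifold])
  from frechet_derivative_at[OF this, symmetric] show ?thesis
    by (simp add: hessian_def[of \<kappa>'] coord_at_times_line[OF manifold] christoffel_static_space bdiff_nord_eval)
      (simp add: hessian_def sum_subtractf[symmetric] left_diff_distrib)
qed

lemma hessian_time:
  "hessian \<kappa>' g' (nord_eval F) (p, s) (0, 1) (0, \<beta> p) =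
     \<beta> p * (\<Sum>n | F n \<noteq> 0. F n p * (real n * (real (n - 1) * s ^ (n - 2))))
     - (\<Sum>n | F n \<noteq> 0. bdiff \<kappa> (F n) p (sharp g p (\<lambda>z. inverse (\<beta> p) * bdiff \<kappa> \<beta> p z / 2)) * s ^ n)"
proof -
  let ?x = "coord_at \<kappa> p" and ?b = "\<beta> p"
  have "((\<lambda>z. \<Sum>n | F n \<noteq> 0. fun_rep \<kappa> (F n) p (fst z) * (real n * snd z ^ (n - 1) * ?b)) has_derivative
     (\<lambda>w. \<Sum>n | F n \<noteq> 0. frechet_derivative (fun_rep \<kappa> (F n) p) (at ?x) (fst w) * (real n * s ^ (n - 1) * ?b)
        + fun_rep \<kappa> (F n) p ?x * (real n * (real (n - 1) * s ^ (n - 2)) * ?b * snd w))) (at (?x, s))"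
    by (rule separated_deriv)
      (auto intro: CM_differentiable[OF F_smooth coord_at_in[OF manifold]] power_deriv2)
  then have "((\<lambda>z. frechet_derivative (fun_rep \<kappa>' (nord_eval F) (p, s)) (at z) (0, ?b)) has_derivative
     (\<lambda>w. \<Sum>n | F n \<noteq> 0. frechet_derivative (fun_rep \<kappa> (F n) p) (at ?x) (fst w) * (real n * s ^ (n - 1) * ?b)
        + fun_rep \<kappa> (F n) p ?x * (real n * (real (n - 1) * s ^ (n - 2)) * ?b * snd w))) (at (?x, s))"
    by (rule has_derivative_transform_within_open[OF _ open_product_coords[OF manifold, of p]])
      (auto simp: nord_eval_rep_deriv coord_at_in[OF manifold]
        linear_0[OF linear_frechet_derivative[OF CM_differentiable[OF F_smooth]]])
  from frechet_derivative_at[OF this, symmetric] show ?thesis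
    by (simp add: hessian_def[of \<kappa>'] coord_at_times_line[OF manifold] christoffel_static_time bdiff_nord_eval
        linear_0[OF linear_frechet_derivative[OF CM_differentiable[OF F_smooth coord_at_in[OF manifold]]]]
        fun_rep_coord_at[OF manifold] sum_distrib_left mult.commute mult.left_commute)
qed

text \<open>The trace splits over the orthogonal directions of \<open>M\<close> and of time: the former give the
  Laplace-Beltrami operator of \<open>g\<close> coefficientwise, the latter the second time derivative and the
  first order term coming from \<open>\<Gamma>(\<partial>\<^sub>t, \<partial>\<^sub>t)\<close>.\<close>

lemma laplace_beltrami_static:
  "laplace_beltrami \<kappa>' g' (nord_eval F) (p, s) =
     (\<Sum>n | F n \<noteq> 0. laplace_beltrami \<kappa> g (F n) p * s ^ n)
     + \<beta> p * (\<Sum>n | F n \<noteq> 0. F n p * (real n * (real (n - 1) * s ^ (n - 2))))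
     - (\<Sum>n | F n \<noteq> 0. bdiff \<kappa> (F n) p (sharp g p (\<lambda>z. inverse (\<beta> p) * bdiff \<kappa> \<beta> p z / 2)) * s ^ n)"
proof -
  let ?h = "\<lambda>i. hessian \<kappa>' g' (nord_eval F) (p, s) i (sharp g' (p, s) (\<lambda>v. i \<bullet> v))"
  have lin: "linear (\<lambda>v. i \<bullet> v)" for i :: "'e \<times> real"
    by (rule bounded_linear.linear[OF bounded_linear_inner_right])
  have "laplace_beltrami \<kappa>' g' (nord_eval F) (p, s) = (\<Sum>b\<in>Basis. ?h (b, 0)) + (\<Sum>b\<in>Basis. ?h (0, b))"
    unfolding laplace_beltrami_def Basis_prod_def
    by (subst sum.union_disjoint) (auto simp: sum.reindex inj_on_def)
  also have "(\<Sum>b\<in>(Basis :: real set). ?h (0, b)) = hessian \<kappa>' g' (nord_eval F) (p, s) (0, 1) (0, \<beta> p)"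
    by (simp add: sharp_static[OF lin] sharp_zero)
  also have "(\<Sum>b\<in>Basis. ?h (b, 0)) = (\<Sum>b\<in>Basis. \<Sum>n | F n \<noteq> 0. hessian \<kappa> g (F n) p b (sharp g p (\<lambda>v. b \<bullet> v)) * s ^ n)"
    by (simp add: sharp_static[OF lin] hessian_space)
  also have "\<dots> = (\<Sum>n | F n \<noteq> 0. laplace_beltrami \<kappa> g (F n) p * s ^ n)"
    by (subst sum.swap) (simp add: laplace_beltrami_def sum_distrib_right)
  finally show ?thesis
    by (simp add: hessian_time)
qed

end

end

section \<open>The wave operator and its classical limit\<close>

text \<open>The condition on \<open>\<zeta>\<close> says that \<open>- \<zeta>\<close> is the vector dual to \<open>1/2 \<beta>\<^sup>-\<^sup>1 d\<beta>\<close>, so that the first order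
  term in \<open>laplace_beltrami_static\<close> is the drift \<open>\<zeta>(f)\<close> of the operator \<open>\<Delta>\<close>.\<close>

lemma (in static) classical_wave_eval:
  assumes F: "F \<in> nord_carrier \<kappa>"
    and G: "G = coeff_laplace \<kappa> g \<zeta> F + (\<lambda>n. \<beta> * tdiff (tdiff F) n)" "G \<in> nord_carrier \<kappa>"
    and \<zeta>: "flat g \<zeta> = (\<lambda>p v. - (1 / 2) * inverse (\<beta> p) * bdiff \<kappa> \<beta> p v)"
    and bl0: "blaplace \<kappa> g \<zeta> 0 = 0"
  shows "nord_eval G = laplace_beltrami (times_line \<kappa>) (static_metric \<beta> g) (nord_eval F)"
proof (intro ext, clarify)
  fix p s
  let ?I = "{n. F n \<noteq> 0}"
  have fin: "finite ?I" "finite {n. G n \<noteq> 0}"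
    using F G(2) by (simp_all add: carrier_finite)
  obtain N where N: "\<And>n. n \<in> ?I \<union> {n. G n \<noteq> 0} \<Longrightarrow> n < N"
    using fin finite_nat_set_iff_bounded[of "?I \<union> {n. G n \<noteq> 0}"] by blast
  have zero: "F n = 0" if "n \<ge> N" for n
    using N[of n] that by force
  have \<zeta>_eq: "sharp g p (\<lambda>z. inverse (\<beta> p) * bdiff \<kappa> \<beta> p z / 2) = - \<zeta> p"
  proof (rule sharp_eq)
    fix v show "g p (- \<zeta> p) v = inverse (\<beta> p) * bdiff \<kappa> \<beta> p v / 2"
      using fun_cong[OF fun_cong[OF \<zeta>, of p], of v] linear_neg[OF metric_linear(2), of p "\<zeta> p" v]
      by (simp add: flat_def)
  qed
  have bd: "bdiff \<kappa> (F n) p (- \<zeta> p) = - vf_apply \<kappa> \<zeta> (F n) p" for n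
    using linear_neg[OF bdiff_linear[OF carrier_coeff[OF F]]] by (simp add: vf_apply_def)
  \<comment> \<open>the common range \<open>n < N\<close> allows for the shift of indices by two in the second derivative\<close>
  have "nord_eval G (p, s) = (\<Sum>n<N. G n p * s ^ n)"
    unfolding nord_eval_def prod.case using N by (intro sum.mono_neutral_left) auto
  also have "\<dots> = (\<Sum>n<N. blaplace \<kappa> g \<zeta> (F n) p * s ^ n)
      + \<beta> p * (\<Sum>n<N. real (n + 1) * real (n + 2) * F (n + 2) p * s ^ n)"
    by (simp add: G(1) coeff_laplace_def tdiff_def sum.distrib sum_distrib_left algebra_simps)
  also have "(\<Sum>n<N. blaplace \<kappa> g \<zeta> (F n) p * s ^ n) = (\<Sum>n\<in>?I. blaplace \<kappa> g \<zeta> (F n) p * s ^ n)"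
    using N by (intro sum.mono_neutral_right) (auto simp: bl0)
  also have "(\<Sum>n<N. real (n + 1) * real (n + 2) * F (n + 2) p * s ^ n)
      = (\<Sum>n<Suc (Suc N). F n p * (real n * (real (n - 1) * s ^ (n - 2))))"
    unfolding sum.lessThan_Suc_shift by (simp add: algebra_simps)
  also have "\<dots> = (\<Sum>n\<in>?I. F n p * (real n * (real (n - 1) * s ^ (n - 2))))"
    using N by (intro sum.mono_neutral_right) (auto simp: less_Suc_eq)
  also have "(\<Sum>n\<in>?I. blaplace \<kappa> g \<zeta> (F n) p * s ^ n) =
      (\<Sum>n\<in>?I. laplace_beltrami \<kappa> g (F n) p * s ^ n) - (\<Sum>n\<in>?I. bdiff \<kappa> (F n) p (- \<zeta> p) * s ^ n)"
    by (simp add: blaplace_def bd sum.distrib sum_negf algebra_simps)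
  finally have "nord_eval G (p, s) =
      (\<Sum>n\<in>?I. laplace_beltrami \<kappa> g (F n) p * s ^ n) - (\<Sum>n\<in>?I. bdiff \<kappa> (F n) p (- \<zeta> p) * s ^ n)
      + \<beta> p * (\<Sum>n\<in>?I. F n p * (real n * (real (n - 1) * s ^ (n - 2))))" .
  then show "nord_eval G (p, s) = laplace_beltrami (times_line \<kappa>) (static_metric \<beta> g) (nord_eval F) (p, s)"
    unfolding laplace_beltrami_static[OF F] \<zeta>_eq by simp
qed

theorem corollary3p4:
  fixes \<kappa> :: "('m::{t2_space,second_countable_topology}, 'e::euclidean_space) mfd"
    and g :: "'m \<Rightarrow> 'e \<Rightarrow> 'e \<Rightarrow> real"
    and \<zeta> \<tau> :: "'m \<Rightarrow> 'e"
    and \<beta> :: "'m \<Rightarrow> real"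
    and S :: "real \<Rightarrow> ('m, 'e) st_calculus"
  assumes "smooth_manifold \<kappa>"
    and "riemannian_metric \<kappa> g"
    and "vector_field \<kappa> \<zeta>"
    and "\<beta> \<in> CM \<kappa>"
    and "conformal_killing \<kappa> g \<tau>"
    and "\<And>lam. lam \<noteq> 0 \<Longrightarrow> spacetime_calculus \<kappa> g \<tau> \<zeta> \<beta> lam (S lam)"
  shows "(\<forall>lam. lam \<noteq> 0 \<longrightarrow> (\<forall>F\<in>nord_carrier \<kappa>.
            (\<exists>!B. is_wave \<kappa> (S lam) lam F B) \<and>
            wave \<kappa> (S lam) lam F =
              shift_by \<kappa> (S lam) lam (ck_alpha \<kappa> g \<tau>) (coeff_laplace \<kappa> g \<zeta> F)
              + nscale 2 (Delta0 \<kappa> (S lam) lam F)))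
       \<and> (\<forall>F\<in>nord_carrier \<kappa>.
            classical_limit \<kappa> (\<lambda>lam. wave \<kappa> (S lam) lam F)
              (coeff_laplace \<kappa> g \<zeta> F + (\<lambda>n. \<beta> * tdiff (tdiff F) n)))
       \<and> ((\<exists>b\<in>CM \<kappa>. \<beta> * b = 1) \<and>
          flat g \<zeta> = (\<lambda>p v. - (1 / 2) * inverse (\<beta> p) * bdiff \<kappa> \<beta> p v) \<longrightarrow>
            (\<forall>F\<in>nord_carrier \<kappa>. \<exists>G\<in>nord_carrier \<kappa>.
               classical_limit \<kappa> (\<lambda>lam. wave \<kappa> (S lam) lam F) G \<and>
               nord_eval G =
                 laplace_beltrami (times_line \<kappa>) (static_metric \<beta> g) (nord_eval F)))"
proof -
  interpret fam: spacetime_family \<kappa> g \<tau> \<zeta> \<beta> S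
    using assms by unfold_locales
  have fixed: "(\<exists>!B. is_wave \<kappa> (S lam) lam F B) \<and> wave \<kappa> (S lam) lam F =
              shift_by \<kappa> (S lam) lam (ck_alpha \<kappa> g \<tau>) (coeff_laplace \<kappa> g \<zeta> F)
              + nscale 2 (Delta0 \<kappa> (S lam) lam F)"
    if lam: "lam \<noteq> 0" and F: "F \<in> nord_carrier \<kappa>" for lam F
  proof -
    interpret spacetime \<kappa> g \<tau> \<zeta> \<beta> lam "S lam"
      using lam by (rule fam.at_param)
    show ?thesis
      using F by (simp add: is_wave_iff wave_eq wave_formula_def)
  qed
  let ?G = "\<lambda>F. coeff_laplace \<kappa> g \<zeta> F + (\<lambda>n. \<beta> * tdiff (tdiff F) n)"
  have limit: "classical_limit \<kappa> (\<lambda>lam. wave \<kappa> (S lam) lam F) (?G F)" and closed: "?G F \<in> nord_carrier \<kappa>"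
    if F: "F \<in> nord_carrier \<kappa>" for F
    using fam.lpoly_limit[OF fam.lpoly_wave[OF F]] fam.lpoly_closed[OF fam.lpoly_wave[OF F]] by blast+
  have geometric: "nord_eval (?G F) = laplace_beltrami (times_line \<kappa>) (static_metric \<beta> g) (nord_eval F)"
    if inv: "\<exists>b\<in>CM \<kappa>. \<beta> * b = 1"
      and \<zeta>: "flat g \<zeta> = (\<lambda>p v. - (1 / 2) * inverse (\<beta> p) * bdiff \<kappa> \<beta> p v)"
      and F: "F \<in> nord_carrier \<kappa>" for F
  proof -
    interpret static \<kappa> g \<beta>
    proof
      fix p
      obtain b where "\<beta> * b = 1" using inv by blast
      then have "\<beta> p * b p = 1" by (metis one_fun_apply times_fun_apply)
      then show "\<beta> p \<noteq> 0" by auto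
    qed (use assms in auto)
    show ?thesis
      by (rule classical_wave_eval[OF F refl closed[OF F] \<zeta> fam.one.blaplace_zero])
  qed
  show ?thesis
  proof (intro conjI allI ballI impI)
    fix lam :: real and F :: "'m nord" assume "lam \<noteq> 0" "F \<in> nord_carrier \<kappa>"
    from fixed[OF this]
    show "\<exists>!B. is_wave \<kappa> (S lam) lam F B"
      and "wave \<kappa> (S lam) lam F = shift_by \<kappa> (S lam) lam (ck_alpha \<kappa> g \<tau>) (coeff_laplace \<kappa> g \<zeta> F)
              + nscale 2 (Delta0 \<kappa> (S lam) lam F)"
      by (rule conjunct1, rule conjunct2)
  next
    fix F :: "'m nord" assume "F \<in> nord_carrier \<kappa>"
    then show "classical_limit \<kappa> (\<lambda>lam. wave \<kappa> (S lam) lam F) (?G F)"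
      by (rule limit)
  next
    fix F :: "'m nord"
    assume "(\<exists>b\<in>CM \<kappa>. \<beta> * b = 1) \<and>
          flat g \<zeta> = (\<lambda>p v. - (1 / 2) * inverse (\<beta> p) * bdiff \<kappa> \<beta> p v)"
      and F: "F \<in> nord_carrier \<kappa>"
    then have "nord_eval (?G F) = laplace_beltrami (times_line \<kappa>) (static_metric \<beta> g) (nord_eval F)"
      by (intro geometric) (rule conjunct1, assumption, rule conjunct2, assumption)
    with limit[OF F] closed[OF F]
    show "\<exists>G\<in>nord_carrier \<kappa>. classical_limit \<kappa> (\<lambda>lam. wave \<kappa> (S lam) lam F) G \<and>
        nord_eval G = laplace_beltrami (times_line \<kappa>) (static_metric \<beta> g) (nord_eval F)"
      by (intro bexI[of _ "?G F"] conjI)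
  qed
qed

end
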